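(* Let $(X,\varphi)$ be a Cantor minimal system. The commutator subgroup $D([[\varphi]]_0)$ is finitely generated if and only if $(X,\varphi)$ is conjugate to a minimal subshift.
   Context: A Cantor minimal system $(X,\varphi)$ is a Cantor set $X$ (compact, metrizable, perfect, totally disconnected, nonempty) with a homeomorphism $\varphi$ of $X$ that is minimal: the only closed $\varphi$-invariant subsets are $\emptyset$ and $X$. The topological full group $[[\varphi]]$ is the group of all homeomorphisms $\gamma$ of $X$ for which there is a continuous map $n_\gamma:X\to\mathbb{Z}$ with $\gamma(x)=\varphi^{n_\gamma(x)}(x)$ for all $x\in X$. The index map $I:[[\varphi]]\to\mathbb{Z}$ is $I(\gamma)=\int n_\gamma\,d\mu$, where $\mu$ is a $\varphi$-invariant probability measure; it is known that $I(\gamma)$ is an integer independent of $\mu$ and that $I$ is a surjective homomorphism. $[[\varphi]]_0$ is the kernel of $I$. For a group $H$, $D(H)$ is its commutator subgroup. A subshift is a closed shift-invariant subset of $A^{\mathbb{Z}}$ ($A$ a finite set, product topology) together with the restriction of the two-sided shift; it is minimal if that restriction is a minimal homeomorphism. Conjugate means topologically conjugate via a homeomorphism intertwining the two maps. *)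

theory Defs
  imports
    "HOL-Probability.Probability_Measure"
    "HOL-Algebra.Elementary_Groups"
    "HOL-Combinatorics.Permutations"
begin

definition invariant_set :: "('a \<Rightarrow> 'a) \<Rightarrow> 'a set \<Rightarrow> bool" where
  "invariant_set f Y \<longleftrightarrow> f ` Y = Y"

definition minimal_homeo :: "'a topology \<Rightarrow> ('a \<Rightarrow> 'a) \<Rightarrow> bool" where
  "minimal_homeo X f \<longleftrightarrow> homeomorphic_map X X f \<and>
     (\<forall>Y. closedin X Y \<and> invariant_set f Y \<longrightarrow> Y = {} \<or> Y = topspace X)"

definition cantor_space :: "'a topology \<Rightarrow> bool" where
  "cantor_space X \<longleftrightarrow> topspace X \<noteq> {} \<and> compact_space X \<and> metrizable_space X \<and>
     X derived_set_of topspace X = topspace X \<and>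
     (\<forall>S. connectedin X S \<longrightarrow> (\<exists>a. S \<subseteq> {a}))"

definition cantor_minimal_system :: "'a topology \<Rightarrow> ('a \<Rightarrow> 'a) \<Rightarrow> bool" where
  "cantor_minimal_system X \<phi> \<longleftrightarrow> cantor_space X \<and> minimal_homeo X \<phi>"

text \<open>The inverse of \<open>\<phi>\<close> is taken inside the space, because the values of \<open>\<phi>\<close> outside
  \<open>topspace X\<close> are arbitrary.\<close>

definition int_iterate :: "'a topology \<Rightarrow> ('a \<Rightarrow> 'a) \<Rightarrow> int \<Rightarrow> 'a \<Rightarrow> 'a" where
  "int_iterate X \<phi> k = (if 0 \<le> k then \<phi> ^^ nat k else inv_into (topspace X) \<phi> ^^ nat (- k))"

definition is_orbit_cocycle ::
  "'a topology \<Rightarrow> ('a \<Rightarrow> 'a) \<Rightarrow> ('a \<Rightarrow> 'a) \<Rightarrow> ('a \<Rightarrow> int) \<Rightarrow> bool" where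
  "is_orbit_cocycle X \<phi> \<gamma> n \<longleftrightarrow> continuous_map X (discrete_topology UNIV) n \<and>
     (\<forall>x\<in>topspace X. \<gamma> x = int_iterate X \<phi> (n x) x)"

text \<open>A homeomorphism of the space is represented by the function on the whole type that is the
  identity outside \<open>topspace X\<close> (this is what \<open>permutes\<close> adds), so that each homeomorphism has
  exactly one representative and the group operation is plain composition.\<close>

definition topological_full_group ::
  "'a topology \<Rightarrow> ('a \<Rightarrow> 'a) \<Rightarrow> ('a \<Rightarrow> 'a) monoid" where
  "topological_full_group X \<phi> =
     \<lparr>carrier = {\<gamma>. \<gamma> permutes topspace X \<and> homeomorphic_map X X \<gamma> \<and>
        (\<exists>n. is_orbit_cocycle X \<phi> \<gamma> n)},
      mult = (\<circ>), one = id\<rparr>"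

definition invariant_prob_measure :: "'a topology \<Rightarrow> ('a \<Rightarrow> 'a) \<Rightarrow> 'a measure \<Rightarrow> bool" where
  "invariant_prob_measure X \<phi> \<mu> \<longleftrightarrow> prob_space \<mu> \<and> space \<mu> = topspace X \<and>
     sets \<mu> = sigma_sets (topspace X) {U. openin X U} \<and>
     (\<forall>A\<in>sets \<mu>. emeasure \<mu> (\<phi> -` A \<inter> topspace X) = emeasure \<mu> A)"

text \<open>For a Cantor minimal system the cocycle of \<open>\<gamma>\<close> is unique on \<open>topspace X\<close>.\<close>

definition orbit_cocycle :: "'a topology \<Rightarrow> ('a \<Rightarrow> 'a) \<Rightarrow> ('a \<Rightarrow> 'a) \<Rightarrow> 'a \<Rightarrow> int" where
  "orbit_cocycle X \<phi> \<gamma> = (SOME n. is_orbit_cocycle X \<phi> \<gamma> n)"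

text \<open>For a Cantor minimal system invariant probability measures exist, and the integral below is
  an integer that does not depend on the choice of \<open>\<mu>\<close>.\<close>

definition index_map :: "'a topology \<Rightarrow> ('a \<Rightarrow> 'a) \<Rightarrow> ('a \<Rightarrow> 'a) \<Rightarrow> int" where
  "index_map X \<phi> \<gamma> = (THE i. \<forall>\<mu>. invariant_prob_measure X \<phi> \<mu> \<longrightarrow>
     real_of_int i = (\<integral>x. real_of_int (orbit_cocycle X \<phi> \<gamma> x) \<partial>\<mu>))"

definition index_kernel :: "'a topology \<Rightarrow> ('a \<Rightarrow> 'a) \<Rightarrow> ('a \<Rightarrow> 'a) set" where
  "index_kernel X \<phi> = kernel (topological_full_group X \<phi>) integer_group (index_map X \<phi>)"

definition finitely_generated_subgroup :: "('g, 'b) monoid_scheme \<Rightarrow> 'g set \<Rightarrow> bool" where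
  "finitely_generated_subgroup G H \<longleftrightarrow> (\<exists>S. finite S \<and> S \<subseteq> carrier G \<and> generate G S = H)"

definition shift :: "(int \<Rightarrow> 'b) \<Rightarrow> int \<Rightarrow> 'b" where
  "shift x = (\<lambda>k. x (k + 1))"

definition full_shift :: "'b set \<Rightarrow> (int \<Rightarrow> 'b) topology" where
  "full_shift A = product_topology (\<lambda>_. discrete_topology A) UNIV"

definition subshift :: "'b set \<Rightarrow> (int \<Rightarrow> 'b) set \<Rightarrow> bool" where
  "subshift A S \<longleftrightarrow> finite A \<and> closedin (full_shift A) S \<and> invariant_set shift S"

definition minimal_subshift :: "'b set \<Rightarrow> (int \<Rightarrow> 'b) set \<Rightarrow> bool" where
  "minimal_subshift A S \<longleftrightarrow> subshift A S \<and> minimal_homeo (subtopology (full_shift A) S) shift"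

definition conjugate ::
  "'a topology \<Rightarrow> ('a \<Rightarrow> 'a) \<Rightarrow> 'b topology \<Rightarrow> ('b \<Rightarrow> 'b) \<Rightarrow> bool" where
  "conjugate X f Y g \<longleftrightarrow>
     (\<exists>h. homeomorphic_map X Y h \<and> (\<forall>x\<in>topspace X. h (f x) = g (h x)))"

text \<open>Letters are natural numbers; every finite alphabet is in bijection with a finite set of
  them, and such a bijection induces a conjugacy of subshifts.\<close>

definition conjugate_to_minimal_subshift :: "'a topology \<Rightarrow> ('a \<Rightarrow> 'a) \<Rightarrow> bool" where
  "conjugate_to_minimal_subshift X \<phi> \<longleftrightarrow>
     (\<exists>(A :: nat set) S. minimal_subshift A S \<and>
        conjugate X \<phi> (subtopology (full_shift A) S) shift)"

end

theory Submission
  imports Defs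
begin

text \<open>Restricted to an orbit, an element of the topological full group is a permutation of the integers of
  bounded displacement, and its index is the net flow across a cut. If the index is zero, finitely many
  exchanges near a small clopen set \<open>C\<close> make the element preserve the pieces of orbits between visits to
  \<open>C\<close>; it then permutes the levels of Kakutani--Rokhlin towers. Hence the kernel of the index map is
  generated by the swaps of \<open>U\<close> and \<open>\<phi> U\<close>. Modulo the normal subgroup generated by the 3-cycles
  \<open>\<gamma>\<^sub>U\<close> on \<open>\<phi>\<^sup>-\<^sup>1 U, U, \<phi> U\<close> these swaps commute, and each \<open>\<gamma>\<^sub>U\<close> is a commutator of swaps, so the
  commutator subgroup is generated by the \<open>\<gamma>\<^sub>U\<close>.

  For a subshift, a cylinder of radius \<open>m + 1\<close> has the form \<open>\<phi> U \<inter> \<phi>\<^sup>-\<^sup>1 V\<close> with cylinders \<open>U, V\<close> of radius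
  \<open>m\<close>, and its 3-cycle is a commutator of \<open>\<gamma>\<^sub>U\<close> and \<open>\<gamma>\<^sub>V\<close> up to inverses; so the finitely many cylinders of one
  radius suffice. Conversely, the cocycles of finitely many generators define a coding of orbits. Points
  with the same code are moved alike by the whole commutator subgroup, but some \<open>\<gamma>\<^sub>U\<close> moves one of two
  given points and fixes the other, so the coding is injective.\<close>

subsection \<open>Topology, permutations and groups\<close>

text \<open>The recurring device is localization. There are no periodic points, so every point has a
  clopen neighbourhood with as many pairwise disjoint iterates as desired. A claim that is stable
  under disjoint unions of clopen sets only has to be checked on such small sets, where group
  elements become permutations of finitely many levels and identities become computations with a few
  integers.

  The obstacle is normality of the group generated by the 3-cycles. Conjugation scatters three
  consecutive levels, so 3-cycles on arbitrary levels must be shown to lie in that group; locally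
  they are even permutations of an interval of levels, which the consecutive 3-cycles generate.

  The flow is an integer by construction. Equating it with the integral for every invariant measure
  settles integrality and independence of the measure at once. An invariant measure must still be
  constructed: with none, the condition in \<open>index_map\<close> would be vacuous and would
  determine no integer.\<close>

lemma totally_disconnected_clopen_base:
  assumes "compact_space X" "Hausdorff_space X"
    and "\<And>S. connectedin X S \<Longrightarrow> \<exists>a. S \<subseteq> {a}"
    and "openin X U" "x \<in> U"
  obtains W where "openin X W" "closedin X W" "x \<in> W" "W \<subseteq> U"
proof -
  let ?C = "connected_component_of_set X x"
  have x: "x \<in> topspace X"
    using assms openin_subset by blast
  have "connectedin X ?C"
    by (rule connectedin_connected_component_of)
  then obtain a where "?C \<subseteq> {a}"
    using assms(3) by blast
  moreover have "x \<in> ?C"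
    using x by (simp add: connected_component_of_refl)
  ultimately have C: "?C = {x}"
    by auto
  have "compactin X ?C"
    using x by (simp add: C)
  moreover have "?C \<in> connected_components_of X"
    using x connected_component_in_connected_components_of by metis
  moreover have "locally_compact_space X"
    using assms(1) compact_imp_locally_compact_space by blast
  moreover have "?C \<subseteq> U"
    using assms(5) C by simp
  \<comment> \<open>Wilder's theorem fits a set that is open with open complement between the
    compact component of \<open>x\<close> and \<open>U\<close>.\<close>
  ultimately obtain A B where AB: "openin X A" "openin X B" "disjnt A B" "A \<union> B = topspace X"
      "?C \<subseteq> A" "A \<subseteq> U"
    using wilder_locally_compact_component_thm[OF _ assms(2) _ _ assms(4)] by metis
  then have "A = topspace X - B"
    by (auto simp: disjnt_iff)
  then have "closedin X A"
    using AB(2) by auto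
  then show thesis
    using that AB C by auto
qed

lemma minimal_homeo_conjugate:
  assumes h: "homeomorphic_map X Y h" and f: "minimal_homeo X f"
    and hf: "\<And>x. x \<in> topspace X \<Longrightarrow> h (f x) = g (h x)"
  shows "minimal_homeo Y g"
proof -
  obtain h' where h': "homeomorphic_maps X Y h h'"
    using h homeomorphic_map_maps by blast
  then have map_h': "homeomorphic_map Y X h'"
    using homeomorphic_maps_map homeomorphic_maps_sym by blast
  have inv: "h' (h x) = x" "h x \<in> topspace Y" if "x \<in> topspace X" for x
    using h' that by (auto simp: homeomorphic_maps_def continuous_map_def)
  have inv': "h (h' y) = y" "h' y \<in> topspace X" if "y \<in> topspace Y" for y
    using h' that by (auto simp: homeomorphic_maps_def continuous_map_def)
  have f_homeo: "homeomorphic_map X X f"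
    using f by (simp add: minimal_homeo_def)
  then have f_in: "f x \<in> topspace X" if "x \<in> topspace X" for x
    using that homeomorphic_imp_surjective_map by blast
  have conj: "f (h' y) = h' (g y)" if "y \<in> topspace Y" for y
    using hf[OF inv'(2)[OF that]] inv(1)[OF f_in[OF inv'(2)[OF that]]] inv'(1)[OF that] by simp
  have "homeomorphic_map Y Y (h \<circ> f \<circ> h')"
    using homeomorphic_map_compose[OF map_h' homeomorphic_map_compose[OF f_homeo h]] by (simp add: comp_assoc)
  then have "homeomorphic_map Y Y g"
    by (rule homeomorphic_map_eq) (simp add: hf inv')
  moreover have "Z = {} \<or> Z = topspace Y" if Z: "closedin Y Z" "g ` Z = Z" for Z
  proof -
    have ZY: "Z \<subseteq> topspace Y"
      using Z(1) by (rule closedin_subset)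
    have "closedin X (h' ` Z)"
      using map_h' Z(1) homeomorphic_map_closedness_eq by blast
    moreover have "f ` h' ` Z = h' ` Z"
    proof -
      have "f ` h' ` Z = (\<lambda>y. h' (g y)) ` Z"
        unfolding image_image using conj ZY by (intro image_cong) auto
      also have "\<dots> = h' ` Z"
        using Z(2) by (metis image_image)
      finally show ?thesis .
    qed
    ultimately have "h' ` Z = {} \<or> h' ` Z = topspace X"
      using f unfolding minimal_homeo_def invariant_set_def by blast
    moreover have "h ` h' ` Z = Z"
      unfolding image_image using inv'(1) ZY by (force simp: image_iff)
    moreover have "h ` topspace X = topspace Y"
      using h by (rule homeomorphic_imp_surjective_map)
    ultimately show ?thesis
      by (metis image_is_empty)
  qed
  ultimately show ?thesis
    unfolding minimal_homeo_def invariant_set_def by blast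
qed

text \<open>Conjugating the transposition of \<open>a\<close> and \<open>b\<close> by that of
  \<open>b\<close> and \<open>b + 1\<close> gives the one of \<open>a\<close> and
  \<open>b + 1\<close>. So adjacent transpositions yield all transpositions, and these yield all
  permutations.\<close>

lemma permutes_adjacent_induct [consumes 1, case_names id comp adjacent]:
  fixes p :: "int \<Rightarrow> int"
  assumes p: "p permutes {l..u}" and "P id"
    and comp: "\<And>p q. p permutes {l..u} \<Longrightarrow> q permutes {l..u} \<Longrightarrow> P p \<Longrightarrow> P q \<Longrightarrow> P (p \<circ> q)"
    and adj: "\<And>i. l \<le> i \<Longrightarrow> i < u \<Longrightarrow> P (Transposition.transpose i (i + 1))"
  shows "P p"
proof -
  have up: "P (Transposition.transpose a (a + int n + 1))" if "l \<le> a" "a + int n + 1 \<le> u" for a n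
    using that
  proof (induction n)
    case 0
    then show ?case
      using adj[of a] by simp
  next
    case (Suc n)
    let ?b = "a + int n + 1"
    have "P (Transposition.transpose ?b (?b + 1))" "P (Transposition.transpose a ?b)"
      using Suc adj[of ?b] by auto
    moreover have "Transposition.transpose i j permutes {l..u}" if "i \<in> {l..u}" "j \<in> {l..u}" for i j
      using that by (rule permutes_swap_id)
    moreover have "a \<in> {l..u}" "?b \<in> {l..u}" "?b + 1 \<in> {l..u}"
      using Suc.prems by auto
    ultimately have "P (Transposition.transpose ?b (?b + 1) \<circ> (Transposition.transpose a ?b \<circ> Transposition.transpose ?b (?b + 1)))"
      by (intro comp permutes_compose) auto
    moreover have "Transposition.transpose ?b (?b + 1) \<circ> (Transposition.transpose a ?b \<circ> Transposition.transpose ?b (?b + 1))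
        = Transposition.transpose a (?b + 1)"
      by (auto simp: fun_eq_iff Transposition.transpose_def)
    ultimately show ?case
      by (simp add: algebra_simps)
  qed
  have tr: "P (Transposition.transpose a b)" if ab: "a \<in> {l..u}" "b \<in> {l..u}" "a \<noteq> b" for a b
  proof (cases "a < b")
    case True
    then show ?thesis
      using up[of a "nat (b - a - 1)"] ab by simp
  next
    case False
    then show ?thesis
      using up[of b "nat (a - b - 1)"] ab by (simp add: Transposition.transpose_commute)
  qed
  have "finite {l..u}"
    by simp
  with p show ?thesis
  proof (induction rule: permutes_induct)
    case (swap a b p)
    then show ?case
      by (intro comp tr permutes_swap_id) auto
  qed (rule \<open>P id\<close>)
qed

text \<open>Builds \<open>p\<close> one adjacent letter at a time, so that parity can be tracked
  along the word. The inner claim quantifies over \<open>q\<close> to be stable under composition of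
  left factors.\<close>

lemma permutes_adjacent_word_induct [consumes 1, case_names id step]:
  fixes p :: "int \<Rightarrow> int"
  assumes p: "p permutes {l..u}" and "Q id"
    and step: "\<And>i q. l \<le> i \<Longrightarrow> i < u \<Longrightarrow> q permutes {l..u} \<Longrightarrow> Q q \<Longrightarrow> Q (Transposition.transpose i (i + 1) \<circ> q)"
  shows "Q p"
proof -
  have "\<forall>q. q permutes {l..u} \<longrightarrow> Q q \<longrightarrow> Q (p \<circ> q)"
    using p
  proof (induction rule: permutes_adjacent_induct)
    case (comp p q)
    then show ?case
      by (metis comp_assoc permutes_compose)
  next
    case (adjacent i)
    then show ?case
      using step by blast
  qed simp
  then show ?thesis
    using permutes_id \<open>Q id\<close> by (metis comp_id)
qed

text \<open>A bijection from \<open>A\<close> to \<open>P\<close> is glued to one between the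
  complements. It later rearranges a window so that exactly the nonnegative places end on the
  nonnegative side.\<close>

lemma exists_permutes_matching:
  assumes "finite J" "A \<subseteq> J" "P \<subseteq> J" "card A = card P"
  obtains p where "p permutes J" "\<And>i. i \<in> J \<Longrightarrow> p i \<in> P \<longleftrightarrow> i \<in> A"
proof -
  have fin: "finite A" "finite P" "finite (J - A)" "finite (J - P)"
    using assms finite_subset by blast+
  obtain f where f: "bij_betw f A P"
    using finite_same_card_bij[OF fin(1,2) assms(4)] by blast
  have "card (J - A) = card (J - P)"
    using assms fin by (simp add: card_Diff_subset)
  then obtain h where h: "bij_betw h (J - A) (J - P)"
    using finite_same_card_bij[OF fin(3,4)] by blast
  define p where "p i = (if i \<in> A then f i else if i \<in> J then h i else i)" for i
  have "bij_betw p A P"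
    using f by (rule bij_betw_cong[THEN iffD1, rotated]) (simp add: p_def)
  moreover have "bij_betw p (J - A) (J - P)"
    using h by (rule bij_betw_cong[THEN iffD1, rotated]) (simp add: p_def)
  ultimately have "bij_betw p (A \<union> (J - A)) (P \<union> (J - P))"
    by (rule bij_betw_combine) blast
  then have bij: "bij_betw p J J"
    using assms(2,3) by (simp add: Un_absorb1)
  have "p permutes J"
    by (rule bij_imp_permutes[OF bij]) (use assms(2) p_def in auto)
  moreover have "p i \<in> P \<longleftrightarrow> i \<in> A" if "i \<in> J" for i
    using that \<open>bij_betw p A P\<close> \<open>bij_betw p (J - A) (J - P)\<close> unfolding bij_betw_def by blast
  ultimately show thesis
    by (rule that)
qed

section \<open>Commuting modulo a normal subgroup\<close>

context group
begin

text \<open>This is the preimage of the centralizer of \<open>k\<close> in the quotient by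
  \<open>N\<close>. Writing [h, k] for the commutator, closure rests on [inv h, k] = inv h [h, k]^-1
  h and [h h', k] = h [h', k] (inv h) [h, k].\<close>

lemma subgroup_commuting_mod:
  assumes N: "N \<lhd> G" and k: "k \<in> carrier G"
  shows "subgroup {h \<in> carrier G. h \<otimes> k \<otimes> inv h \<otimes> inv k \<in> N} G"
proof (rule subgroupI)
  interpret N: normal N G
    by (rule N)
  show "{h \<in> carrier G. h \<otimes> k \<otimes> inv h \<otimes> inv k \<in> N} \<noteq> {}"
    using k N.one_closed by (auto intro!: exI[of _ \<one>])
  fix h assume h: "h \<in> {h \<in> carrier G. h \<otimes> k \<otimes> inv h \<otimes> inv k \<in> N}"
  then have "inv (h \<otimes> k \<otimes> inv h \<otimes> inv k) \<in> N"
    by simp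
  then have "inv h \<otimes> inv (h \<otimes> k \<otimes> inv h \<otimes> inv k) \<otimes> h \<in> N"
    using h N.inv_op_closed1 by simp
  moreover have "inv h \<otimes> inv (h \<otimes> k \<otimes> inv h \<otimes> inv k) \<otimes> h = inv h \<otimes> k \<otimes> inv (inv h) \<otimes> inv k"
    using h k by (simp add: inv_mult_group m_assoc)
  ultimately show "inv h \<in> {h \<in> carrier G. h \<otimes> k \<otimes> inv h \<otimes> inv k \<in> N}"
    using h by simp
  fix h' assume h': "h' \<in> {h \<in> carrier G. h \<otimes> k \<otimes> inv h \<otimes> inv k \<in> N}"
  have "h \<otimes> (h' \<otimes> k \<otimes> inv h' \<otimes> inv k) \<otimes> inv h \<otimes> (h \<otimes> k \<otimes> inv h \<otimes> inv k) \<in> N"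
    using h h' N.inv_op_closed2 by simp
  moreover have "inv h \<otimes> (h \<otimes> x) = x" "inv k \<otimes> (k \<otimes> x) = x" if "x \<in> carrier G" for x
    using that h k by (simp_all flip: m_assoc)
  then have "h \<otimes> (h' \<otimes> k \<otimes> inv h' \<otimes> inv k) \<otimes> inv h \<otimes> (h \<otimes> k \<otimes> inv h \<otimes> inv k)
      = h \<otimes> h' \<otimes> k \<otimes> inv (h \<otimes> h') \<otimes> inv k"
    using h h' k by (simp add: inv_mult_group m_assoc)
  ultimately show "h \<otimes> h' \<in> {h \<in> carrier G. h \<otimes> k \<otimes> inv h \<otimes> inv k \<in> N}"
    using h h' by simp
qed auto

lemma commutator_mod_commute:
  assumes "subgroup N G" "h \<in> carrier G" "k \<in> carrier G" "h \<otimes> k \<otimes> inv h \<otimes> inv k \<in> N"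
  shows "k \<otimes> h \<otimes> inv k \<otimes> inv h \<in> N"
proof -
  have "inv (h \<otimes> k \<otimes> inv h \<otimes> inv k) \<in> N"
    by (rule subgroup.m_inv_closed[OF assms(1,4)])
  then show ?thesis
    using assms(2,3) by (simp add: inv_mult_group m_assoc)
qed

end

subsection \<open>Orbits, clopen sets and locally constant functions\<close>

locale cantor_minimal =
  fixes X :: "'a topology" and \<phi> :: "'a \<Rightarrow> 'a"
  assumes cms: "cantor_minimal_system X \<phi>"
begin

abbreviation "T \<equiv> topspace X"

definition clopen :: "'a set \<Rightarrow> bool" where
  "clopen U \<longleftrightarrow> openin X U \<and> closedin X U"

text \<open>The identity outside \<open>T\<close>, so that the laws \<open>F_F\<close> and
  \<open>F_inj\<close> hold on the whole type and can be simp rules without side conditions.\<close>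

definition F :: "int \<Rightarrow> 'a \<Rightarrow> 'a" where
  "F k x = (if x \<in> T then int_iterate X \<phi> k x else x)"

text \<open>Continuity into a discrete space (\<open>continuous_map_discrete_iff\<close>), for
  values of any type, so that integers, truth values, tuples and sets of points are treated
  alike.\<close>

definition locally_constant :: "('a \<Rightarrow> 'b) \<Rightarrow> bool" where
  "locally_constant n \<longleftrightarrow> (\<forall>x\<in>T. \<exists>W. clopen W \<and> x \<in> W \<and> (\<forall>y\<in>W. n y = n x))"

lemma T_nonempty: "T \<noteq> {}"
  and compact_X: "compact_space X"
  and metrizable_X: "metrizable_space X"
  and perfect_X: "X derived_set_of T = T"
  and disconnected_X: "connectedin X S \<Longrightarrow> \<exists>a. S \<subseteq> {a}"
  and homeo_phi: "homeomorphic_map X X \<phi>"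
  and minimal_phi: "closedin X Y \<Longrightarrow> \<phi> ` Y = Y \<Longrightarrow> Y = {} \<or> Y = T"
  using cms unfolding cantor_minimal_system_def cantor_space_def minimal_homeo_def invariant_set_def
  by auto

lemma Hausdorff_X: "Hausdorff_space X"
  by (rule metrizable_imp_Hausdorff_space[OF metrizable_X])

section \<open>Clopen sets and compactness\<close>

lemma clopen_subset: "clopen U \<Longrightarrow> U \<subseteq> T"
  unfolding clopen_def by (simp add: openin_subset)

lemma clopen_empty [simp]: "clopen {}"
  and clopen_T [simp]: "clopen T"
  and clopen_Int: "clopen A \<Longrightarrow> clopen B \<Longrightarrow> clopen (A \<inter> B)"
  and clopen_Un: "clopen A \<Longrightarrow> clopen B \<Longrightarrow> clopen (A \<union> B)"
  and clopen_Diff: "clopen A \<Longrightarrow> clopen B \<Longrightarrow> clopen (A - B)"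
  unfolding clopen_def by (auto intro: openin_diff closedin_diff)

lemma clopen_Inter: "finite I \<Longrightarrow> (\<And>i. i \<in> I \<Longrightarrow> clopen (A i)) \<Longrightarrow> clopen (T \<inter> (\<Inter>i\<in>I. A i))"
proof (induction I rule: finite_induct)
  case (insert i I)
  then have "clopen (A i \<inter> (T \<inter> (\<Inter>i\<in>I. A i)))"
    by (auto intro!: clopen_Int)
  moreover have "A i \<inter> (T \<inter> (\<Inter>i\<in>I. A i)) = T \<inter> (\<Inter>i\<in>insert i I. A i)"
    by auto
  ultimately show ?case
    by simp
qed simp

lemma clopen_Union: "finite I \<Longrightarrow> (\<And>i. i \<in> I \<Longrightarrow> clopen (A i)) \<Longrightarrow> clopen (\<Union>i\<in>I. A i)"
  by (induction I rule: finite_induct) (auto intro: clopen_Un)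

lemma clopen_base:
  assumes "openin X U" "x \<in> U"
  obtains W where "clopen W" "x \<in> W" "W \<subseteq> U"
  by (rule totally_disconnected_clopen_base[OF compact_X Hausdorff_X disconnected_X assms])
    (auto simp: clopen_def)

lemma clopen_separate:
  assumes "x \<in> T" "finite S" "x \<notin> S"
  obtains W where "clopen W" "x \<in> W" "W \<inter> S = {}"
proof -
  have "finite (S \<inter> T)" "S \<inter> T \<subseteq> T"
    using assms by auto
  then have "closedin X (S \<inter> T)"
    using Hausdorff_X Hausdorff_imp_t1_space t1_space_closedin_finite by blast
  then have "openin X (T - S \<inter> T)"
    by blast
  then obtain W where "clopen W" "x \<in> W" "W \<subseteq> T - S \<inter> T"
    using clopen_base assms by blast
  then show thesis
    using that by blast
qed

lemma clopen_cover:
  assumes "clopen U" "\<And>x. x \<in> U \<Longrightarrow> clopen (W x) \<and> x \<in> W x"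
  obtains S where "finite S" "S \<subseteq> U" "U \<subseteq> (\<Union>x\<in>S. W x)"
proof -
  have "compactin X U"
    using assms(1) compact_X closedin_compact_space unfolding clopen_def by blast
  moreover have "\<forall>A\<in>W ` U. openin X A" "U \<subseteq> \<Union>(W ` U)"
    using assms(2) unfolding clopen_def by auto
  ultimately have "\<exists>\<F>. finite \<F> \<and> \<F> \<subseteq> W ` U \<and> U \<subseteq> \<Union>\<F>"
    unfolding compactin_def by auto
  then show thesis
    using that by (metis finite_subset_image)
qed

text \<open>The localization principle. The local hypothesis speaks of all clopen subsets of a
  neighbourhood because a finite cover is made disjoint by subtracting its members, which leaves
  arbitrary clopen pieces.\<close>

lemma clopen_induct:
  assumes U: "clopen U" and "Q {}"
    and un: "\<And>A B. clopen A \<Longrightarrow> clopen B \<Longrightarrow> A \<inter> B = {} \<Longrightarrow> A \<union> B \<subseteq> U \<Longrightarrow> Q A \<Longrightarrow> Q B \<Longrightarrow> Q (A \<union> B)"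
    and loc: "\<And>x. x \<in> U \<Longrightarrow> \<exists>W. clopen W \<and> x \<in> W \<and> (\<forall>V. clopen V \<and> V \<subseteq> W \<and> V \<subseteq> U \<longrightarrow> Q V)"
  shows "Q U"
proof -
  obtain W where W: "\<And>x. x \<in> U \<Longrightarrow> clopen (W x) \<and> x \<in> W x \<and>
      (\<forall>V. clopen V \<and> V \<subseteq> W x \<and> V \<subseteq> U \<longrightarrow> Q V)"
    using loc by metis
  obtain S where S: "finite S" "S \<subseteq> U" "U \<subseteq> (\<Union>x\<in>S. W x)"
    using clopen_cover[OF U, of W] W by blast
  have "Q V" if "clopen V" "V \<subseteq> U" "V \<subseteq> (\<Union>x\<in>S. W x)" for V
    using S(1,2) that
  proof (induction S arbitrary: V rule: finite_induct)
    case empty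
    then show ?case
      using \<open>Q {}\<close> by simp
  next
    case (insert s S)
    have "clopen (W s)"
      using W insert by auto
    have "clopen (V \<inter> W s)" "V \<inter> W s \<subseteq> U"
      using insert.prems \<open>clopen (W s)\<close> by (auto intro: clopen_Int)
    then have "Q (V \<inter> W s)"
      using W[of s] insert.prems by blast
    moreover have "Q (V - W s)"
      using insert \<open>clopen (W s)\<close> by (intro insert.IH) (auto intro: clopen_Diff)
    ultimately have "Q (V \<inter> W s \<union> (V - W s))"
      using insert.prems \<open>clopen (W s)\<close> by (intro un) (auto intro: clopen_Diff clopen_Int)
    then show ?case
      by (simp add: Int_Diff_Un)
  qed
  then show ?thesis
    using S U by blast
qed

section \<open>Integer iterates, aperiodicity and minimality\<close>

lemma bij_phi: "bij_betw \<phi> T T"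
  using homeo_phi by (simp add: bij_betw_def homeomorphic_imp_injective_map homeomorphic_imp_surjective_map)

lemma F_simps:
  "x \<notin> T \<Longrightarrow> F k x = x"
  "x \<in> T \<Longrightarrow> F k x = int_iterate X \<phi> k x"
  by (simp_all add: F_def)

lemma F_0 [simp]: "F 0 x = x"
  by (simp add: F_def int_iterate_def)

lemma phi_inv: "x \<in> T \<Longrightarrow> \<phi> (inv_into T \<phi> x) = x" "x \<in> T \<Longrightarrow> inv_into T \<phi> (\<phi> x) = x"
    "x \<in> T \<Longrightarrow> inv_into T \<phi> x \<in> T" "x \<in> T \<Longrightarrow> \<phi> x \<in> T"
  using bij_phi by (auto simp: bij_betw_def inv_into_f_f f_inv_into_f inv_into_into)

lemma F_in_aux: "x \<in> T \<Longrightarrow> (\<phi> ^^ n) x \<in> T \<and> (inv_into T \<phi> ^^ n) x \<in> T"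
  by (induction n) (auto simp: phi_inv)

lemma F_in [simp]: "F k x \<in> T \<longleftrightarrow> x \<in> T"
  using F_in_aux by (auto simp: F_def int_iterate_def)

lemma F_Suc: "x \<in> T \<Longrightarrow> F (k + 1) x = \<phi> (F k x)"
proof (cases "k \<ge> 0")
  case True
  assume "x \<in> T"
  then show ?thesis
    using True by (simp add: F_def int_iterate_def nat_add_distrib)
next
  case False
  assume x: "x \<in> T"
  define m where "m = nat (- k) - 1"
  have m: "k = - int (Suc m)"
    using False by (simp add: m_def)
  have "\<phi> (F k x) = (inv_into T \<phi> ^^ m) x"
    using x F_in_aux[OF x, of m] unfolding m F_def int_iterate_def by (simp add: phi_inv nat_add_distrib)
  also have "\<dots> = F (k + 1) x"
    using x by (cases m) (auto simp: F_def int_iterate_def m nat_add_distrib)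
  finally show ?thesis ..
qed

lemma F_1: "x \<in> T \<Longrightarrow> F 1 x = \<phi> x"
  using F_Suc[of x 0] by simp

lemma F_add: "F (i + j) x = F i (F j x)"
proof (cases "x \<in> T")
  case True
  show ?thesis
  proof (induction i rule: int_induct[where k = 0])
    case (step1 i)
    then show ?case
      using F_Suc[of x "i + j"] F_Suc[of "F j x" i] True by (simp add: algebra_simps)
  next
    case (step2 i)
    have "\<phi> (F (i - 1 + j) x) = \<phi> (F (i - 1) (F j x))"
      using step2 F_Suc[of x "i - 1 + j"] F_Suc[of "F j x" "i - 1"] True by (simp add: algebra_simps)
    then show ?case
      using bij_phi True by (auto simp: bij_betw_def dest: inj_onD)
  qed simp
qed (simp add: F_simps)

lemma F_F [simp]: "F i (F j x) = F (i + j) x"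
  by (simp add: F_add)

lemma F_inj [simp]: "F k x = F k y \<longleftrightarrow> x = y"
  by (metis F_0 F_F add.commute add.right_inverse)

lemma F_image_iff: "x \<in> F k ` U \<longleftrightarrow> F (- k) x \<in> U"
  by (auto simp: image_iff intro!: bexI[of _ "F (- k) x"])

lemma F_image_F [simp]: "F i ` F j ` U = F (i + j) ` U"
  by (simp add: image_image)

lemma homeo_F: "homeomorphic_map X X (F k)"
proof (induction k rule: int_induct[where k = 0])
  case base
  show ?case
    by (rule homeomorphic_map_eq[of X X id]) (simp_all add: homeomorphic_map_id)
next
  case (step1 i)
  have "homeomorphic_map X X (\<phi> \<circ> F i)"
    using homeomorphic_map_compose step1(2) homeo_phi by blast
  then show ?case
    by (rule homeomorphic_map_eq) (simp add: F_Suc)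
next
  case (step2 i)
  obtain g where g: "homeomorphic_maps X X \<phi> g"
    using homeo_phi homeomorphic_map_maps by blast
  then have "homeomorphic_map X X g"
    using homeomorphic_maps_sym homeomorphic_maps_map by blast
  then have "homeomorphic_map X X (g \<circ> F i)"
    using homeomorphic_map_compose step2(2) by blast
  then show ?case
  proof (rule homeomorphic_map_eq)
    fix x assume x: "x \<in> T"
    show "(g \<circ> F i) x = F (i - 1) x"
      using F_Suc[OF x, of "i - 1"] g x by (simp add: homeomorphic_maps_def)
  qed
qed

lemma clopen_F [simp]: "clopen (F k ` U) \<longleftrightarrow> clopen U"
proof
  have *: "clopen (F k ` U)" if "clopen U" for k U
    using that homeo_F[of k] homeomorphic_map_openness homeomorphic_map_closedness clopen_subset[OF that]
    unfolding clopen_def by blast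
  show "clopen (F k ` U)" if "clopen U"
    using * that by blast
  show "clopen U" if "clopen (F k ` U)"
    using *[OF that, of "- k"] by simp
qed

lemma clopen_F_vimage: "clopen U \<Longrightarrow> clopen {x \<in> T. F k x \<in> U}"
proof -
  assume "clopen U"
  then have "clopen (F (- k) ` U)"
    by simp
  moreover have "F (- k) ` U = {x \<in> T. F k x \<in> U}"
    using clopen_subset[OF \<open>clopen U\<close>] by (auto simp: F_image_iff)
  ultimately show ?thesis
    by simp
qed

text \<open>A periodic orbit is finite, hence closed and invariant, hence all of the space. But a
  finite Hausdorff space has isolated points, which a perfect space has not.\<close>

lemma F_aperiodic:
  assumes "x \<in> T" "F k x = x"
  shows "k = 0"
proof (rule ccontr)
  assume k: "k \<noteq> 0"
  let ?O = "range (\<lambda>j. F j x)"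
  have per: "F (m * k) x = x" for m
  proof (induction m rule: int_induct[where k = 0])
    case (step1 i)
    then show ?case
      using F_add[of "i * k" k x] assms(2) by (simp add: algebra_simps)
  next
    case (step2 i)
    have "F k (F ((i - 1) * k) x) = F k x"
      using step2 assms(2) by (simp add: algebra_simps)
    then show ?case
      using F_inj by blast
  qed simp
  have "F j x = F (j mod k) x" for j
  proof -
    have "F j x = F (j mod k) (F (j div k * k) x)"
      unfolding F_F by (simp add: mult.commute)
    then show ?thesis
      using per by simp
  qed
  \<comment> \<open>The interval is symmetric because \<open>j mod k\<close> takes the sign of
    \<open>k\<close>, which may be negative.\<close>
  then have "?O \<subseteq> (\<lambda>j. F j x) ` {- \<bar>k\<bar>..\<bar>k\<bar>}"
  proof -
    have "j mod k \<in> {- \<bar>k\<bar>..\<bar>k\<bar>}" for j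
      using abs_mod_less[OF k, of j] by auto
    then show ?thesis
      using \<open>\<And>j. F j x = F (j mod k) x\<close> by blast
  qed
  then have fin: "finite ?O"
    using finite_subset by blast
  have t1: "t1_space X"
    using Hausdorff_X Hausdorff_imp_t1_space by blast
  have "closedin X ?O"
    using t1 fin assms(1) by (auto simp: t1_space_closedin_finite)
  moreover have "\<phi> ` ?O = ?O"
  proof -
    have "\<phi> ` ?O = range (\<lambda>j. F (j + 1) x)"
      using assms(1) by (auto simp: F_Suc image_iff)
    also have "\<dots> = ?O"
      by (auto simp: image_iff) (metis diff_add_cancel)
    finally show ?thesis .
  qed
  ultimately have "?O = T"
    using minimal_phi by blast
  then have "finite T"
    using fin by simp
  then have "closedin X (T - {x})"
    using t1 t1_space_closedin_finite by blast
  then have "openin X {x}"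
    using assms(1) by (simp add: openin_closedin_eq)
  moreover have "x \<in> X derived_set_of T"
    using perfect_X assms(1) by simp
  ultimately show False
    by (auto simp: in_derived_set_of)
qed

lemma F_eq_iff: "x \<in> T \<Longrightarrow> F i x = F j x \<longleftrightarrow> i = j"
proof
  assume "x \<in> T" "F i x = F j x"
  then have "F (- j + i) x = x"
    by (metis F_0 F_F ab_group_add_class.ab_left_minus)
  then show "i = j"
    using F_aperiodic \<open>x \<in> T\<close> by force
qed simp

text \<open>The complement of the union of all iterates of \<open>U\<close> is closed and invariant,
  and it is not the whole space because \<open>U\<close> is nonempty.\<close>

lemma minimal_clopen:
  assumes "clopen U" "U \<noteq> {}" "x \<in> T"
  obtains k where "F k x \<in> U"
proof -
  let ?V = "\<Union>k. F k ` U"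
  have V: "openin X ?V"
    using assms(1) clopen_F unfolding clopen_def by blast
  have "\<phi> ` (T - ?V) = T - ?V"
  proof -
    have "\<phi> ` (T - ?V) = F 1 ` (T - ?V)"
      by (auto simp: F_1 intro!: image_cong)
    also have "\<dots> = T - ?V"
    proof -
      have "F 1 ` ?V = ?V"
      proof -
        have "F 1 ` ?V = (\<Union>k. F (1 + k) ` U)"
          by (auto simp: image_UN)
        also have "\<dots> = ?V"
          by (auto) (metis add_diff_cancel_left' diff_add_cancel image_eqI add.commute)
        finally show ?thesis .
      qed
      moreover have "F 1 ` T = T"
        by (auto simp: F_image_iff)
      moreover have "inj (F 1)"
        by (auto simp: inj_def)
      ultimately show ?thesis
        by (simp add: image_set_diff)
    qed
    finally show ?thesis .
  qed
  moreover have "closedin X (T - ?V)"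
    using V by (simp add: closedin_diff)
  ultimately have "T - ?V = {} \<or> T - ?V = T"
    using minimal_phi[of "T - ?V"] by blast
  then have "T \<subseteq> ?V"
  proof
    assume "T - ?V = T"
    moreover obtain u where "u \<in> U"
      using assms(2) by blast
    then have "u \<in> T" "u \<in> F 0 ` U"
      using clopen_subset[OF assms(1)] by (auto simp: F_image_iff)
    ultimately show ?thesis
      by blast
  qed auto
  then obtain k where "x \<in> F k ` U"
    using assms(3) by blast
  then show thesis
    using that assms(3) by (auto simp: F_image_iff)
qed

section \<open>Locally constant functions\<close>

lemma locally_constantI:
  "(\<And>x. x \<in> T \<Longrightarrow> \<exists>W. clopen W \<and> x \<in> W \<and> (\<forall>y\<in>W. n y = n x)) \<Longrightarrow> locally_constant n"
  by (simp add: locally_constant_def)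

lemma locally_constantD:
  assumes "locally_constant n" "x \<in> T"
  obtains W where "clopen W" "x \<in> W" "\<And>y. y \<in> W \<Longrightarrow> n y = n x"
  using bspec[OF assms(1)[unfolded locally_constant_def] assms(2)] by (elim exE conjE) metis

lemma locally_constant_compose:
  assumes "locally_constant n"
  shows "locally_constant (\<lambda>x. f (n x))"
proof (rule locally_constantI)
  fix x assume "x \<in> T"
  then obtain W where "clopen W" "x \<in> W" "\<And>y. y \<in> W \<Longrightarrow> n y = n x"
    by (rule locally_constantD[OF assms]) metis
  then show "\<exists>W. clopen W \<and> x \<in> W \<and> (\<forall>y\<in>W. f (n y) = f (n x))"
    by metis
qed

lemma locally_constant_const: "locally_constant (\<lambda>_. c)"
  by (rule locally_constantI) (use clopen_T in metis)

lemma locally_constant_pair: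
  assumes "locally_constant n" "locally_constant m"
  shows "locally_constant (\<lambda>x. f (n x) (m x))"
proof (rule locally_constantI)
  fix x assume x: "x \<in> T"
  obtain V W where "clopen V" "x \<in> V" "\<forall>y\<in>V. n y = n x" "clopen W" "x \<in> W" "\<forall>y\<in>W. m y = m x"
    using assms x unfolding locally_constant_def by blast
  then show "\<exists>W. clopen W \<and> x \<in> W \<and> (\<forall>y\<in>W. f (n y) (m y) = f (n x) (m x))"
    by (metis IntD1 IntD2 IntI clopen_Int)
qed

lemma locally_constant_F:
  assumes "locally_constant n"
  shows "locally_constant (\<lambda>x. n (F k x))"
proof (rule locally_constantI)
  fix x assume "x \<in> T"
  then obtain W where W: "clopen W" "F k x \<in> W" "\<And>y. y \<in> W \<Longrightarrow> n y = n (F k x)"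
    using locally_constantD[OF assms, of "F k x"] F_in by blast
  then show "\<exists>W. clopen W \<and> x \<in> W \<and> (\<forall>y\<in>W. n (F k y) = n (F k x))"
    using clopen_F_vimage[OF W(1), of k] \<open>x \<in> T\<close> by blast
qed

lemma locally_constant_finite:
  assumes "finite I" "\<And>i. i \<in> I \<Longrightarrow> locally_constant (n i)"
  shows "locally_constant (\<lambda>x. (\<lambda>i\<in>I. n i x))"
proof (rule locally_constantI)
  fix x assume x: "x \<in> T"
  obtain W where W: "\<And>i. i \<in> I \<Longrightarrow> clopen (W i) \<and> x \<in> W i \<and> (\<forall>y\<in>W i. n i y = n i x)"
    using assms(2)[unfolded locally_constant_def] x by meson
  then show "\<exists>W. clopen W \<and> x \<in> W \<and> (\<forall>y\<in>W. (\<lambda>i\<in>I. n i y) = (\<lambda>i\<in>I. n i x))"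
    using clopen_Inter[OF assms(1), of W] x
    by (intro exI[of _ "T \<inter> (\<Inter>i\<in>I. W i)"] conjI ballI restrict_ext) blast+
qed

lemma clopen_locally_constant:
  assumes "locally_constant n"
  shows "clopen {x \<in> T. P (n x)}"
proof -
  have *: "openin X {x \<in> T. Q (n x)}" for Q
  proof (subst openin_subopen, safe)
    fix x assume x: "x \<in> T" "Q (n x)"
    obtain W where W: "clopen W" "x \<in> W" "\<And>y. y \<in> W \<Longrightarrow> n y = n x"
      using locally_constantD[OF assms x(1)] by blast
    show "\<exists>Ta. openin X Ta \<and> x \<in> Ta \<and> Ta \<subseteq> {x \<in> T. Q (n x)}"
      proof (intro exI[of _ W] conjI subsetI)
      fix y assume "y \<in> W"
      then have "y \<in> T" "n y = n x"
        using clopen_subset[OF W(1)] W(3) by auto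
      then show "y \<in> {x \<in> T. Q (n x)}"
        using x by simp
    qed (use W clopen_def in auto)
  qed
  have "{x \<in> T. P (n x)} = T - {x \<in> T. \<not> P (n x)}"
    by auto
  then have "closedin X {x \<in> T. P (n x)}"
    using *[of "\<lambda>i. \<not> P i"] by (metis closedin_topspace closedin_diff)
  then show ?thesis
    using * by (simp add: clopen_def)
qed

lemma locally_constant_mem: "clopen U \<Longrightarrow> locally_constant (\<lambda>x. x \<in> U)"
proof (rule locally_constantI)
  fix x assume "clopen U" "x \<in> T"
  then show "\<exists>W. clopen W \<and> x \<in> W \<and> (\<forall>y\<in>W. (y \<in> U) = (x \<in> U))"
    using clopen_Diff[OF clopen_T, of U] by (cases "x \<in> U") blast+
qed

lemma locally_constant_finite_range:
  assumes "locally_constant n"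
  shows "finite (n ` T)"
proof -
  obtain W where W0: "\<forall>x\<in>T. clopen (W x) \<and> x \<in> W x \<and> (\<forall>y\<in>W x. n y = n x)"
    using bchoice[OF assms[unfolded locally_constant_def]] by (rule exE)
  have W1: "clopen (W x) \<and> x \<in> W x" and W: "y \<in> W x \<Longrightarrow> n y = n x" if "x \<in> T" for x y
    by (use bspec[OF W0 that] in metis)+
  obtain S where S: "finite S" "S \<subseteq> T" "T \<subseteq> (\<Union>x\<in>S. W x)"
    using clopen_cover[OF clopen_T W1] by metis
  have "n ` T \<subseteq> n ` S"
  proof
    fix i assume "i \<in> n ` T"
    then obtain y where y: "y \<in> T" "i = n y"
      by blast
    then obtain x where "x \<in> S" "y \<in> W x"
      using S(3) by blast
    moreover from this have "n y = n x"
      using W S(2) by (metis subsetD)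
    ultimately show "i \<in> n ` S"
      using y(2) by blast
  qed
  then show ?thesis
    using S(1) finite_surj by blast
qed

lemma locally_constant_bounded:
  assumes "locally_constant (n :: 'a \<Rightarrow> int)"
  obtains N where "N > 0" "\<And>x. x \<in> T \<Longrightarrow> \<bar>n x\<bar> < N"
proof -
  have fin: "finite ((\<lambda>x. \<bar>n x\<bar>) ` T)"
    using locally_constant_finite_range[OF locally_constant_compose[OF assms, of abs]] .
  have "\<bar>n x\<bar> < max 0 (Max ((\<lambda>x. \<bar>n x\<bar>) ` T)) + 1" if "x \<in> T" for x
  proof -
    have "\<bar>n x\<bar> \<le> Max ((\<lambda>x. \<bar>n x\<bar>) ` T)"
      using fin that by (intro Max_ge) auto
    then show ?thesis
      by linarith
  qed
  then show thesis
    using that[of "max 0 (Max ((\<lambda>x. \<bar>n x\<bar>) ` T)) + 1"] by auto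
qed

lemma continuous_map_discrete_iff:
  "continuous_map X (discrete_topology UNIV) n \<longleftrightarrow> locally_constant n"
proof
  assume n: "continuous_map X (discrete_topology UNIV) n"
  show "locally_constant n"
  proof (rule locally_constantI)
    fix x assume x: "x \<in> T"
    have "openin X {y \<in> T. n y \<in> {n x}}"
      using n unfolding continuous_map_def openin_discrete_topology by blast
    then obtain W where "clopen W" "x \<in> W" "W \<subseteq> {y \<in> T. n y \<in> {n x}}"
      using clopen_base x by (metis (mono_tags, lifting) insertI1 mem_Collect_eq)
    then show "\<exists>W. clopen W \<and> x \<in> W \<and> (\<forall>y\<in>W. n y = n x)"
      by blast
  qed
next
  assume "locally_constant n"
  then show "continuous_map X (discrete_topology UNIV) n"
    using clopen_locally_constant[of n "\<lambda>i. i \<in> U" for U] unfolding continuous_map_def clopen_def by auto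
qed

text \<open>With \<open>K\<close> the nonzero differences from \<open>J\<close>, aperiodicity
  separates \<open>x\<close> from the finitely many \<open>F k x\<close> by a clopen
  \<open>V\<close>. Shrinking to points whose \<open>K\<close>-translates lie in \<open>V\<close>
  exactly when those of \<open>x\<close> do makes every such translate avoid \<open>V\<close>, so no
  coincidence between different levels is left.\<close>

lemma free_nbhd:
  assumes "x \<in> T" "finite J"
  obtains W where "clopen W" "x \<in> W"
    "\<And>i j y z. i \<in> J \<Longrightarrow> j \<in> J \<Longrightarrow> y \<in> W \<Longrightarrow> z \<in> W \<Longrightarrow> F i y = F j z \<Longrightarrow> i = j \<and> y = z"
proof -
  define K where "K = (\<lambda>(i, j). j - i) ` (J \<times> J) - {0}"
  have K: "finite K"
    using assms(2) by (simp add: K_def)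
  have K0: "0 \<notin> K" and KJ: "\<And>i j. i \<in> J \<Longrightarrow> j \<in> J \<Longrightarrow> j - i \<noteq> 0 \<Longrightarrow> j - i \<in> K"
    by (auto simp: K_def)
  have notin: "x \<notin> (\<lambda>k. F k x) ` K"
  proof
    assume "x \<in> (\<lambda>k. F k x) ` K"
    then obtain k where "x = F k x" "k \<in> K"
      by (rule imageE)
    then show False
      using F_aperiodic[OF assms(1), of k] K0 by simp
  qed
  obtain V where V: "clopen V" "x \<in> V" "V \<inter> (\<lambda>k. F k x) ` K = {}"
    by (rule clopen_separate[OF assms(1) finite_imageI[OF K] notin])
  have "locally_constant (\<lambda>y. (\<lambda>k\<in>K. F k y \<in> V))"
    using K V(1) by (intro locally_constant_finite locally_constant_F locally_constant_mem)
  from locally_constantD[OF this assms(1)] obtain W where W: "clopen W" "x \<in> W"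
      "\<And>y. y \<in> W \<Longrightarrow> (\<lambda>k\<in>K. F k y \<in> V) = (\<lambda>k\<in>K. F k x \<in> V)"
    by metis
  show thesis
  proof (rule that[of "V \<inter> W"])
    fix i j y z assume *: "i \<in> J" "j \<in> J" "y \<in> V \<inter> W" "z \<in> V \<inter> W" "F i y = F j z"
    then have "F (- i) (F i y) = F (- i) (F j z)"
      by simp
    then have yz: "y = F (j - i) z"
      by simp
    have "j - i \<notin> K"
    proof
      assume k: "j - i \<in> K"
      then have "F (j - i) x \<notin> V"
        using V(3) by blast
      moreover have "F (j - i) z \<in> V \<longleftrightarrow> F (j - i) x \<in> V"
        using W(3)[of z] * k by (metis IntD2 restrict_apply')
      ultimately show False
        using yz * by blast
    qed
    then have "j - i = 0"
      using KJ * by blast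
    then show "i = j \<and> y = z"
      using yz by simp
  qed (use V(1,2) W(1,2) in \<open>auto intro: clopen_Int\<close>)
qed

subsection \<open>Tower permutations and the full group\<close>

abbreviation "G \<equiv> topological_full_group X \<phi>"

text \<open>A pair \<open>(b, i)\<close> stands for the point \<open>F i b\<close>, that is, for level \<open>i\<close> of the tower over the base
  point \<open>b\<close>. On a free set of pairs this encoding is injective, and \<open>tower D \<pi>\<close> permutes the levels over
  \<open>b\<close> by \<open>\<pi> b\<close>; the value is meaningful only if \<open>D\<close> is free.\<close>

definition free :: "('a \<times> int) set \<Rightarrow> bool" where
  "free D \<longleftrightarrow> D \<subseteq> T \<times> UNIV \<and> inj_on (\<lambda>(b, i). F i b) D"

definition tower :: "('a \<times> int) set \<Rightarrow> ('a \<Rightarrow> int \<Rightarrow> int) \<Rightarrow> 'a \<Rightarrow> 'a" where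
  "tower D \<pi> x = (if x \<in> (\<lambda>(b, i). F i b) ` D
     then case inv_into D (\<lambda>(b, i). F i b) x of (b, i) \<Rightarrow> F (\<pi> b i) b else x)"

lemma freeI:
  assumes "\<And>b i. (b, i) \<in> D \<Longrightarrow> b \<in> T"
    and "\<And>b i b' i'. (b, i) \<in> D \<Longrightarrow> (b', i') \<in> D \<Longrightarrow> F i b = F i' b' \<Longrightarrow> b = b' \<and> i = i'"
  shows "free D"
  unfolding free_def inj_on_def using assms by auto

lemma freeD: "free D \<Longrightarrow> (b, i) \<in> D \<Longrightarrow> (b', i') \<in> D \<Longrightarrow> F i b = F i' b' \<Longrightarrow> b = b' \<and> i = i'"
  unfolding free_def inj_on_def by auto

lemma free_base: "free D \<Longrightarrow> (b, i) \<in> D \<Longrightarrow> b \<in> T"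
  unfolding free_def by auto

lemma free_subset: "free D \<Longrightarrow> D' \<subseteq> D \<Longrightarrow> free D'"
  unfolding free_def by (auto intro: inj_on_subset)

lemma tower_in: "free D \<Longrightarrow> (b, i) \<in> D \<Longrightarrow> tower D \<pi> (F i b) = F (\<pi> b i) b"
proof -
  assume *: "free D" "(b, i) \<in> D"
  have "inv_into D (\<lambda>(b, i). F i b) (F i b) = (b, i)"
    using inv_into_f_f[of "\<lambda>(b, i). F i b" D "(b, i)"] * unfolding free_def by simp
  moreover have "F i b \<in> (\<lambda>(b, i). F i b) ` D"
    using *(2) by force
  ultimately show ?thesis
    by (simp add: tower_def)
qed

lemma tower_out: "(\<And>b i. (b, i) \<in> D \<Longrightarrow> F i b \<noteq> x) \<Longrightarrow> tower D \<pi> x = x"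
  unfolding tower_def by (auto split: if_splits)

lemma tower_cases:
  obtains (inside) b i where "(b, i) \<in> D" "x = F i b" | (outside) "\<And>b i. (b, i) \<in> D \<Longrightarrow> F i b \<noteq> x"
  by metis

lemma tower_eqI:
  assumes "free D" "\<And>b i. (b, i) \<in> D \<Longrightarrow> g (F i b) = F (\<pi> b i) b"
    and "\<And>x. (\<And>b i. (b, i) \<in> D \<Longrightarrow> F i b \<noteq> x) \<Longrightarrow> g x = x"
  shows "tower D \<pi> = g"
proof
  fix x
  show "tower D \<pi> x = g x"
  proof (cases rule: tower_cases[of D x])
    case (inside b i)
    then show ?thesis
      using assms tower_in by simp
  next
    case outside
    then show ?thesis
      using assms(3)[of x] tower_out[of D x] by metis
  qed
qed

lemma tower_id: "free D \<Longrightarrow> (\<And>b i. (b, i) \<in> D \<Longrightarrow> \<pi> b i = i) \<Longrightarrow> tower D \<pi> = id"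
  by (rule tower_eqI) auto

lemma tower_cong:
  "free D \<Longrightarrow> (\<And>b i. (b, i) \<in> D \<Longrightarrow> \<pi> b i = \<pi>' b i) \<Longrightarrow> tower D \<pi> = tower D \<pi>'"
  by (rule tower_eqI) (auto simp: tower_in intro: tower_out)

lemma tower_empty [simp]: "tower {} \<pi> = id"
  by (rule tower_id) (auto simp: free_def)

lemma tower_comp:
  assumes "free D" "\<And>b i. (b, i) \<in> D \<Longrightarrow> (b, \<rho> b i) \<in> D"
  shows "tower D \<pi> \<circ> tower D \<rho> = tower D (\<lambda>b. \<pi> b \<circ> \<rho> b)"
proof (rule tower_eqI[symmetric])
  fix x assume *: "\<And>b i. (b, i) \<in> D \<Longrightarrow> F i b \<noteq> x"
  show "(tower D \<pi> \<circ> tower D \<rho>) x = x"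
    using tower_out[of D x, OF *] by simp
qed (use assms in \<open>auto simp: tower_in\<close>)

lemma tower_restrict:
  assumes "free D" "D' \<subseteq> D" "\<And>b i. (b, i) \<in> D \<Longrightarrow> (b, i) \<notin> D' \<Longrightarrow> \<pi> b i = i"
  shows "tower D' \<pi> = tower D \<pi>"
proof (rule tower_eqI[symmetric])
  fix b i assume bi: "(b, i) \<in> D"
  show "tower D' \<pi> (F i b) = F (\<pi> b i) b"
  proof (cases "(b, i) \<in> D'")
    case True
    then show ?thesis
      using free_subset[OF assms(1,2)] by (simp add: tower_in)
  next
    case False
    have "F i' b' \<noteq> F i b" if "(b', i') \<in> D'" for b' i'
      using freeD[OF assms(1), of b' i' b i] that assms(2) bi False by auto
    then show ?thesis
      using tower_out[of D' "F i b"] assms(3)[OF bi False] by simp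
  qed
next
  fix x assume *: "\<And>b i. (b, i) \<in> D \<Longrightarrow> F i b \<noteq> x"
  show "tower D' \<pi> x = x"
    by (rule tower_out) (use * assms(2) in blast)
qed (rule assms(1))

text \<open>The factor of \<open>D2\<close> acts before that of \<open>D1\<close>; invariance of
  \<open>D2\<close> keeps \<open>D1\<close> from moving the same point again.\<close>

lemma tower_Un:
  assumes D: "free (D1 \<union> D2)" "D1 \<inter> D2 = {}"
    and \<pi>: "\<And>b i. (b, i) \<in> D2 \<Longrightarrow> (b, \<pi> b i) \<in> D2"
  shows "tower (D1 \<union> D2) \<pi> = tower D1 \<pi> \<circ> tower D2 \<pi>"
proof (rule tower_eqI)
  have D12: "free D1" "free D2"
    using D(1) free_subset by blast+
  fix b i assume "(b, i) \<in> D1 \<union> D2"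
  then show "(tower D1 \<pi> \<circ> tower D2 \<pi>) (F i b) = F (\<pi> b i) b"
  proof
    assume bi: "(b, i) \<in> D1"
    have "F i' b' \<noteq> F i b" if "(b', i') \<in> D2" for b' i'
      using freeD[OF D(1), of b' i' b i] that D(2) bi by auto
    then show ?thesis
      using tower_out[of D2 "F i b"] tower_in[OF D12(1) bi] by simp
  next
    assume bi: "(b, i) \<in> D2"
    have "F i' b' \<noteq> F (\<pi> b i) b" if "(b', i') \<in> D1" for b' i'
      using freeD[OF D(1), of b' i' b "\<pi> b i"] that D(2) \<pi>[OF bi] by auto
    then show ?thesis
      using tower_out[of D1 "F (\<pi> b i) b"] tower_in[OF D12(2) bi] by simp
  qed
next
  fix x assume *: "\<And>b i. (b, i) \<in> D1 \<union> D2 \<Longrightarrow> F i b \<noteq> x"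
  show "(tower D1 \<pi> \<circ> tower D2 \<pi>) x = x"
    using tower_out[of D1 x] tower_out[of D2 x] * by simp
qed (rule D(1))

lemma tower_inverse:
  assumes "free D" "\<And>b i. (b, i) \<in> D \<Longrightarrow> (b, \<rho> b i) \<in> D" "\<And>b i. (b, i) \<in> D \<Longrightarrow> \<pi> b (\<rho> b i) = i"
  shows "tower D \<pi> \<circ> tower D \<rho> = id"
  using tower_comp[OF assms(1), of \<rho> \<pi>, OF assms(2)] tower_id[OF assms(1), of "\<lambda>b. \<pi> b \<circ> \<rho> b"] assms(3)
  by simp

text \<open>The carrier of the topological full group (\<open>G_eq\<close>). Being a homeomorphism
  is not part of it, since it follows from the cocycle by \<open>full_homeomorphic\<close>.\<close>

definition full :: "('a \<Rightarrow> 'a) set" where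
  "full = {g. g permutes T \<and> (\<exists>n. locally_constant n \<and> (\<forall>x\<in>T. g x = F (n x) x))}"

lemma fullI:
  "g permutes T \<Longrightarrow> locally_constant n \<Longrightarrow> (\<And>x. x \<in> T \<Longrightarrow> g x = F (n x) x) \<Longrightarrow> g \<in> full"
  unfolding full_def by blast

lemma fullE:
  assumes "g \<in> full"
  obtains n where "g permutes T" "locally_constant n" "\<And>x. x \<in> T \<Longrightarrow> g x = F (n x) x"
proof -
  from assms have g: "g permutes T" and "\<exists>n. locally_constant n \<and> (\<forall>x\<in>T. g x = F (n x) x)"
    unfolding full_def by simp_all
  from this(2) obtain n where n: "locally_constant n" "\<forall>x\<in>T. g x = F (n x) x"
    by (elim exE conjE)
  show thesis
    by (rule that[OF g n(1) bspec[OF n(2)]])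
qed

lemma orbit_cocycle_iff:
  "is_orbit_cocycle X \<phi> g n \<longleftrightarrow> locally_constant n \<and> (\<forall>x\<in>T. g x = F (n x) x)"
  unfolding is_orbit_cocycle_def continuous_map_discrete_iff by (simp add: F_simps)

text \<open>On each of the clopen sets where \<open>n\<close> is constant, \<open>g\<close> is a
  single iterate, so \<open>g\<close> is continuous; a continuous bijection from a compact to a
  Hausdorff space is a homeomorphism.\<close>

lemma full_homeomorphic:
  assumes "g \<in> full"
  shows "homeomorphic_map X X g"
proof -
  obtain n where n: "g permutes T" "locally_constant n" "\<And>x. x \<in> T \<Longrightarrow> g x = F (n x) x"
    using fullE[OF assms] by metis
  have "continuous_map X X g"
    unfolding continuous_map_def
  proof (intro conjI allI impI)
    show "g \<in> T \<rightarrow> T"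
      using n(1) permutes_in_image by fastforce
    fix U assume U: "openin X U"
    have "openin X {x \<in> T. F k x \<in> U}" for k
      using homeo_F[of k] U unfolding homeomorphic_eq_everything_map continuous_map_def by blast
    moreover have "openin X {x \<in> T. n x = k}" for k
      using clopen_locally_constant[OF n(2), of "\<lambda>i. i = k"] unfolding clopen_def by simp
    ultimately have "openin X (\<Union>k. {x \<in> T. n x = k} \<inter> {x \<in> T. F k x \<in> U})"
      by (intro openin_Union) auto
    moreover have "(\<Union>k. {x \<in> T. n x = k} \<inter> {x \<in> T. F k x \<in> U}) = {x \<in> T. g x \<in> U}"
      using n(3) by auto
    ultimately show "openin X {x \<in> T. g x \<in> U}"
      by simp
  qed
  moreover have "g ` T = T" "inj_on g T"
    using n(1) by (simp_all add: permutes_image permutes_inj_on)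
  ultimately show ?thesis
    using continuous_imp_homeomorphic_map[OF _ compact_X Hausdorff_X] by blast
qed

lemma G_eq: "G = \<lparr>carrier = full, mult = (\<circ>), one = id\<rparr>"
proof -
  have "{\<gamma>. \<gamma> permutes T \<and> homeomorphic_map X X \<gamma> \<and> (\<exists>n. is_orbit_cocycle X \<phi> \<gamma> n)} = full"
    using full_homeomorphic by (auto simp: orbit_cocycle_iff full_def)
  then show ?thesis
    unfolding topological_full_group_def by simp
qed

lemma carrier_G [simp]: "carrier G = full"
  and mult_G [simp]: "mult G = (\<circ>)"
  and one_G [simp]: "one G = id"
  by (simp_all add: G_eq)

lemma full_comp:
  assumes "g \<in> full" "h \<in> full"
  shows "g \<circ> h \<in> full"
proof -
  obtain n where n: "g permutes T" "locally_constant n" "\<And>x. x \<in> T \<Longrightarrow> g x = F (n x) x"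
    using fullE[OF assms(1)] by metis
  obtain m where m: "h permutes T" "locally_constant m" "\<And>x. x \<in> T \<Longrightarrow> h x = F (m x) x"
    using fullE[OF assms(2)] by metis
  show ?thesis
  proof (rule fullI)
    show "g \<circ> h permutes T"
      using m(1) n(1) by (rule permutes_compose)
    show "(g \<circ> h) x = F (n (h x) + m x) x" if "x \<in> T" for x
      using m(3)[OF that] n(3)[of "h x"] that by simp
    show "locally_constant (\<lambda>x. n (h x) + m x)"
    proof (rule locally_constantI)
      fix x assume x: "x \<in> T"
      obtain V where V: "clopen V" "x \<in> V" "\<And>y. y \<in> V \<Longrightarrow> m y = m x"
        using locally_constantD[OF m(2) x] by metis
      have "locally_constant (\<lambda>y. n (F (m x) y))"
        using n(2) by (rule locally_constant_F)
      then obtain W where W: "clopen W" "x \<in> W" "\<And>y. y \<in> W \<Longrightarrow> n (F (m x) y) = n (F (m x) x)"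
        using locally_constantD[OF _ x] by metis
      have "n (h y) + m y = n (h x) + m x" if "y \<in> V \<inter> W" for y
      proof -
        have "y \<in> T"
          using that clopen_subset[OF V(1)] by blast
        then show ?thesis
          using V(3)[of y] W(3)[of y] that m(3)[of y] m(3)[OF x] by simp
      qed
      then show "\<exists>W. clopen W \<and> x \<in> W \<and> (\<forall>y\<in>W. n (h y) + m y = n (h x) + m x)"
        using V(1,2) W(1,2) clopen_Int by (meson IntI)
    qed
  qed
qed

lemma full_id: "id \<in> full"
  by (rule fullI[OF permutes_id locally_constant_const[of 0]]) simp

lemma full_inv:
  assumes "g \<in> full"
  shows "inv_into UNIV g \<in> full"
proof -
  obtain n where n: "g permutes T" "locally_constant n" "\<And>x. x \<in> T \<Longrightarrow> g x = F (n x) x"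
    using fullE[OF assms(1)] by metis
  let ?h = "inv_into UNIV g"
  have gh: "g (?h x) = x" "?h (g x) = x" for x
    using n(1) permutes_inverses by fast+
  have hT: "?h x \<in> T" if "x \<in> T" for x
    using that permutes_in_image[OF permutes_inv[OF n(1)]] by blast
  show ?thesis
  proof (rule fullI)
    show "?h permutes T"
      using n(1) by (rule permutes_inv)
    show "?h x = F (- n (?h x)) x" if "x \<in> T" for x
    proof -
      have "F (- n (?h x)) (g (?h x)) = ?h x"
        using n(3)[OF hT[OF that]] by simp
      then show ?thesis
        using gh(1) by simp
    qed
    show "locally_constant (\<lambda>x. - n (?h x))"
    proof (rule locally_constantI)
      fix x assume x: "x \<in> T"
      define k where "k = n (?h x)"
      obtain V where V: "clopen V" "?h x \<in> V" "\<And>y. y \<in> V \<Longrightarrow> n y = k"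
        using locally_constantD[OF n(2) hT[OF x]] unfolding k_def by metis
      have "- n (?h y) = - n (?h x)" if y: "y \<in> F k ` V" for y
      proof -
        obtain z where z: "z \<in> V" "y = F k z"
          using y by (rule imageE) metis
        then have "y = g z"
          using n(3)[of z] V(3)[of z] clopen_subset[OF V(1)] by (metis subsetD)
        then show ?thesis
          using V(3)[OF z(1)] gh(2)[of z] k_def by simp
      qed
      moreover have "x \<in> F k ` V"
        using V(2) n(3)[OF hT[OF x]] gh(1)[of x] unfolding k_def by (metis image_eqI)
      moreover have "clopen (F k ` V)"
        using V(1) by simp
      ultimately show "\<exists>W. clopen W \<and> x \<in> W \<and> (\<forall>y\<in>W. - n (?h y) = - n (?h x))"
        by blast
    qed
  qed
qed

lemma full_bij: "g \<in> full \<Longrightarrow> bij g"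
  unfolding full_def using permutes_bij by blast

lemma full_in: "g \<in> full \<Longrightarrow> g x \<in> T \<longleftrightarrow> x \<in> T"
  by (erule fullE) (simp add: permutes_in_image)

lemma group_G: "group G"
proof (rule groupI)
  fix g assume g: "g \<in> carrier G"
  then have "inv_into UNIV g \<circ> g = id"
    using full_bij[of g] by (simp add: bij_is_inj)
  then show "\<exists>h\<in>carrier G. h \<otimes>\<^bsub>G\<^esub> g = \<one>\<^bsub>G\<^esub>"
    using full_inv[of g] g by auto
qed (auto intro: full_comp full_id)

sublocale G: group G
  by (rule group_G)

lemma inv_G:
  assumes "g \<in> full"
  shows "inv\<^bsub>G\<^esub> g = inv_into UNIV g"
  using G.inv_equality[of "inv_into UNIV g" g] full_inv[OF assms] assms full_bij[OF assms]
  by (simp add: bij_is_inj)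

lemma free_Times_cases:
  assumes "free (B \<times> J)" "i \<in> J" "j \<in> J" "i \<noteq> j"
  shows "F i ` B \<inter> F j ` B = {}"
  using assms freeD[OF assms(1)] by fastforce

lemma free_Times_nbhd:
  assumes "x \<in> T" "finite J"
  obtains W where "clopen W" "x \<in> W" "free (W \<times> J)"
proof -
  have "\<exists>W. clopen W \<and> x \<in> W \<and> free (W \<times> J)"
  proof (rule free_nbhd[OF assms])
    fix W assume W: "clopen W" "x \<in> W" and *: "\<And>i j y z. i \<in> J \<Longrightarrow> j \<in> J \<Longrightarrow> y \<in> W \<Longrightarrow> z \<in> W \<Longrightarrow>
      F i y = F j z \<Longrightarrow> i = j \<and> y = z"
    have "free (W \<times> J)"
    proof (rule freeI)
      show "b \<in> T" if "(b, i) \<in> W \<times> J" for b i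
        using that clopen_subset[OF W(1)] by blast
      show "b = c \<and> i = j" if "(b, i) \<in> W \<times> J" "(c, j) \<in> W \<times> J" "F i b = F j c" for b i c j
        using *[of i j b c] that by simp
    qed
    then show ?thesis
      using W by metis
  qed
  then show thesis
    using that by metis
qed

lemma tower_full:
  assumes B: "clopen B" and J: "finite J" "free (B \<times> J)" and \<pi>: "\<pi> permutes J"
  shows "tower (B \<times> J) (\<lambda>_. \<pi>) \<in> full"
proof -
  let ?g = "tower (B \<times> J) (\<lambda>_. \<pi>)" and ?h = "tower (B \<times> J) (\<lambda>_. inv_into UNIV \<pi>)"
  have \<pi>J: "i \<in> J \<Longrightarrow> \<pi> i \<in> J" "i \<in> J \<Longrightarrow> inv_into UNIV \<pi> i \<in> J" for i
    using permutes_in_image[OF \<pi>] permutes_in_image[OF permutes_inv[OF \<pi>]] by auto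
  have "?g \<circ> ?h = id" "?h \<circ> ?g = id"
    using \<pi>J permutes_inverses[OF \<pi>] by (auto intro!: tower_inverse J)
  then have "bij ?g"
    using o_bij by blast
  have BT: "B \<subseteq> T"
    using B by (rule clopen_subset)
  have *: "?g x = x" if "x \<notin> T" for x
    by (rule tower_out) (use that BT in auto)
  have perm: "?g permutes T"
    unfolding permutes_def bij_iff[symmetric] using \<open>bij ?g\<close> * by blast
  \<comment> \<open>By freeness at most one level contains \<open>x\<close>, so the choice is forced
    and \<open>n\<close> is the displacement of that level.\<close>
  define n where "n x = (if \<exists>i\<in>J. x \<in> F i ` B then (let i = (SOME i. i \<in> J \<and> x \<in> F i ` B) in \<pi> i - i) else 0)" for x
  have n1: "n x = \<pi> i - i" if "i \<in> J" "x \<in> F i ` B" for i x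
  proof -
    have "j = i" if "j \<in> J \<and> x \<in> F j ` B" for j
      using free_Times_cases[OF J(2), of i j] \<open>i \<in> J\<close> \<open>x \<in> F i ` B\<close> that by blast
    then have "(SOME i. i \<in> J \<and> x \<in> F i ` B) = i"
      using that by (intro some_equality conjI) blast+
    moreover have "\<exists>i\<in>J. x \<in> F i ` B"
      using that by blast
    ultimately show ?thesis
      by (simp only: n_def Let_def if_True)
  qed
  have n2: "n x = 0" if "\<And>i. i \<in> J \<Longrightarrow> x \<notin> F i ` B" for x
  proof -
    have "\<not> (\<exists>i\<in>J. x \<in> F i ` B)"
      using that by blast
    then show ?thesis
      by (simp only: n_def if_False)
  qed
  show ?thesis
  proof (rule fullI[OF perm])
    show "locally_constant n"
    proof (rule locally_constantI)
      fix x assume x: "x \<in> T"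
      show "\<exists>W. clopen W \<and> x \<in> W \<and> (\<forall>y\<in>W. n y = n x)"
      proof (cases "\<exists>i\<in>J. x \<in> F i ` B")
        case True
        then obtain i where i: "i \<in> J" "x \<in> F i ` B"
          by blast
        then have "\<forall>y\<in>F i ` B. n y = n x"
          using n1[OF i(1)] by metis
        then show ?thesis
          using B i by (metis clopen_F)
      next
        case False
        have "clopen (T - (\<Union>i\<in>J. F i ` B))"
          using B J(1) by (intro clopen_Diff clopen_Union) auto
        moreover have "n y = n x" if "y \<in> T - (\<Union>i\<in>J. F i ` B)" for y
        proof -
          have "n y = 0"
            by (rule n2) (use that in blast)
          moreover have "n x = 0"
            by (rule n2) (use False in blast)
          ultimately show ?thesis
            by simp
        qed
        ultimately show ?thesis
          using x False by (intro exI[of _ "T - (\<Union>i\<in>J. F i ` B)"]) blast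
      qed
    qed
    fix x assume "x \<in> T"
    show "?g x = F (n x) x"
    proof (cases rule: tower_cases[of "B \<times> J" x])
      case (inside b i)
      then show ?thesis
        using tower_in[OF J(2) inside(1), of "\<lambda>_. \<pi>"] n1[of i x] by simp
    next
      case outside
      then have "n x = 0"
        by (intro n2) blast
      then show ?thesis
        using tower_out[of "B \<times> J" x, OF outside] by simp
    qed
  qed
qed

section \<open>Swaps, 3-cycles and towers composed of swaps\<close>

definition swp :: "'a set \<Rightarrow> 'a \<Rightarrow> 'a" where
  "swp U = tower (U \<times> {0, 1}) (\<lambda>_. Transposition.transpose 0 1)"

text \<open>Arbitrary levels are allowed because conjugates of the consecutive 3-cycles are of this
  kind. For distinct levels it sends \<open>a\<close> to \<open>b\<close>, \<open>b\<close> to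
  \<open>c\<close> and \<open>c\<close> to \<open>a\<close>.\<close>

definition cycle3 :: "'a set \<Rightarrow> int \<Rightarrow> int \<Rightarrow> int \<Rightarrow> 'a \<Rightarrow> 'a" where
  "cycle3 U a b c = tower (U \<times> {a, b, c}) (\<lambda>_. Transposition.transpose a b \<circ> Transposition.transpose b c)"

lemma free_F:
  assumes "free (V \<times> J)" "\<And>k. k \<in> K \<Longrightarrow> k + i \<in> J"
  shows "free ((F i ` V) \<times> K)"
proof (rule freeI)
  fix b k b' k' assume *: "(b, k) \<in> (F i ` V) \<times> K" "(b', k') \<in> (F i ` V) \<times> K" "F k b = F k' b'"
  then obtain c c' where c: "b = F i c" "b' = F i c'" "c \<in> V" "c' \<in> V"
    by auto
  then have "F (k + i) c = F (k' + i) c'"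
    using * by simp
  moreover have "(c, k + i) \<in> V \<times> J" "(c', k' + i) \<in> V \<times> J"
    using * c assms(2) by auto
  ultimately have "c = c' \<and> k + i = k' + i"
    using freeD[OF assms(1)] by metis
  then show "b = b' \<and> k = k'"
    using c by simp
next
  fix b k assume "(b, k) \<in> (F i ` V) \<times> K"
  then obtain c where "c \<in> V" "b = F i c" "k + i \<in> J"
    using assms(2) by auto
  then show "b \<in> T"
    using free_base[OF assms(1), of c "k + i"] by simp
qed

text \<open>Level \<open>k\<close> over \<open>F i b\<close> is level \<open>k + i\<close> over
  \<open>b\<close>. Rebasing in this way places swaps and 3-cycles with different bases in one
  tower, where they compose as permutations of integers.\<close>

lemma tower_shift:
  assumes "free (V \<times> J)" "\<And>k. k \<in> K \<Longrightarrow> k + i \<in> J" "\<pi> permutes K"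
  shows "tower ((F i ` V) \<times> K) (\<lambda>_. \<pi>) = tower (V \<times> J) (\<lambda>_ k. \<pi> (k - i) + i)"
proof -
  have fr: "free ((F i ` V) \<times> K)"
    using assms(1,2) by (rule free_F)
  show ?thesis
  proof (rule tower_eqI[OF assms(1), symmetric])
    fix b j assume bj: "(b, j) \<in> V \<times> J"
    show "tower ((F i ` V) \<times> K) (\<lambda>_. \<pi>) (F j b) = F (\<pi> (j - i) + i) b"
    proof (cases "j - i \<in> K")
      case True
      then show ?thesis
        using tower_in[OF fr, of "F i b" "j - i" "\<lambda>_. \<pi>"] bj by simp
    next
      case False
      have "F k c \<noteq> F j b" if ck: "(c, k) \<in> (F i ` V) \<times> K" for c k
      proof
        assume eq: "F k c = F j b"
        obtain c' where c': "c' \<in> V" "c = F i c'"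
          using ck by auto
        then have "F (k + i) c' = F j b" "(c', k + i) \<in> V \<times> J"
          using eq ck assms(2) by auto
        then have "k + i = j"
          using freeD[OF assms(1) _ bj] by metis
        then show False
          using False ck by auto
      qed
      then have "tower ((F i ` V) \<times> K) (\<lambda>_. \<pi>) (F j b) = F j b"
        by (rule tower_out)
      then show ?thesis
        using permutes_not_in[OF assms(3) False] by simp
    qed
  next
    fix x assume *: "\<And>b j. (b, j) \<in> V \<times> J \<Longrightarrow> F j b \<noteq> x"
    show "tower ((F i ` V) \<times> K) (\<lambda>_. \<pi>) x = x"
    proof (rule tower_out)
      fix c and k :: int assume "(c, k) \<in> (F i ` V) \<times> K"
      then obtain c' where "c' \<in> V" "F k c = F (k + i) c'" "k + i \<in> J"
        using assms(2) by auto
      then show "F k c \<noteq> x"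
        using *[of c' "k + i"] by simp
    qed
  qed
qed

lemma tower_swp:
  assumes "free (V \<times> J)" "i \<in> J" "i + 1 \<in> J"
  shows "tower (V \<times> J) (\<lambda>_. Transposition.transpose i (i + 1)) = swp (F i ` V)"
    and "free ((F i ` V) \<times> {0, 1})"
proof -
  have J: "k + i \<in> J" if "k \<in> {0, 1}" for k
    using that assms(2,3) by (auto simp: add.commute)
  show "free ((F i ` V) \<times> {0, 1})"
    using assms(1) J by (rule free_F)
  have "swp (F i ` V) = tower (V \<times> J) (\<lambda>_ k. Transposition.transpose 0 1 (k - i) + i)"
    unfolding swp_def by (rule tower_shift[OF assms(1) J]) (auto intro: permutes_swap_id)
  also have "\<dots> = tower (V \<times> J) (\<lambda>_. Transposition.transpose i (i + 1))"
    by (rule tower_cong[OF assms(1)]) (auto simp: Transposition.transpose_def)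
  finally show "tower (V \<times> J) (\<lambda>_. Transposition.transpose i (i + 1)) = swp (F i ` V)"
    by simp
qed

lemma tower_const_mem:
  assumes V: "clopen V" "free (V \<times> {l..u})" and p: "p permutes {l..u}"
    and H: "id \<in> H" "\<And>g h. g \<in> H \<Longrightarrow> h \<in> H \<Longrightarrow> g \<circ> h \<in> H"
    and swp: "\<And>U. clopen U \<Longrightarrow> free (U \<times> {0, 1}) \<Longrightarrow> swp U \<in> H"
  shows "tower (V \<times> {l..u}) (\<lambda>_. p) \<in> H"
  using p
proof (induction rule: permutes_adjacent_induct)
  case id
  then show ?case
    using tower_id[OF V(2), of "\<lambda>_. id"] H(1) by (simp add: id_def)
next
  case (comp p q)
  have "(b, q i) \<in> V \<times> {l..u}" if "(b, i) \<in> V \<times> {l..u}" for b i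
    using that permutes_in_image[OF comp(2)] by auto
  then have "tower (V \<times> {l..u}) (\<lambda>_. p) \<circ> tower (V \<times> {l..u}) (\<lambda>_. q) = tower (V \<times> {l..u}) (\<lambda>_. p \<circ> q)"
    by (rule tower_comp[OF V(2)])
  then show ?case
    using H(2)[OF comp(3,4)] by (simp only:)
next
  case (adjacent i)
  then have "i \<in> {l..u}" "i + 1 \<in> {l..u}"
    by auto
  from tower_swp[OF V(2) this] show ?case
    using swp[of "F i ` V"] V(1) by simp
qed

text \<open>Locally \<open>J\<close> and \<pi> are constant and a whole interval of levels is free.
  There the tower is one permutation of the interval, a product of adjacent transpositions, and each
  of those is a swap.\<close>

lemma tower_mem:
  fixes J :: "'a \<Rightarrow> int set"
  assumes B: "clopen B" "free (Sigma B J)" "\<And>b. b \<in> B \<Longrightarrow> finite (J b)"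
    and \<pi>: "\<And>b. b \<in> B \<Longrightarrow> bij_betw (\<pi> b) (J b) (J b)"
    and loc: "\<And>b. b \<in> B \<Longrightarrow> \<exists>W. clopen W \<and> b \<in> W \<and> (\<forall>c\<in>W \<inter> B. J c = J b \<and> (\<forall>i\<in>J b. \<pi> c i = \<pi> b i))"
    and H: "id \<in> H" "\<And>g h. g \<in> H \<Longrightarrow> h \<in> H \<Longrightarrow> g \<circ> h \<in> H"
    and swp: "\<And>U. clopen U \<Longrightarrow> free (U \<times> {0, 1}) \<Longrightarrow> swp U \<in> H"
  shows "tower (Sigma B J) \<pi> \<in> H"
  using B(1)
proof (rule clopen_induct)
  show "tower (Sigma {} J) \<pi> \<in> H"
    using H(1) by simp
next
  fix V W assume VW: "clopen V" "clopen W" "V \<inter> W = {}" "V \<union> W \<subseteq> B"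
    "tower (Sigma V J) \<pi> \<in> H" "tower (Sigma W J) \<pi> \<in> H"
  have "tower (Sigma V J \<union> Sigma W J) \<pi> = tower (Sigma V J) \<pi> \<circ> tower (Sigma W J) \<pi>"
  proof (rule tower_Un)
    show "free (Sigma V J \<union> Sigma W J)"
      by (rule free_subset[OF B(2)]) (use VW(4) in auto)
    show "Sigma V J \<inter> Sigma W J = {}"
      using VW(3) by auto
    show "(b, \<pi> b i) \<in> Sigma W J" if "(b, i) \<in> Sigma W J" for b i
      using that \<pi>[of b] VW(4) by (auto simp: bij_betw_def)
  qed
  moreover have "Sigma (V \<union> W) J = Sigma V J \<union> Sigma W J"
    by auto
  ultimately show "tower (Sigma (V \<union> W) J) \<pi> \<in> H"
    using H(2) VW by simp
next
  fix b assume b: "b \<in> B"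
  have bT: "b \<in> T"
    using b clopen_subset[OF B(1)] by blast
  obtain W1 where W1: "clopen W1" "b \<in> W1" "\<forall>c\<in>W1 \<inter> B. J c = J b \<and> (\<forall>i\<in>J b. \<pi> c i = \<pi> b i)"
    using loc[OF b] by (elim exE conjE)
  obtain M where M: "J b \<subseteq> {- M..M}"
  proof (rule that[of "Max (insert 0 (abs ` J b))"], rule subsetI)
    fix i assume "i \<in> J b"
    then have "\<bar>i\<bar> \<le> Max (insert 0 (abs ` J b))"
      using B(3)[OF b] by (intro Max_ge) auto
    then show "i \<in> {- Max (insert 0 (abs ` J b))..Max (insert 0 (abs ` J b))}"
      by auto
  qed
  obtain W2 where W2: "clopen W2" "b \<in> W2" "free (W2 \<times> {- M..M})"
    by (rule free_Times_nbhd[OF bT finite_atLeastAtMost_int[of "- M" M]])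
  \<comment> \<open>Filling up with the identity turns a permutation of \<open>J b\<close>, which
    may have gaps, into one of an interval.\<close>
  define p where "p i = (if i \<in> J b then \<pi> b i else i)" for i
  have pJ: "bij_betw p (J b) (J b)"
    using \<pi>[OF b] by (rule bij_betw_cong[THEN iffD1, rotated]) (simp add: p_def)
  have "p permutes J b"
    by (rule bij_imp_permutes[OF pJ]) (simp add: p_def)
  then have p: "p permutes {- M..M}"
    using M by (rule permutes_subset)
  have "tower (Sigma V J) \<pi> \<in> H" if V: "clopen V" "V \<subseteq> W1 \<inter> W2" "V \<subseteq> B" for V
  proof -
    have SV: "Sigma V J = V \<times> J b"
      using V W1(3) by (intro Sigma_cong) auto
    have fr: "free (V \<times> {- M..M})"
      by (rule free_subset[OF W2(3)]) (use V(2) in blast)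
    have sub: "V \<times> J b \<subseteq> V \<times> {- M..M}"
      using M by blast
    have "tower (Sigma V J) \<pi> = tower (V \<times> J b) (\<lambda>_. p)"
      unfolding SV
    proof (rule tower_cong)
      show "free (V \<times> J b)"
        using fr sub by (rule free_subset)
      show "\<pi> c i = p i" if "(c, i) \<in> V \<times> J b" for c i
        using W1(3) V that unfolding p_def by auto
    qed
    also have "\<dots> = tower (V \<times> {- M..M}) (\<lambda>_. p)"
      using fr sub by (rule tower_restrict) (auto simp: p_def)
    also have "\<dots> \<in> H"
      by (rule tower_const_mem[OF V(1) fr p H swp])
    finally show ?thesis .
  qed
  then show "\<exists>W. clopen W \<and> b \<in> W \<and> (\<forall>V. clopen V \<and> V \<subseteq> W \<and> V \<subseteq> B \<longrightarrow> tower (Sigma V J) \<pi> \<in> H)"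
    using W1(1,2) W2(1,2) by (intro exI[of _ "W1 \<inter> W2"]) (auto intro: clopen_Int)
qed

subsection \<open>Flow and generation by swaps\<close>

text \<open>On the orbit of \<open>x\<close> a full group element acts as the permutation \<open>j \<mapsto> j + n (F j x)\<close> of the
  integers. The number below is its net flow across the cut between \<open>-1\<close> and \<open>0\<close>; only the window
  \<open>[-N, N)\<close> matters because \<open>n\<close> is bounded by \<open>N\<close>.\<close>

definition flow :: "int \<Rightarrow> ('a \<Rightarrow> int) \<Rightarrow> 'a \<Rightarrow> int" where
  "flow N n x = int (card {j \<in> {- N..<N}. 0 \<le> j + n (F j x)}) - N"

lemma locally_constant_flow:
  assumes "locally_constant n"
  shows "locally_constant (flow N n)"
proof -
  have "locally_constant (\<lambda>x. (\<lambda>f. int (card {j \<in> {- N..<N}. 0 \<le> j + f j}) - N) (\<lambda>j\<in>{- N..<N}. n (F j x)))"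
    by (rule locally_constant_compose[of _ "\<lambda>f. int (card {j \<in> {- N..<N}. 0 \<le> j + f j}) - N"])
      (intro locally_constant_finite locally_constant_F assms finite_atLeastLessThan_int)
  moreover have "(\<lambda>f. int (card {j \<in> {- N..<N}. 0 \<le> j + f j}) - N) (\<lambda>j\<in>{- N..<N}. n (F j x)) = flow N n x" for x
  proof -
    have "{j \<in> {- N..<N}. 0 \<le> j + (\<lambda>j\<in>{- N..<N}. n (F j x)) j} = {j \<in> {- N..<N}. 0 \<le> j + n (F j x)}"
      by auto
    then show ?thesis
      by (simp add: flow_def)
  qed
  ultimately show ?thesis
    by simp
qed

text \<open>Passing to \<open>F 1 x\<close> moves window and cut up by one. The set of counted
  places loses \<open>j0\<close>, the only place sent to 0, and gains \<open>N\<close>; the place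
  \<open>- N\<close> was not counted, because displacements are smaller than
  \<open>N\<close>.\<close>

lemma flow_F:
  assumes g: "g permutes T" "\<And>x. x \<in> T \<Longrightarrow> g x = F (n x) x"
    and N: "\<And>x. x \<in> T \<Longrightarrow> \<bar>n x\<bar> < N" and x: "x \<in> T"
  shows "flow N n (F 1 x) = flow N n x"
proof -
  define A where "A = {j \<in> {- N..<N}. 0 \<le> j + n (F j x)}"
  \<comment> \<open>The places counted for \<open>F 1 x\<close>, renumbered along the orbit of
    \<open>x\<close>.\<close>
  define B where "B = {j \<in> {- N + 1..<N + 1}. 1 \<le> j + n (F j x)}"
  have n: "\<bar>n (F j x)\<bar> < N" for j
    using N x by simp
  define y where "y = inv_into UNIV g x"
  have gy: "g y = x"
    unfolding y_def using g(1) permutes_inverses(1) by fastforce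
  have yT: "y \<in> T"
    unfolding y_def using permutes_in_image[OF permutes_inv[OF g(1)]] x by blast
  define j0 where "j0 = - n y"
  have x_eq: "x = F (n y) y"
    using g(2)[OF yT] gy by simp
  have y_eq: "F j0 x = y"
    unfolding j0_def by (subst x_eq) simp
  have j0: "j0 + n (F j0 x) = 0"
    unfolding y_eq by (simp add: j0_def)
  have uniq: "j = j0" if "j + n (F j x) = 0" for j
  proof -
    have "g (F j x) = F (n (F j x) + j) x"
      using g(2)[of "F j x"] x by simp
    then have "g (F j x) = g y"
      using that gy by (simp add: add.commute)
    then have "F j x = F j0 x"
      using permutes_inj[OF g(1)] y_eq by (simp add: inj_eq)
    then show ?thesis
      using F_eq_iff[OF x] by blast
  qed
  have j0A: "j0 \<in> A"
    using j0 N[OF yT] by (auto simp: A_def j0_def)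
  have "B = insert N (A - {j0})"
  proof (rule Set.set_eqI)
    fix j
    have 1: "1 \<le> j + n (F j x) \<longleftrightarrow> 0 \<le> j + n (F j x) \<and> j \<noteq> j0"
    proof (cases "j = j0")
      case True
      then show ?thesis
        using j0 by (simp only:) simp
    next
      case False
      then have "j + n (F j x) \<noteq> 0"
        using uniq by blast
      then show ?thesis
        using False by linarith
    qed
    have 2: "j = N \<Longrightarrow> 0 \<le> j + n (F j x)" "j = - N \<Longrightarrow> \<not> 0 \<le> j + n (F j x)" "j0 \<noteq> N"
      using n[of j] j0A by (simp_all add: A_def)
    have 3: "- N + 1 \<le> j \<and> j < N + 1 \<longleftrightarrow> j = N \<or> - N \<le> j \<and> j < N \<and> j \<noteq> - N"
      using n[of j] by linarith
    show "j \<in> B \<longleftrightarrow> j \<in> insert N (A - {j0})"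
      unfolding A_def B_def mem_Collect_eq insert_iff Diff_iff atLeastLessThan_iff 1 3 using 2 by blast
  qed
  moreover have "finite A"
    unfolding A_def by (rule finite_subset[of _ "{- N..<N}"]) auto
  moreover have "N \<notin> A"
    by (simp add: A_def)
  ultimately have "card B = card A"
    using j0A card_Suc_Diff1[of A j0] by simp
  moreover have "card {j \<in> {- N..<N}. 0 \<le> j + n (F j (F 1 x))} = card B"
  proof (rule bij_betw_same_card)
    show "bij_betw (\<lambda>j. j + 1) {j \<in> {- N..<N}. 0 \<le> j + n (F j (F 1 x))} B"
      by (rule bij_betw_byWitness[where f' = "\<lambda>j. j - 1"]) (auto simp: B_def)
  qed
  ultimately show ?thesis
    by (simp add: flow_def A_def)
qed

text \<open>The flow is constant along orbits, and its level sets are clopen, so by minimality every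
  orbit meets every nonempty level set.\<close>

lemma flow_const:
  assumes g: "g permutes T" "locally_constant n" "\<And>x. x \<in> T \<Longrightarrow> g x = F (n x) x"
    and N: "\<And>x. x \<in> T \<Longrightarrow> \<bar>n x\<bar> < N" and x: "x \<in> T" and y: "y \<in> T"
  shows "flow N n x = flow N n y"
proof -
  have shift: "flow N n (F k z) = flow N n z" if "z \<in> T" for k z
  proof (induction k rule: int_induct[where k = 0])
    case (step1 i)
    then show ?case
      using flow_F[OF g(1,3) N, of "F i z"] that by (simp add: add.commute)
  next
    case (step2 i)
    then show ?case
      using flow_F[OF g(1,3) N, of "F (i - 1) z"] that by simp
  qed simp
  have "clopen {z \<in> T. flow N n z = flow N n x}"
    by (rule clopen_locally_constant[OF locally_constant_flow[OF g(2)]])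
  then obtain k where "F k y \<in> {z \<in> T. flow N n z = flow N n x}"
    using minimal_clopen[OF _ _ y] x by blast
  then show ?thesis
    using shift[OF y] by simp
qed

section \<open>Return times and first-return towers\<close>

lemma visits_bounded:
  assumes "clopen C" "C \<noteq> {}"
  obtains M where "\<And>x. x \<in> T \<Longrightarrow> \<exists>k\<in>{- M..M}. F k x \<in> C"
proof -
  have "\<forall>x\<in>T. \<exists>k. F k x \<in> C"
    using minimal_clopen[OF assms] by blast
  then obtain k where k: "\<And>x. x \<in> T \<Longrightarrow> F (k x) x \<in> C"
    by metis
  obtain S where S: "finite S" "S \<subseteq> T" "T \<subseteq> (\<Union>x\<in>S. {y \<in> T. F (k x) y \<in> C})"
    by (rule clopen_cover[OF clopen_T, of "\<lambda>x. {y \<in> T. F (k x) y \<in> C}"])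
      (use k clopen_F_vimage[OF assms(1)] in auto)
  show thesis
  proof (rule that[of "Max (insert 0 ((\<lambda>x. \<bar>k x\<bar>) ` S))"])
    fix y assume "y \<in> T"
    then obtain x where x: "x \<in> S" "F (k x) y \<in> C"
      using S(3) by blast
    have "\<bar>k x\<bar> \<le> Max (insert 0 ((\<lambda>x. \<bar>k x\<bar>) ` S))"
      using S(1) x(1) by (intro Max_ge) auto
    then show "\<exists>k\<in>{- Max (insert 0 ((\<lambda>x. \<bar>k x\<bar>) ` S))..Max (insert 0 ((\<lambda>x. \<bar>k x\<bar>) ` S))}. F k y \<in> C"
      using x(2) by (intro bexI[of _ "k x"]) auto
  qed
qed

definition ret :: "'a set \<Rightarrow> 'a \<Rightarrow> int" where
  "ret C x = int (LEAST i. 0 < i \<and> F (int i) x \<in> C)"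

lemma ret:
  assumes "clopen C" "C \<noteq> {}" "x \<in> T"
  shows "0 < ret C x" "F (ret C x) x \<in> C" "\<And>i. 0 < i \<Longrightarrow> i < ret C x \<Longrightarrow> F i x \<notin> C"
proof -
  obtain M where M: "\<And>x. x \<in> T \<Longrightarrow> \<exists>k\<in>{- M..M}. F k x \<in> C"
    using visits_bounded[OF assms(1,2)] by blast
  \<comment> \<open>The bound \<open>M\<close> is two-sided; centring the window at
    \<open>M + 1\<close> makes the visit strictly later than \<open>x\<close>.\<close>
  obtain k where k: "k \<in> {- M..M}" "F k (F (M + 1) x) \<in> C"
    using M[of "F (M + 1) x"] assms(3) by auto
  then have "0 < nat (k + M + 1) \<and> F (int (nat (k + M + 1))) x \<in> C"
    by (auto simp: algebra_simps)
  then have *: "0 < (LEAST i. 0 < i \<and> F (int i) x \<in> C) \<and> F (int (LEAST i. 0 < i \<and> F (int i) x \<in> C)) x \<in> C"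
    by (rule LeastI)
  then show "0 < ret C x" "F (ret C x) x \<in> C"
    by (simp_all add: ret_def)
  show "F i x \<notin> C" if "0 < i" "i < ret C x" for i
    using not_less_Least[of "nat i" "\<lambda>i. 0 < i \<and> F (int i) x \<in> C"] that by (auto simp: ret_def)
qed

lemma ret_eqI:
  assumes "0 < i" "F i x \<in> C" "\<And>j. 0 < j \<Longrightarrow> j < i \<Longrightarrow> F j x \<notin> C"
  shows "ret C x = i"
proof -
  have "(LEAST i. 0 < i \<and> F (int i) x \<in> C) = nat i"
    by (rule Least_equality) (use assms in \<open>auto intro: leI simp: nat_le_iff simp flip: not_less\<close>)
  then show ?thesis
    using assms(1) by (simp add: ret_def)
qed

text \<open>If \<open>F i b = F j c\<close> with \<open>i \<le> j\<close>, then \<open>c\<close>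
  visits \<open>C\<close> after \<open>j - i\<close> steps, which is before its return time unless
  \<open>i = j\<close>.\<close>

lemma tower_free:
  assumes "clopen C" "C \<noteq> {}"
  shows "free (SIGMA c:C. {0..<ret C c})"
proof -
  have CT: "C \<subseteq> T"
    using assms(1) by (rule clopen_subset)
  have *: "b = c \<and> i = j" if "b \<in> C" "c \<in> C" "0 \<le> i" "i < ret C b" "0 \<le> j" "j < ret C c" "F i b = F j c" "i \<le> j" for b c i j
  proof -
    have "F (- i) (F i b) = F (- i) (F j c)"
      using that(7) by simp
    then have b: "b = F (j - i) c"
      by simp
    moreover have "j - i = 0"
      using ret(3)[OF assms, of c "j - i"] that b CT by (cases "j - i = 0") auto
    ultimately show ?thesis
      by simp
  qed
  show ?thesis
  proof (rule freeI)
    show "b = c \<and> i = j" if "(b, i) \<in> (SIGMA c:C. {0..<ret C c})" "(c, j) \<in> (SIGMA c:C. {0..<ret C c})" "F i b = F j c" for b i c j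
    proof (cases "i \<le> j")
      case True
      then show ?thesis
        using *[of b c i j] that by auto
    next
      case False
      then show ?thesis
        using *[of c b j i] that by auto
    qed
  qed (use CT in auto)
qed

text \<open>The base point is the latest visit to \<open>C\<close> not after \<open>x\<close>. A
  return within \<open>i\<close> steps would be a later one.\<close>

lemma tower_cover:
  assumes "clopen C" "C \<noteq> {}" "x \<in> T"
  obtains c i where "c \<in> C" "0 \<le> i" "i < ret C c" "x = F i c"
proof -
  obtain M where M: "\<And>x. x \<in> T \<Longrightarrow> \<exists>k\<in>{- M..M}. F k x \<in> C"
    using visits_bounded[OF assms(1,2)] by blast
  obtain k where k: "k \<in> {- M..M}" "F k (F (- M) x) \<in> C"
    using M[of "F (- M) x"] assms(3) by auto
  define P where "P i \<longleftrightarrow> F (- int i) x \<in> C" for i :: nat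
  have "P (nat (M - k))"
    using k by (simp add: P_def)
  then have least: "P (Least P)" "\<And>i. i < Least P \<Longrightarrow> \<not> P i"
    by (auto intro: LeastI dest: not_less_Least)
  let ?i = "int (Least P)" and ?c = "F (- int (Least P)) x"
  have c: "?c \<in> C"
    using least(1) by (simp add: P_def)
  have cT: "?c \<in> T"
    using assms(3) by simp
  have "?i < ret C ?c"
  proof (rule ccontr)
    assume "\<not> ?i < ret C ?c"
    moreover have "0 < ret C ?c" "F (ret C ?c) ?c \<in> C"
      using ret[OF assms(1,2) cT] by auto
    ultimately have "nat (?i - ret C ?c) < Least P" "P (nat (?i - ret C ?c))"
      by (auto simp: P_def add.commute)
    then show False
      using least(2) by blast
  qed
  then show thesis
    using that[OF c, of ?i] by simp
qed

lemma locally_constant_window: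
  assumes "locally_constant n" "x \<in> T" "finite I"
  obtains W where "clopen W" "x \<in> W" "\<And>y i. y \<in> W \<Longrightarrow> i \<in> I \<Longrightarrow> n (F i y) = n (F i x)"
proof -
  have "locally_constant (\<lambda>y. (\<lambda>i\<in>I. n (F i y)))"
    using assms by (intro locally_constant_finite locally_constant_F)
  from locally_constantD[OF this assms(2)] obtain W where W: "clopen W" "x \<in> W"
    "\<And>y. y \<in> W \<Longrightarrow> (\<lambda>i\<in>I. n (F i y)) = (\<lambda>i\<in>I. n (F i x))"
    by metis
  have "n (F i y) = n (F i x)" if "y \<in> W" "i \<in> I" for y i
    using fun_cong[OF W(3)[OF that(1)], of i] that(2) by simp
  then show thesis
    using that W(1,2) by metis
qed

lemma tower_element_mem:
  assumes g: "g \<in> full" and C: "clopen C" "C \<noteq> {}"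
    and cut: "\<And>c k. c \<in> C \<Longrightarrow> \<exists>j. g (F k c) = F j c \<and> (0 \<le> j \<longleftrightarrow> 0 \<le> k)"
    and H: "id \<in> H" "\<And>g h. g \<in> H \<Longrightarrow> h \<in> H \<Longrightarrow> g \<circ> h \<in> H"
      "\<And>U. clopen U \<Longrightarrow> free (U \<times> {0, 1}) \<Longrightarrow> swp U \<in> H"
  shows "g \<in> H"
proof -
  obtain n where n: "g permutes T" "locally_constant n" "\<And>x. x \<in> T \<Longrightarrow> g x = F (n x) x"
    using fullE[OF g] by metis
  have CT: "c \<in> C \<Longrightarrow> c \<in> T" for c
    using clopen_subset[OF C(1)] by blast
  have inner: "g (F k c) = F (k + n (F k c)) c" if "c \<in> C" for c k
    using n(3)[of "F k c"] CT[OF that] by (simp add: add.commute)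
  let ?D = "SIGMA c:C. {0..<ret C c}" and ?\<pi> = "\<lambda>c k. k + n (F k c)"
  have fr: "free ?D"
    using C by (rule tower_free)
  have range: "?\<pi> c k \<in> {0..<ret C c}" if c: "c \<in> C" and k: "k \<in> {0..<ret C c}" for c k
  proof -
    obtain j where j: "g (F k c) = F j c" "0 \<le> j \<longleftrightarrow> 0 \<le> k"
      using cut[OF c] by blast
    then have "j = ?\<pi> c k"
      using inner[OF c, of k] F_eq_iff[OF CT[OF c]] by simp
    \<comment> \<open>The cut at \<open>c\<close> keeps the new level nonnegative; the cut at the
      next visit keeps it below the return time.\<close>
    let ?c = "F (ret C c) c"
    have c': "?c \<in> C"
      using ret(2)[OF C CT[OF c]] .
    obtain i where i: "g (F (k - ret C c) ?c) = F i ?c" "0 \<le> i \<longleftrightarrow> 0 \<le> k - ret C c"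
      using cut[OF c'] by blast
    have "i + ret C c = ?\<pi> c k"
      using i(1) inner[OF c, of k] F_eq_iff[OF CT[OF c]] by simp
    then show ?thesis
      using i(2) j(2) \<open>j = ?\<pi> c k\<close> k by auto
  qed
  have bij: "bij_betw (?\<pi> c) {0..<ret C c} {0..<ret C c}" if c: "c \<in> C" for c
  proof -
    have "inj_on (?\<pi> c) {0..<ret C c}"
    proof (rule inj_onI)
      fix i j assume "?\<pi> c i = ?\<pi> c j"
      then have "g (F i c) = g (F j c)"
        using inner[OF c] by simp
      then show "i = j"
        using permutes_inj[OF n(1)] F_eq_iff[OF CT[OF c]] by (simp add: inj_eq)
    qed
    moreover have "?\<pi> c ` {0..<ret C c} \<subseteq> {0..<ret C c}"
      using range[OF c] by blast
    ultimately show ?thesis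
      unfolding bij_betw_def by (simp add: endo_inj_surj)
  qed
  have "tower ?D ?\<pi> = g"
  proof (rule tower_eqI[OF fr])
    fix x assume *: "\<And>b i. (b, i) \<in> ?D \<Longrightarrow> F i b \<noteq> x"
    have "x \<notin> T"
    proof
      assume "x \<in> T"
      then obtain c i where "c \<in> C" "0 \<le> i" "i < ret C c" "x = F i c"
        by (rule tower_cover[OF C])
      then show False
        using *[of c i] by simp
    qed
    then show "g x = x"
      using n(1) permutes_not_in by metis
  qed (use inner in auto)
  moreover have "tower ?D ?\<pi> \<in> H"
  proof (rule tower_mem[OF C(1) fr _ bij _ H])
    fix b assume b: "b \<in> C"
    have bT: "b \<in> T"
      using CT b .
    have "locally_constant (\<lambda>x. (x \<in> C, n x))"
      using locally_constant_mem[OF C(1)] n(2) by (rule locally_constant_pair)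
    \<comment> \<open>The window includes the level \<open>ret C b\<close>, so that nearby points
      have the same return time as well as the same permutation.\<close>
    from locally_constant_window[OF this bT finite_atLeastAtMost_int[of 0 "ret C b"]]
    obtain W where W: "clopen W" "b \<in> W"
      "\<And>y i. y \<in> W \<Longrightarrow> i \<in> {0..ret C b} \<Longrightarrow> (F i y \<in> C, n (F i y)) = (F i b \<in> C, n (F i b))"
      by metis
    have "{0..<ret C c} = {0..<ret C b} \<and> (\<forall>i\<in>{0..<ret C b}. ?\<pi> c i = ?\<pi> b i)" if "c \<in> W \<inter> C" for c
    proof
      have "ret C c = ret C b"
      proof (rule ret_eqI)
        show "0 < ret C b"
          by (rule ret(1)[OF C bT])
        then show "F (ret C b) c \<in> C"
          using W(3)[of c "ret C b"] ret(2)[OF C bT] that by simp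
        show "F j c \<notin> C" if "0 < j" "j < ret C b" for j
          using W(3)[of c j] ret(3)[OF C bT that] \<open>c \<in> W \<inter> C\<close> that by simp
      qed
      then show "{0..<ret C c} = {0..<ret C b}"
        by simp
      show "\<forall>i\<in>{0..<ret C b}. ?\<pi> c i = ?\<pi> b i"
        using W(3)[of c] that by simp
    qed
    then show "\<exists>W. clopen W \<and> b \<in> W \<and> (\<forall>c\<in>W \<inter> C. {0..<ret C c} = {0..<ret C b} \<and> (\<forall>i\<in>{0..<ret C b}. ?\<pi> c i = ?\<pi> b i))"
      using W(1,2) by blast
  qed auto
  ultimately show ?thesis
    by simp
qed

text \<open>The correction composes \<open>g\<close> with permutations of the window \<open>[-N, N)\<close> over a small clopen set \<open>C\<close>
  so that no point crosses the cut at a visit to \<open>C\<close>. It exists because the net flow is zero.\<close>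

lemma window_correction:
  assumes g: "g \<in> full" "locally_constant n" "\<And>x. x \<in> T \<Longrightarrow> g x = F (n x) x"
    and N: "0 < N" "\<And>x. x \<in> T \<Longrightarrow> \<bar>n x\<bar> < N" and flow: "\<And>x. x \<in> T \<Longrightarrow> flow N n x = 0"
    and C: "clopen C" "free (C \<times> {- 2 * N..2 * N})"
  obtains \<pi> where "\<And>c. c \<in> C \<Longrightarrow> \<pi> c permutes {- N..<N}"
    "\<And>c k. c \<in> C \<Longrightarrow> \<exists>j. g (tower (C \<times> {- N..<N}) \<pi> (F k c)) = F j c \<and> (0 \<le> j \<longleftrightarrow> 0 \<le> k)"
    "\<And>c. c \<in> C \<Longrightarrow> \<exists>W. clopen W \<and> c \<in> W \<and> (\<forall>d\<in>W \<inter> C. \<pi> d = \<pi> c)"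
proof -
  let ?J = "{- N..<N}"
  \<comment> \<open>The places of the window that \<open>g\<close> sends to the nonnegative side.
    Zero flow says that there are exactly \<open>N\<close> of them.\<close>
  define P where "P c = {j \<in> ?J. 0 \<le> j + n (F j c)}" for c
  \<comment> \<open>The choice depends on the set \<open>A\<close> alone, so \<pi> inherits local
    constancy from \<open>P\<close>.\<close>
  define perm where "perm A = (SOME p. p permutes ?J \<and> (\<forall>i\<in>?J. p i \<in> A \<longleftrightarrow> i \<in> {0..<N}))" for A
  define \<pi> where "\<pi> c = perm (P c)" for c
  have CT: "c \<in> C \<Longrightarrow> c \<in> T" for c
    using clopen_subset[OF C(1)] by blast
  have \<pi>: "\<pi> c permutes ?J \<and> (\<forall>i\<in>?J. \<pi> c i \<in> P c \<longleftrightarrow> i \<in> {0..<N})" if "c \<in> C" for c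
  proof -
    have "card {0..<N} = card (P c)"
      using flow[OF CT[OF that]] by (simp add: flow_def P_def)
    moreover have "finite ?J" "{0..<N} \<subseteq> ?J" "P c \<subseteq> ?J"
      using N(1) by (auto simp: P_def)
    ultimately obtain p where "p permutes ?J" "\<forall>i\<in>?J. p i \<in> P c \<longleftrightarrow> i \<in> {0..<N}"
      using exists_permutes_matching[of ?J "{0..<N}" "P c"] by metis
    then have "\<exists>p. p permutes ?J \<and> (\<forall>i\<in>?J. p i \<in> P c \<longleftrightarrow> i \<in> {0..<N})"
      by (intro exI[of _ p] conjI)
    then show ?thesis
      unfolding \<pi>_def perm_def by (rule someI_ex)
  qed
  have \<pi>J: "\<pi> c i \<in> ?J" if "c \<in> C" "i \<in> ?J" for c i
    using \<pi>[OF that(1)] permutes_in_image that(2) by metis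
  have fr: "free (C \<times> ?J)"
    using C(2) by (rule free_subset) (use N(1) in auto)
  have inner: "g (F k c) = F (k + n (F k c)) c" if "c \<in> C" for c k
    using g(3)[of "F k c"] CT[OF that] by (simp add: add.commute)
  have n: "\<bar>n (F k c)\<bar> < N" if "c \<in> C" for k c
    using N(2) CT[OF that] by simp
  have cut: "\<exists>j. g (tower (C \<times> ?J) \<pi> (F k c)) = F j c \<and> (0 \<le> j \<longleftrightarrow> 0 \<le> k)" if c: "c \<in> C" for c k
  proof (cases rule: tower_cases[of "C \<times> ?J" "F k c"])
    case (inside d i)
    then have d: "d \<in> C" and i: "i \<in> ?J"
      by auto
    define m where "m = k - i"
    have "F (- i) (F k c) = F (- i) (F i d)"
      using inside(2) by simp
    then have dm: "d = F m c"
      by (simp add: m_def)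
    let ?j = "\<pi> d i + n (F (\<pi> d i) d)"
    have j: "\<pi> d i \<in> ?J" "0 \<le> ?j \<longleftrightarrow> 0 \<le> i"
      using \<pi>J[OF d i] \<pi>[OF d] i by (auto simp: P_def)
    have "g (tower (C \<times> ?J) \<pi> (F k c)) = g (F (\<pi> d i) d)"
      unfolding inside(2) using tower_in[OF fr inside(1)] by simp
    also have "\<dots> = F ?j d"
      by (rule inner[OF d])
    also have "\<dots> = F (?j + m) c"
      using dm by simp
    finally have 1: "g (tower (C \<times> ?J) \<pi> (F k c)) = F (?j + m) c" .
    have "0 \<le> ?j + m \<longleftrightarrow> 0 \<le> k"
    proof (cases "m = 0")
      case True
      then show ?thesis
        using j(2) m_def by simp
    next
      case False
      \<comment> \<open>Windows at different visits are far apart, so a window at \<open>d\<close>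
        cannot interfere with the cut at \<open>c\<close>. A distance of at most
        \<open>4 * N\<close> splits into two halves of at most \<open>2 * N\<close>, contradicting
        freeness of \<open>C\<close>; this explains the constant in the hypothesis.\<close>
      have "\<bar>m\<bar> > 4 * N"
      proof (rule ccontr)
        assume "\<not> \<bar>m\<bar> > 4 * N"
        then have m: "\<bar>m div 2\<bar> \<le> 2 * N" "\<bar>m - m div 2\<bar> \<le> 2 * N"
          by linarith+
        have "F (- (m div 2)) d = F (m - m div 2) c"
          using dm by (simp add: algebra_simps)
        then have "d = c \<and> - (m div 2) = m - m div 2"
          using freeD[OF C(2), of d "- (m div 2)" c "m - m div 2"] c d m by (auto simp: abs_le_iff)
        then show False
          using False by simp
      qed
      moreover have "\<bar>?j\<bar> < 2 * N" "\<bar>i\<bar> \<le> N"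
        using j(1) i n[OF d, of "\<pi> d i"] by auto
      ultimately show ?thesis
        unfolding m_def by auto
    qed
    with 1 show ?thesis
      by blast
  next
    case outside
    then have "k \<notin> ?J"
      using c by blast
    then have "0 \<le> k + n (F k c) \<longleftrightarrow> 0 \<le> k"
      using n[OF c, of k] by auto
    moreover have "g (tower (C \<times> ?J) \<pi> (F k c)) = F (k + n (F k c)) c"
      using tower_out[of "C \<times> ?J" "F k c" \<pi>] outside inner[OF c] by metis
    ultimately show ?thesis
      by blast
  qed
  have loc: "\<exists>W. clopen W \<and> c \<in> W \<and> (\<forall>d\<in>W \<inter> C. \<pi> d = \<pi> c)" if c: "c \<in> C" for c
  proof -
    obtain W where W: "clopen W" "c \<in> W" "\<And>y i. y \<in> W \<Longrightarrow> i \<in> ?J \<Longrightarrow> n (F i y) = n (F i c)"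
      using locally_constant_window[OF g(2) CT[OF c], of ?J] by (metis finite_atLeastLessThan_int)
    have "P d = P c" if "d \<in> W" for d
      using W(3)[OF that] unfolding P_def by auto
    then show ?thesis
      using W(1,2) unfolding \<pi>_def by (metis IntD1)
  qed
  show thesis
    by (rule that[of \<pi>]) (use \<pi> cut loc in blast)+
qed

lemma flow_zero_mem:
  assumes g: "g \<in> full" "locally_constant n" "\<And>x. x \<in> T \<Longrightarrow> g x = F (n x) x"
    and N: "0 < N" "\<And>x. x \<in> T \<Longrightarrow> \<bar>n x\<bar> < N" and flow: "\<And>x. x \<in> T \<Longrightarrow> flow N n x = 0"
    and H: "subgroup H G" "\<And>U. clopen U \<Longrightarrow> free (U \<times> {0, 1}) \<Longrightarrow> swp U \<in> H"
  shows "g \<in> H"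
proof -
  have H1: "id \<in> H" and H2: "\<And>g h. g \<in> H \<Longrightarrow> h \<in> H \<Longrightarrow> g \<circ> h \<in> H"
    using subgroup.one_closed[OF H(1)] subgroup.m_closed[OF H(1)] by auto
  obtain x where x: "x \<in> T"
    using T_nonempty by blast
  obtain C where C: "clopen C" "x \<in> C" "free (C \<times> {- 2 * N..2 * N})"
    by (rule free_Times_nbhd[OF x finite_atLeastAtMost_int[of "- 2 * N" "2 * N"]])
  let ?J = "{- N..<N}"
  obtain \<pi> where \<pi>: "\<And>c. c \<in> C \<Longrightarrow> \<pi> c permutes ?J"
    "\<And>c k. c \<in> C \<Longrightarrow> \<exists>j. g (tower (C \<times> ?J) \<pi> (F k c)) = F j c \<and> (0 \<le> j \<longleftrightarrow> 0 \<le> k)"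
    "\<And>c. c \<in> C \<Longrightarrow> \<exists>W. clopen W \<and> c \<in> W \<and> (\<forall>d\<in>W \<inter> C. \<pi> d = \<pi> c)"
    by (rule window_correction[OF g N flow C(1,3)]) metis+
  let ?r = "tower (C \<times> ?J) \<pi>"
  have fr: "free (C \<times> ?J)"
    using C(3) by (rule free_subset) (use N(1) in auto)
  \<comment> \<open>Stated for every \<open>K\<close> closed under composition: \<open>full\<close>
    is needed to invert the correction in the group, and \<open>H\<close> for the
    conclusion.\<close>
  have r: "?r \<in> K" if "id \<in> K" "\<And>g h. g \<in> K \<Longrightarrow> h \<in> K \<Longrightarrow> g \<circ> h \<in> K"
      "\<And>U. clopen U \<Longrightarrow> free (U \<times> {0, 1}) \<Longrightarrow> swp U \<in> K" for K
  proof (rule tower_mem[OF C(1) fr _ _ _ that])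
    show "bij_betw (\<pi> b) ?J ?J" if "b \<in> C" for b
      using \<pi>(1)[OF that] by (rule permutes_imp_bij)
    show "\<exists>W. clopen W \<and> b \<in> W \<and> (\<forall>c\<in>W \<inter> C. ?J = ?J \<and> (\<forall>i\<in>?J. \<pi> c i = \<pi> b i))" if "b \<in> C" for b
      using \<pi>(3)[OF that] by metis
  qed auto
  have swp_full: "swp U \<in> full" if "clopen U" "free (U \<times> {0, 1})" for U
    unfolding swp_def using that by (intro tower_full permutes_swap_id) auto
  have rfull: "?r \<in> full"
    by (rule r[OF full_id full_comp swp_full])
  have rH: "?r \<in> H"
    by (rule r[OF H1 H2 H(2)])
  have "g \<circ> ?r \<in> H"
    by (rule tower_element_mem[OF full_comp[OF g(1) rfull] C(1) _ _ H1 H2 H(2)])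
      (use C(2) \<pi>(2) in auto)
  moreover have "inv_into UNIV ?r \<in> H"
    using subgroup.m_inv_closed[OF H(1) rH] inv_G[OF rfull] by simp
  ultimately have "(g \<circ> ?r) \<circ> inv_into UNIV ?r \<in> H"
    by (rule H2)
  moreover have "?r \<circ> inv_into UNIV ?r = id"
    using surj_iff[THEN iffD1, OF bij_is_surj[OF full_bij[OF rfull]]] .
  ultimately show ?thesis
    by (simp add: comp_assoc)
qed

subsection \<open>3-cycles generate a normal subgroup\<close>

text \<open>\<open>U\<close> is the middle level: the cycle is \<open>F (- 1) ` U\<close> to \<open>U\<close> to \<open>F 1 ` U\<close> and back, Matui's \<open>\<gamma>\<^sub>U\<close>.\<close>

definition gamma :: "'a set \<Rightarrow> 'a \<Rightarrow> 'a" where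
  "gamma U = cycle3 U (- 1) 0 1"

definition gammas :: "('a \<Rightarrow> 'a) set" where
  "gammas = gamma ` {U. clopen U \<and> free (U \<times> {- 1, 0, 1})}"

text \<open>The kernel of the index map described without measures; see
  \<open>index_kernel_eq\<close>.\<close>

definition zero_flow :: "('a \<Rightarrow> 'a) set" where
  "zero_flow = {g \<in> full. \<exists>n N. locally_constant n \<and> (\<forall>x\<in>T. g x = F (n x) x \<and> \<bar>n x\<bar> < N \<and> flow N n x = 0)}"

lemma cycle3_full:
  assumes "clopen U" "free (U \<times> {a, b, c})"
  shows "cycle3 U a b c \<in> full"
  unfolding cycle3_def using assms
  by (intro tower_full permutes_compose permutes_swap_id) auto

lemma swp_full: "clopen U \<Longrightarrow> free (U \<times> {0, 1}) \<Longrightarrow> swp U \<in> full"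
  unfolding swp_def by (intro tower_full permutes_swap_id) auto

lemma gamma_full: "clopen U \<Longrightarrow> free (U \<times> {- 1, 0, 1}) \<Longrightarrow> gamma U \<in> full"
  unfolding gamma_def by (rule cycle3_full)

section \<open>Additivity in the base and 3-cycles on arbitrary levels\<close>

lemma tower_const_Un:
  assumes "free ((A \<union> B) \<times> J)" "A \<inter> B = {}" "\<pi> permutes J"
  shows "tower ((A \<union> B) \<times> J) (\<lambda>_. \<pi>) = tower (A \<times> J) (\<lambda>_. \<pi>) \<circ> tower (B \<times> J) (\<lambda>_. \<pi>)"
proof -
  have "tower (A \<times> J \<union> B \<times> J) (\<lambda>_. \<pi>) = tower (A \<times> J) (\<lambda>_. \<pi>) \<circ> tower (B \<times> J) (\<lambda>_. \<pi>)"
  proof (rule tower_Un)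
    show "free (A \<times> J \<union> B \<times> J)"
      using assms(1) by (simp add: Sigma_Un_distrib1)
  qed (use assms(2) permutes_in_image[OF assms(3)] in auto)
  then show ?thesis
    by (simp add: Sigma_Un_distrib1)
qed

lemma swp_Un: "free ((A \<union> B) \<times> {0, 1}) \<Longrightarrow> A \<inter> B = {} \<Longrightarrow> swp (A \<union> B) = swp A \<circ> swp B"
  unfolding swp_def by (rule tower_const_Un) (auto intro: permutes_swap_id)

lemma cycle3_Un:
  "free ((A \<union> B) \<times> {a, b, c}) \<Longrightarrow> A \<inter> B = {} \<Longrightarrow> cycle3 (A \<union> B) a b c = cycle3 A a b c \<circ> cycle3 B a b c"
  unfolding cycle3_def by (rule tower_const_Un) (auto intro!: permutes_swap_id permutes_compose)

lemma free_Times_subset: "free (U \<times> I) \<Longrightarrow> V \<subseteq> U \<Longrightarrow> J \<subseteq> I \<Longrightarrow> free (V \<times> J)"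
  by (erule free_subset) auto

lemma cycle3_tower:
  assumes "free (V \<times> J)" "a + i \<in> J" "b + i \<in> J" "c + i \<in> J"
  shows "cycle3 (F i ` V) a b c = tower (V \<times> J) (\<lambda>_. Transposition.transpose (a + i) (b + i) \<circ> Transposition.transpose (b + i) (c + i))"
proof -
  have "cycle3 (F i ` V) a b c = tower (V \<times> J) (\<lambda>_ k. (Transposition.transpose a b \<circ> Transposition.transpose b c) (k - i) + i)"
    unfolding cycle3_def
    by (rule tower_shift[OF assms(1)]) (use assms in \<open>auto intro!: permutes_swap_id permutes_compose\<close>)
  also have "\<dots> = tower (V \<times> J) (\<lambda>_. Transposition.transpose (a + i) (b + i) \<circ> Transposition.transpose (b + i) (c + i))"
    by (rule tower_cong[OF assms(1)]) (auto simp: Transposition.transpose_def)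
  finally show ?thesis .
qed

text \<open>A product of two adjacent transpositions lies in \<open>H\<close>: for neighbouring ones it is a power of some
  \<open>gamma\<close>, and in general it telescopes.\<close>

lemma even_tower_mem:
  assumes V: "clopen V" "free (V \<times> {l..u})" and p: "p permutes {l..u}" "evenperm p"
    and H: "subgroup H G" "gammas \<subseteq> H"
  shows "tower (V \<times> {l..u}) (\<lambda>_. p) \<in> H"
proof -
  define t where "t p = tower (V \<times> {l..u}) (\<lambda>_. p)" for p
  define s where "s i = Transposition.transpose i (i + 1)" for i :: int
  have comp: "t p \<circ> t q = t (p \<circ> q)" if "q permutes {l..u}" for p q
    unfolding t_def by (rule tower_comp[OF V(2)]) (use permutes_in_image[OF that] in auto)
  have H1: "g \<circ> h \<in> H" if "g \<in> H" "h \<in> H" for g h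
    using subgroup.m_closed[OF H(1) that] by simp
  have sp: "s i permutes {l..u}" if "l \<le> i" "i < u" for i
    unfolding s_def using that by (intro permutes_swap_id) auto
  have s2: "s i \<circ> s i = id" for i
    by (simp add: s_def)
  have idH: "t id \<in> H"
    using tower_id[OF V(2), of "\<lambda>_. id"] subgroup.one_closed[OF H(1)] by (simp add: id_def t_def)
  have cons: "t (s i \<circ> s (i + 1)) \<in> H" if "l \<le> i" "i + 1 < u" for i
  proof -
    have "gamma (F (i + 1) ` V) = t (s i \<circ> s (i + 1))"
      unfolding gamma_def t_def s_def using cycle3_tower[OF V(2), of "- 1" "i + 1" 0 1] that by (simp add: add.commute)
    moreover have "gamma (F (i + 1) ` V) \<in> gammas"
      unfolding gammas_def using V(1) that by (auto intro!: imageI free_F[OF V(2)])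
    ultimately show ?thesis
      using H(2) by auto
  qed
  have cons': "t (s (i + 1) \<circ> s i) \<in> H" if "l \<le> i" "i + 1 < u" for i
  proof -
    \<comment> \<open>The square of a 3-cycle is its inverse.\<close>
    have "(s i \<circ> s (i + 1)) \<circ> (s i \<circ> s (i + 1)) = s (i + 1) \<circ> s i"
      by (auto simp: fun_eq_iff Transposition.transpose_def s_def)
    then have "t (s (i + 1) \<circ> s i) = t (s i \<circ> s (i + 1)) \<circ> t (s i \<circ> s (i + 1))"
      using comp[OF permutes_compose[OF sp sp], of "i + 1" i "s i \<circ> s (i + 1)"] that by simp
    then show ?thesis
      using H1 cons[OF that] by simp
  qed
  have pair: "t (s i \<circ> s (i + int n)) \<in> H \<and> t (s (i + int n) \<circ> s i) \<in> H" if "l \<le> i" "i + int n < u" for i n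
    using that
  proof (induction n)
    case 0
    then show ?case
      using idH by (simp only: of_nat_0 add_0_right s2 simp_thms)
  next
    case (Suc n)
    let ?j = "i + int n"
    have j: "l \<le> ?j" "?j + 1 < u"
      using Suc.prems by auto
    have j': "i + int (Suc n) = ?j + 1"
      by simp
    have e1: "(s i \<circ> s ?j) \<circ> (s ?j \<circ> s (?j + 1)) = s i \<circ> s (?j + 1)"
      using s2[of ?j] by (metis comp_assoc comp_id)
    have e2: "(s (?j + 1) \<circ> s ?j) \<circ> (s ?j \<circ> s i) = s (?j + 1) \<circ> s i"
      using s2[of ?j] by (metis comp_assoc comp_id)
    have IH: "t (s i \<circ> s ?j) \<in> H" "t (s ?j \<circ> s i) \<in> H"
    proof -
      have "i + int n < u"
        using Suc.prems by simp
      then show "t (s i \<circ> s ?j) \<in> H" "t (s ?j \<circ> s i) \<in> H"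
        using Suc.IH Suc.prems(1) by blast+
    qed
    have p: "s ?j \<circ> s (?j + 1) permutes {l..u}" "s ?j \<circ> s i permutes {l..u}"
      using j Suc.prems by (auto intro!: permutes_compose sp)
    have "t (s i \<circ> s (?j + 1)) \<in> H"
      using H1[OF IH(1) cons[OF j]] unfolding comp[OF p(1)] e1 .
    moreover have "t (s (?j + 1) \<circ> s i) \<in> H"
      using H1[OF cons'[OF j] IH(2)] unfolding comp[OF p(2)] e2 .
    ultimately show ?case
      unfolding j' by blast
  qed
  have pair': "t (s i \<circ> s j) \<in> H" if "l \<le> i" "i < u" "l \<le> j" "j < u" for i j
    using pair[of i "nat (j - i)"] pair[of j "nat (i - j)"] that by (cases "i \<le> j") auto
  have perm: "permutation q" if "q permutes {l..u}" for q
    using that by (rule permutes_imp_permutation[rotated]) simp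
  \<comment> \<open>Each letter flips the parity, so both parities are carried along; an odd
    permutation is made even by one further adjacent transposition, whichever it is.\<close>
  have "(evenperm p \<longrightarrow> t p \<in> H) \<and> (\<not> evenperm p \<longrightarrow> (\<forall>i. l \<le> i \<and> i < u \<longrightarrow> t (s i \<circ> p) \<in> H))"
    using p(1)
  proof (induction rule: permutes_adjacent_word_induct)
    case id
    then show ?case
      using idH evenperm_id by blast
  next
    case (step i q)
    note step = step[folded s_def]
    have ev: "evenperm (s i \<circ> q) \<longleftrightarrow> \<not> evenperm q"
      using evenperm_comp[OF permutation_swap_id perm[OF step(3)], of i "i + 1"] evenperm_swap[of i "i + 1"] by (simp add: s_def)
    have "t (s j \<circ> (s i \<circ> q)) \<in> H" if "evenperm q" "l \<le> j" "j < u" for j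
    proof -
      have "t (s j \<circ> s i) \<circ> t q = t (s j \<circ> (s i \<circ> q))"
        using comp[OF step(3), of "s j \<circ> s i"] unfolding comp_assoc .
      then show ?thesis
        using H1[OF pair'[OF that(2,3) step(1,2)], of "t q"] step(4) that(1) by metis
    qed
    then show ?case
      using step(1,2,4) ev unfolding s_def[symmetric] by blast
  qed
  then show ?thesis
    using p(2) by (simp add: t_def)
qed

text \<open>Locally an interval containing \<open>a\<close>, \<open>b\<close> and \<open>c\<close>
  is free, and there the 3-cycle is an even permutation of the interval.\<close>

lemma cycle3_mem:
  assumes U: "clopen U" "free (U \<times> {a, b, c})" and abc: "a \<noteq> b" "b \<noteq> c"
    and H: "subgroup H G" "gammas \<subseteq> H"
  shows "cycle3 U a b c \<in> H"
  using U(1)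
proof (rule clopen_induct)
  show "cycle3 {} a b c \<in> H"
    using subgroup.one_closed[OF H(1)] by (simp add: cycle3_def)
next
  fix A B assume AB: "A \<inter> B = {}" "A \<union> B \<subseteq> U" "cycle3 A a b c \<in> H" "cycle3 B a b c \<in> H"
  have "free ((A \<union> B) \<times> {a, b, c})"
    using U(2) by (rule free_Times_subset) (use AB in auto)
  then have "cycle3 (A \<union> B) a b c = cycle3 A a b c \<circ> cycle3 B a b c"
    using AB(1) by (rule cycle3_Un)
  then show "cycle3 (A \<union> B) a b c \<in> H"
    using subgroup.m_closed[OF H(1) AB(3,4)] by simp
next
  fix x assume "x \<in> U"
  then have x: "x \<in> T"
    using clopen_subset[OF U(1)] by blast
  define M where "M = \<bar>a\<bar> + \<bar>b\<bar> + \<bar>c\<bar>"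
  obtain W where W: "clopen W" "x \<in> W" "free (W \<times> {- M..M})"
    by (rule free_Times_nbhd[OF x finite_atLeastAtMost_int[of "- M" M]])
  have "cycle3 V a b c \<in> H" if V: "clopen V" "V \<subseteq> W" for V
  proof -
    have fr: "free (V \<times> {- M..M})"
      using W(3) by (rule free_Times_subset) (use V in auto)
    have in_M: "a \<in> {- M..M}" "b \<in> {- M..M}" "c \<in> {- M..M}"
      by (auto simp: M_def)
    have "cycle3 V a b c = tower (V \<times> {- M..M}) (\<lambda>_. Transposition.transpose a b \<circ> Transposition.transpose b c)"
      using cycle3_tower[OF fr, of a 0 b c] in_M by simp
    also have "\<dots> \<in> H"
    proof (rule even_tower_mem[OF V(1) fr _ _ H])
      show "Transposition.transpose a b \<circ> Transposition.transpose b c permutes {- M..M}"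
        using in_M by (intro permutes_compose permutes_swap_id)
      show "evenperm (Transposition.transpose a b \<circ> Transposition.transpose b c)"
        using abc evenperm_comp[OF permutation_swap_id permutation_swap_id, of a b b c] evenperm_swap by metis
    qed
    finally show ?thesis .
  qed
  then show "\<exists>W. clopen W \<and> x \<in> W \<and> (\<forall>V. clopen V \<and> V \<subseteq> W \<and> V \<subseteq> U \<longrightarrow> cycle3 V a b c \<in> H)"
    using W(1,2) by blast
qed

lemma gammas_full: "gammas \<subseteq> full"
  unfolding gammas_def using gamma_full by auto

lemma subgroup_Gamma: "subgroup (generate G gammas) G"
  using G.generate_is_subgroup gammas_full by simp

lemma full_inverse:
  assumes "g \<in> full"
  shows "inv_into UNIV g (g x) = x" "g (inv_into UNIV g x) = x"
  using full_bij[OF assms] by (simp_all add: bij_is_inj bij_is_surj surj_f_inv_f)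

lemma cycle3_values:
  assumes "free (U \<times> {a, b, c})" "a \<noteq> b" "b \<noteq> c" "a \<noteq> c" "y \<in> U"
  shows "cycle3 U a b c (F a y) = F b y" "cycle3 U a b c (F b y) = F c y" "cycle3 U a b c (F c y) = F a y"
  unfolding cycle3_def using tower_in[OF assms(1)] assms(2-5) by (simp_all add: Transposition.transpose_def)

text \<open>Conjugation only relabels levels, as long as \<open>g\<close> moves each of the three by
  a constant amount. The map \<sigma> leads from the new labels back to the old ones.\<close>

lemma conj_cycle3_const:
  assumes g: "g \<in> full" and V: "free (V \<times> {a, b, c})" and abc: "a \<noteq> b" "b \<noteq> c" "a \<noteq> c" and "V \<noteq> {}"
    and const: "\<And>y. y \<in> V \<Longrightarrow> g (F a y) = F a' y \<and> g (F b y) = F b' y \<and> g (F c y) = F c' y"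
  shows "a' \<noteq> b' \<and> b' \<noteq> c' \<and> a' \<noteq> c'" (is ?dist) "free (V \<times> {a', b', c'})"
    "g \<circ> cycle3 V a b c \<circ> inv_into UNIV g = cycle3 V a' b' c'"
proof -
  have g_inj: "x = y" if "g x = g y" for x y
    using that full_inverse(1)[OF g] by metis
  obtain y where y: "y \<in> V"
    using \<open>V \<noteq> {}\<close> by blast
  then have yT: "y \<in> T"
    using free_base[OF V] by blast
  show dist: ?dist
    using const[OF y] F_eq_iff[OF yT] g_inj abc by metis
  define \<sigma> where "\<sigma> i = (if i = a' then a else if i = b' then b else c)" for i
  have \<sigma>: "F i z = g (F (\<sigma> i) z)" "\<sigma> i \<in> {a, b, c}" if "(z, i) \<in> V \<times> {a', b', c'}" for i z
    using that const[of z] dist by (auto simp: \<sigma>_def)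
  have \<sigma>_inj: "i = j" if "\<sigma> i = \<sigma> j" "i \<in> {a', b', c'}" "j \<in> {a', b', c'}" for i j
    using that abc dist by (auto simp: \<sigma>_def split: if_splits)
  show fr: "free (V \<times> {a', b', c'})"
  proof (rule freeI)
    fix z i w j assume *: "(z, i) \<in> V \<times> {a', b', c'}" "(w, j) \<in> V \<times> {a', b', c'}" "F i z = F j w"
    then have "F (\<sigma> i) z = F (\<sigma> j) w"
      using \<sigma>(1)[OF *(1)] \<sigma>(1)[OF *(2)] g_inj by metis
    then have "z = w \<and> \<sigma> i = \<sigma> j"
      using freeD[OF V, of z "\<sigma> i" w "\<sigma> j"] \<sigma>(2)[OF *(1)] \<sigma>(2)[OF *(2)] * by blast
    then show "z = w \<and> i = j"
      using \<sigma>_inj[of i j] * by blast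
  next
    show "z \<in> T" if "(z, i) \<in> V \<times> {a', b', c'}" for z i
      using free_base[OF V, of z a] that by blast
  qed
  have "cycle3 V a' b' c' = g \<circ> cycle3 V a b c \<circ> inv_into UNIV g"
    unfolding cycle3_def[of V a' b' c']
  proof (rule tower_eqI[OF fr])
    fix z i assume zi: "(z, i) \<in> V \<times> {a', b', c'}"
    then have z: "z \<in> V"
      by blast
    have i: "inv_into UNIV g (F a' z) = F a z" "inv_into UNIV g (F b' z) = F b z" "inv_into UNIV g (F c' z) = F c z"
      using const[OF z] full_inverse(1)[OF g] by metis+
    show "(g \<circ> cycle3 V a b c \<circ> inv_into UNIV g) (F i z) =
        F ((Transposition.transpose a' b' \<circ> Transposition.transpose b' c') i) z"
      using zi i cycle3_values[OF V abc z] const[OF z] dist by (auto simp: Transposition.transpose_def)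
  next
    fix x assume *: "\<And>z i. (z, i) \<in> V \<times> {a', b', c'} \<Longrightarrow> F i z \<noteq> x"
    have "cycle3 V a b c (inv_into UNIV g x) = inv_into UNIV g x"
      unfolding cycle3_def
    proof (rule tower_out)
      fix z i assume zi: "(z, i) \<in> V \<times> {a, b, c}"
      show "F i z \<noteq> inv_into UNIV g x"
      proof
        assume "F i z = inv_into UNIV g x"
        then have "g (F i z) = x"
          using full_inverse(2)[OF g] by metis
        then show False
          using *[of z a'] *[of z b'] *[of z c'] const[of z] zi by auto
      qed
    qed
    then show "(g \<circ> cycle3 V a b c \<circ> inv_into UNIV g) x = x"
      using full_inverse(2)[OF g] by simp
  qed
  then show "g \<circ> cycle3 V a b c \<circ> inv_into UNIV g = cycle3 V a' b' c'"
    by simp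
qed

text \<open>Locally the cocycle of \<open>g\<close> is constant on the three levels, so the
  conjugate is a 3-cycle on other levels and \<open>cycle3_mem\<close> applies.\<close>

lemma conj_cycle3_mem:
  assumes g: "g \<in> full" and U: "clopen U" "free (U \<times> {a, b, c})" and abc: "a \<noteq> b" "b \<noteq> c" "a \<noteq> c"
    and H: "subgroup H G" "gammas \<subseteq> H"
  shows "g \<circ> cycle3 U a b c \<circ> inv_into UNIV g \<in> H"
  using U(1)
proof (rule clopen_induct)
  have "g \<circ> inv_into UNIV g = id"
    using full_inverse(2)[OF g] by auto
  then show "g \<circ> cycle3 {} a b c \<circ> inv_into UNIV g \<in> H"
    using subgroup.one_closed[OF H(1)] by (simp add: cycle3_def)
next
  fix A B assume AB: "A \<inter> B = {}" "A \<union> B \<subseteq> U"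
    "g \<circ> cycle3 A a b c \<circ> inv_into UNIV g \<in> H" "g \<circ> cycle3 B a b c \<circ> inv_into UNIV g \<in> H"
  have "free ((A \<union> B) \<times> {a, b, c})"
    using U(2) by (rule free_Times_subset) (use AB in auto)
  then have "cycle3 (A \<union> B) a b c = cycle3 A a b c \<circ> cycle3 B a b c"
    using AB(1) by (rule cycle3_Un)
  then have "g \<circ> cycle3 (A \<union> B) a b c \<circ> inv_into UNIV g
      = (g \<circ> cycle3 A a b c \<circ> inv_into UNIV g) \<circ> (g \<circ> cycle3 B a b c \<circ> inv_into UNIV g)"
    using full_inverse(1)[OF g] by (auto simp: fun_eq_iff)
  then show "g \<circ> cycle3 (A \<union> B) a b c \<circ> inv_into UNIV g \<in> H"
    using subgroup.m_closed[OF H(1) AB(3,4)] by simp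
next
  fix x assume "x \<in> U"
  then have x: "x \<in> T"
    using clopen_subset[OF U(1)] by blast
  obtain n where n: "g permutes T" "locally_constant n" "\<And>x. x \<in> T \<Longrightarrow> g x = F (n x) x"
    using fullE[OF g] by metis
  obtain W where W: "clopen W" "x \<in> W" "\<And>y i. y \<in> W \<Longrightarrow> i \<in> {a, b, c} \<Longrightarrow> n (F i y) = n (F i x)"
    using locally_constant_window[OF n(2) x, of "{a, b, c}"] by (metis finite.emptyI finite.insertI)
  have "g \<circ> cycle3 V a b c \<circ> inv_into UNIV g \<in> H" if V: "clopen V" "V \<subseteq> W" "V \<subseteq> U" for V
  proof (cases "V = {}")
    case True
    have "g \<circ> inv_into UNIV g = id"
      using full_inverse(2)[OF g] by auto
    then show ?thesis
      using subgroup.one_closed[OF H(1)] True by (simp add: cycle3_def)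
  next
    case False
    have fr: "free (V \<times> {a, b, c})"
      using U(2) by (rule free_Times_subset) (use V in auto)
    have c: "g (F i y) = F (n (F i x) + i) y" if "y \<in> V" "i \<in> {a, b, c}" for y i
    proof -
      have "y \<in> W" "y \<in> T"
        using that V(2) clopen_subset[OF V(1)] by blast+
      then show ?thesis
        using n(3)[of "F i y"] W(3)[of y i] that(2) by simp
    qed
    have const: "g (F a y) = F (n (F a x) + a) y \<and> g (F b y) = F (n (F b x) + b) y \<and> g (F c y) = F (n (F c x) + c) y"
      if "y \<in> V" for y
      using c[OF that] by simp
    note * = conj_cycle3_const[OF g fr abc False const]
    show ?thesis
      using *(3) cycle3_mem[OF V(1) *(2) _ _ H] *(1) by simp
  qed
  then show "\<exists>W. clopen W \<and> x \<in> W \<and> (\<forall>V. clopen V \<and> V \<subseteq> W \<and> V \<subseteq> U \<longrightarrow> g \<circ> cycle3 V a b c \<circ> inv_into UNIV g \<in> H)"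
    using W(1,2) by blast
qed

lemma normal_Gamma: "generate G gammas \<lhd> G"
proof -
  let ?\<Gamma> = "generate G gammas"
  \<comment> \<open>All conjugates of the generators together are closed under conjugation, so they
    generate a normal subgroup; \<open>conj_cycle3_mem\<close> shows that nothing new is
    generated.\<close>
  let ?S = "(\<lambda>(g, h). g \<circ> h \<circ> inv_into UNIV g) ` (full \<times> gammas)"
  have S_full: "?S \<subseteq> full"
    using gammas_full full_inv full_comp by auto
  have "generate G ?S \<lhd> G"
  proof (rule G.normal_generateI)
    fix h g assume h: "h \<in> ?S" and g: "g \<in> carrier G"
    obtain k s where ks: "k \<in> full" "s \<in> gammas" "h = k \<circ> s \<circ> inv_into UNIV k"
      using h by auto
    have gk: "g \<circ> k \<in> full"
      using g ks full_comp by simp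
    have "inv_into UNIV (g \<circ> k) = inv_into UNIV k \<circ> inv_into UNIV g"
      using full_bij g ks by (simp add: o_inv_distrib)
    then have "g \<otimes>\<^bsub>G\<^esub> h \<otimes>\<^bsub>G\<^esub> inv\<^bsub>G\<^esub> g = (g \<circ> k) \<circ> s \<circ> inv_into UNIV (g \<circ> k)"
      using g ks by (simp add: inv_G comp_assoc)
    then show "g \<otimes>\<^bsub>G\<^esub> h \<otimes>\<^bsub>G\<^esub> inv\<^bsub>G\<^esub> g \<in> ?S"
      using gk ks(2) by force
  qed (use S_full in simp)
  moreover have "generate G ?S = ?\<Gamma>"
  proof
    have "?S \<subseteq> ?\<Gamma>"
    proof (rule image_subsetI)
      fix p assume "p \<in> full \<times> gammas"
      then obtain g U where p: "p = (g, gamma U)" "g \<in> full" "clopen U" "free (U \<times> {- 1, 0, 1})"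
        unfolding gammas_def by auto
      have "g \<circ> cycle3 U (- 1) 0 1 \<circ> inv_into UNIV g \<in> ?\<Gamma>"
        by (rule conj_cycle3_mem[OF p(2-4) _ _ _ subgroup_Gamma]) (auto intro: generate.incl)
      then show "(case p of (g, h) \<Rightarrow> g \<circ> h \<circ> inv_into UNIV g) \<in> ?\<Gamma>"
        by (simp add: p(1) gamma_def)
    qed
    then show "generate G ?S \<subseteq> ?\<Gamma>"
      using G.generate_subgroup_incl subgroup_Gamma by blast
    have "gammas \<subseteq> ?S"
    proof
      fix s assume "s \<in> gammas"
      then have "(id, s) \<in> full \<times> gammas"
        using full_id by simp
      moreover have "s = (\<lambda>(g, h). g \<circ> h \<circ> inv_into UNIV g) (id, s)"
        by simp
      ultimately show "s \<in> ?S"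
        by (rule rev_image_eqI)
    qed
    then show "?\<Gamma> \<subseteq> generate G ?S"
      by (rule G.mono_generate)
  qed
  ultimately show ?thesis
    by simp
qed

subsection \<open>The commutator subgroup\<close>

lemma F_0_image [simp]: "F 0 ` W = W"
  by simp

lemma free_01: "free (U \<times> {0, 1}) \<longleftrightarrow> U \<subseteq> T \<and> (\<forall>x\<in>U. F 1 x \<notin> U)"
proof safe
  assume fr: "free (U \<times> {0, 1})"
  show "x \<in> T" if "x \<in> U" for x
    using free_base[OF fr, of x 0] that by simp
  show False if "x \<in> U" "F 1 x \<in> U" for x
    using freeD[OF fr, of x 1 "F 1 x" 0] that by simp
next
  assume U: "U \<subseteq> T" "\<forall>x\<in>U. F 1 x \<notin> U"
  show "free (U \<times> {0, 1})"
  proof (rule freeI)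
    fix b i c j assume *: "(b, i) \<in> U \<times> {0, 1 :: int}" "(c, j) \<in> U \<times> {0, 1}" "F i b = F j c"
    have "i = j"
    proof (rule ccontr)
      assume "i \<noteq> j"
      then consider "i = 0" "j = 1" | "i = 1" "j = 0"
        using * by auto
      then show False
        using U(2) * by cases auto
    qed
    then show "b = c \<and> i = j"
      using * by simp
  qed (use U in auto)
qed

lemma swp_empty [simp]: "swp {} = id"
  by (simp add: swp_def)

lemma swp_swp: "free (U \<times> {0, 1}) \<Longrightarrow> swp U \<circ> swp U = id"
  unfolding swp_def by (rule tower_inverse) (auto simp: Transposition.transpose_def)

lemma inv_swp: "clopen U \<Longrightarrow> free (U \<times> {0, 1}) \<Longrightarrow> inv\<^bsub>G\<^esub> swp U = swp U"
  using G.inv_equality[of "swp U" "swp U"] swp_swp swp_full by simp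

text \<open>In the tower over \<open>W\<close> the two swaps are the transpositions (0 1) and (-1
  0); two transpositions sharing one level have a 3-cycle as commutator.\<close>

lemma gamma_commutator:
  assumes W: "clopen W" "free (W \<times> {- 1, 0, 1})"
  shows "swp W \<otimes>\<^bsub>G\<^esub> swp (F (- 1) ` W) \<otimes>\<^bsub>G\<^esub> inv\<^bsub>G\<^esub> swp W \<otimes>\<^bsub>G\<^esub> inv\<^bsub>G\<^esub> swp (F (- 1) ` W) = gamma W"
proof -
  define t where "t p = tower (W \<times> {- 1, 0, 1}) (\<lambda>_. p)" for p
  define s0 s1 where "s0 = Transposition.transpose (0::int) 1" and "s1 = Transposition.transpose (- 1::int) 0"
  have comp: "t p \<circ> t q = t (p \<circ> q)" if "q permutes {- 1, 0, 1}" for p q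
    unfolding t_def by (rule tower_comp[OF W(2)]) (use permutes_in_image[OF that] in auto)
  have perm: "s0 permutes {- 1, 0, 1}" "s1 permutes {- 1, 0, 1}"
    unfolding s0_def s1_def by (auto intro: permutes_swap_id)
  have fr0: "free (W \<times> {0, 1})"
    using W(2) by (rule free_Times_subset) auto
  have fr1: "free ((F (- 1) ` W) \<times> {0, 1})"
    using W(2) by (rule free_F) auto
  have e0: "swp W = t s0"
    using tower_swp(1)[OF W(2), of 0] by (simp add: t_def s0_def)
  have e1: "swp (F (- 1) ` W) = t s1"
    using tower_swp(1)[OF W(2), of "- 1"] by (simp add: t_def s1_def)
  have inv: "inv\<^bsub>G\<^esub> swp W = swp W" "inv\<^bsub>G\<^esub> swp (F (- 1) ` W) = swp (F (- 1) ` W)"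
    using inv_swp[OF W(1) fr0] inv_swp[of "F (- 1) ` W"] fr1 W(1) by simp_all
  have "swp W \<otimes>\<^bsub>G\<^esub> swp (F (- 1) ` W) \<otimes>\<^bsub>G\<^esub> inv\<^bsub>G\<^esub> swp W \<otimes>\<^bsub>G\<^esub> inv\<^bsub>G\<^esub> swp (F (- 1) ` W)
      = t s0 \<circ> t s1 \<circ> t s0 \<circ> t s1"
    by (simp only: inv mult_G) (simp only: e0 e1)
  also have "\<dots> = t (s0 \<circ> s1 \<circ> s0 \<circ> s1)"
    unfolding comp[OF perm(1)] comp[OF perm(2)] ..
  also have "s0 \<circ> s1 \<circ> s0 \<circ> s1 = Transposition.transpose (- 1) 0 \<circ> Transposition.transpose 0 1"
  proof
    fix x
    show "(s0 \<circ> s1 \<circ> s0 \<circ> s1) x = (Transposition.transpose (- 1) 0 \<circ> Transposition.transpose 0 1) x"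
      by (cases "x = - 1"; cases "x = 0"; cases "x = 1") (simp_all add: s0_def s1_def Transposition.transpose_def)
  qed
  also have "t \<dots> = gamma W"
    by (simp add: t_def gamma_def cycle3_def)
  finally show ?thesis .
qed

definition commute_mod :: "('a \<Rightarrow> 'a) \<Rightarrow> ('a \<Rightarrow> 'a) \<Rightarrow> bool" where
  "commute_mod h k \<longleftrightarrow> h \<otimes>\<^bsub>G\<^esub> k \<otimes>\<^bsub>G\<^esub> inv\<^bsub>G\<^esub> h \<otimes>\<^bsub>G\<^esub> inv\<^bsub>G\<^esub> k \<in> generate G gammas"

lemma commute_mod_subgroup:
  assumes "k \<in> full"
  shows "subgroup {h \<in> full. commute_mod h k} G"
  using G.subgroup_commuting_mod[OF normal_Gamma, of k] assms unfolding commute_mod_def carrier_G by blast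

lemma commute_mod_comp:
  assumes "k \<in> full" "g \<in> full" "h \<in> full" "commute_mod g k" "commute_mod h k"
  shows "commute_mod (g \<circ> h) k"
  using subgroup.m_closed[OF commute_mod_subgroup[OF assms(1)], of g h] assms unfolding mult_G by blast

lemma commute_mod_sym: "h \<in> full \<Longrightarrow> k \<in> full \<Longrightarrow> commute_mod h k \<Longrightarrow> commute_mod k h"
  unfolding commute_mod_def using G.commutator_mod_commute[OF subgroup_Gamma] by simp

lemma commute_mod_commuting:
  assumes "h \<in> full" "k \<in> full" "h \<circ> k = k \<circ> h"
  shows "commute_mod h k"
proof -
  have "h \<otimes>\<^bsub>G\<^esub> k \<otimes>\<^bsub>G\<^esub> inv\<^bsub>G\<^esub> h \<otimes>\<^bsub>G\<^esub> inv\<^bsub>G\<^esub> k = k \<otimes>\<^bsub>G\<^esub> h \<otimes>\<^bsub>G\<^esub> inv\<^bsub>G\<^esub> h \<otimes>\<^bsub>G\<^esub> inv\<^bsub>G\<^esub> k"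
    using assms(3) by (simp only: mult_G)
  also have "\<dots> = \<one>\<^bsub>G\<^esub>"
    using assms(1,2) G.m_assoc[of k h "inv\<^bsub>G\<^esub> h"] G.inv_closed G.r_inv G.r_one carrier_G by metis
  finally show ?thesis
    unfolding commute_mod_def using generate.one by metis
qed

lemma commute_mod_adjacent:
  assumes "clopen A" "free (A \<times> {- 1, 0, 1})"
  shows "commute_mod (swp A) (swp (F (- 1) ` A))"
  unfolding commute_mod_def gamma_commutator[OF assms]
  by (rule generate.incl) (use assms in \<open>auto simp: gammas_def\<close>)

text \<open>Near a point of \<open>U\<close> the set \<open>A\<close> is so small that \<open>V\<close> consists of \<open>A\<close> or nothing, of
  \<open>F (- 1) ` A\<close> or nothing, of \<open>F 1 ` A\<close> or nothing, and of a part whose swap commutes with that of \<open>A\<close>.\<close>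

lemma commute_mod_swp:
  assumes U: "clopen U" "free (U \<times> {0, 1})" and V: "clopen V" "free (V \<times> {0, 1})"
  shows "commute_mod (swp U) (swp V)"
  using U(1)
proof (rule clopen_induct)
  have V_full: "swp V \<in> full"
    using V by (rule swp_full)
  then show "commute_mod (swp {}) (swp V)"
    by (intro commute_mod_commuting) (auto simp: full_id)
  fix A B assume AB: "clopen A" "clopen B" "A \<inter> B = {}" "A \<union> B \<subseteq> U"
    "commute_mod (swp A) (swp V)" "commute_mod (swp B) (swp V)"
  have fr: "free (C \<times> {0, 1})" if "C \<subseteq> U" for C
    using U(2) that by (rule free_Times_subset) simp
  have "swp (A \<union> B) = swp A \<circ> swp B"
    using fr AB(3,4) by (intro swp_Un) auto
  then show "commute_mod (swp (A \<union> B)) (swp V)"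
    using AB fr by (auto intro!: commute_mod_comp V_full swp_full)
next
  fix x assume x: "x \<in> U"
  then have xT: "x \<in> T"
    using clopen_subset[OF U(1)] by blast
  obtain W0 where W0: "clopen W0" "x \<in> W0" "free (W0 \<times> {- 3..3})"
    by (rule free_Times_nbhd[OF xT finite_atLeastAtMost_int[of "- 3" 3]])
  obtain W where W: "clopen W" "x \<in> W" "\<And>y i. y \<in> W \<Longrightarrow> i \<in> {- 1, 0, 1} \<Longrightarrow> (F i y \<in> V) = (F i x \<in> V)"
    using locally_constant_window[OF locally_constant_mem[OF V(1)] xT, of "{- 1, 0, 1}"]
    by (metis finite.emptyI finite.insertI)
  have "commute_mod (swp A) (swp V)" if A: "clopen A" "A \<subseteq> W0 \<inter> W" "A \<subseteq> U" for A
  proof -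
    have frA: "free (A \<times> J)" if "J \<subseteq> {- 3..3}" for J
      using W0(3) by (rule free_Times_subset) (use A that in auto)
    have A01: "free (A \<times> {0, 1})" and A101: "free (A \<times> {- 1, 0, 1})"
      by (auto intro: frA)
    have AT: "A \<subseteq> T"
      using A(1) by (rule clopen_subset)
    have const: "F i y \<in> V \<longleftrightarrow> F i x \<in> V" if "y \<in> A" "i \<in> {- 1, 0, 1}" for y i
      using W(3) that A(2) by blast
    define V0 V1 V2 V3 where "V0 = V \<inter> A" and "V1 = V \<inter> F (- 1) ` A" and "V2 = V \<inter> F 1 ` A"
      and "V3 = V - (A \<union> F (- 1) ` A \<union> F 1 ` A)"
    note Vi = V0_def V1_def V2_def V3_def
    have clopen: "clopen V0" "clopen V1" "clopen V2" "clopen V3"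
      unfolding Vi using A(1) V(1) by (auto intro!: clopen_Int clopen_Diff clopen_Un)
    have frV: "free (B \<times> {0, 1})" if "B \<subseteq> V" for B
      using V(2) that by (rule free_Times_subset) simp
    have full: "swp B \<in> full" if "B \<subseteq> V" "clopen B" for B
      using that frV by (intro swp_full) auto
    have A_full: "swp A \<in> full"
      using A(1) A01 by (rule swp_full)
    have disj: "A \<inter> F (- 1) ` A = {}" "A \<inter> F 1 ` A = {}" "F (- 1) ` A \<inter> F 1 ` A = {}"
      using free_Times_cases[OF A101, of 0 "- 1"] free_Times_cases[OF A101, of 0 1]
        free_Times_cases[OF A101, of "- 1" 1] by simp_all
    have V_eq: "V = V0 \<union> (V1 \<union> (V2 \<union> V3))"
      unfolding Vi by blast
    have "swp V = swp V0 \<circ> (swp V1 \<circ> (swp V2 \<circ> swp V3))"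
    proof -
      have sub: "V1 \<union> (V2 \<union> V3) \<subseteq> V" "V2 \<union> V3 \<subseteq> V"
        unfolding Vi by blast+
      have "swp (V0 \<union> (V1 \<union> (V2 \<union> V3))) = swp V0 \<circ> swp (V1 \<union> (V2 \<union> V3))"
        by (rule swp_Un[OF frV]) (use disj in \<open>unfold Vi, blast+\<close>)
      moreover have "swp (V1 \<union> (V2 \<union> V3)) = swp V1 \<circ> swp (V2 \<union> V3)"
        by (rule swp_Un[OF frV[OF sub(1)]]) (use disj in \<open>unfold Vi, blast\<close>)
      moreover have "swp (V2 \<union> V3) = swp V2 \<circ> swp V3"
        by (rule swp_Un[OF frV[OF sub(2)]]) (use disj in \<open>unfold Vi, blast\<close>)
      ultimately show ?thesis
        using V_eq by simp
    qed
    moreover have cid: "commute_mod (swp {}) (swp A)"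
      using A_full full_id by (intro commute_mod_commuting) simp_all
    moreover have "commute_mod (swp V0) (swp A)"
    proof -
      have "V0 = {} \<or> V0 = A"
      proof (cases "x \<in> V")
        case True
        then have "A \<subseteq> V"
          using const[of _ 0] by auto
        then show ?thesis
          unfolding Vi by blast
      next
        case False
        then have "A \<inter> V = {}"
          using const[of _ 0] by auto
        then show ?thesis
          unfolding Vi by blast
      qed
      then show ?thesis
        using cid commute_mod_commuting[OF A_full A_full refl] by (elim disjE) simp_all
    qed
    moreover have "commute_mod (swp V1) (swp A)"
    proof -
      have "V1 = {} \<or> V1 = F (- 1) ` A"
      proof (cases "F (- 1) x \<in> V")
        case True
        then have "F (- 1) ` A \<subseteq> V"
          using const[of _ "- 1"] by auto
        then show ?thesis
          unfolding Vi by blast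
      next
        case False
        then have "F (- 1) ` A \<inter> V = {}"
          using const[of _ "- 1"] by auto
        then show ?thesis
          unfolding Vi by blast
      qed
      moreover have "commute_mod (swp (F (- 1) ` A)) (swp A)" if "V1 = F (- 1) ` A"
      proof (rule commute_mod_sym[OF A_full _ commute_mod_adjacent[OF A(1) A101]])
        have "V1 \<subseteq> V"
          unfolding Vi by blast
        then show "swp (F (- 1) ` A) \<in> full"
          using full clopen(2) that by metis
      qed
      ultimately show ?thesis
        using cid by (elim disjE) simp_all
    qed
    moreover have "commute_mod (swp V2) (swp A)"
    proof -
      have "V2 = {} \<or> V2 = F 1 ` A"
      proof (cases "F (1) x \<in> V")
        case True
        then have "F (1) ` A \<subseteq> V"
          using const[of _ 1] by auto
        then show ?thesis
          unfolding Vi by blast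
      next
        case False
        then have "F (1) ` A \<inter> V = {}"
          using const[of _ 1] by auto
        then show ?thesis
          unfolding Vi by blast
      qed
      \<comment> \<open>Here \<open>A\<close> is the lower neighbour, so the adjacent case is
        applied with the translate of \<open>A\<close> as its base.\<close>
      moreover have "commute_mod (swp (F 1 ` A)) (swp A)"
      proof -
        have "free ((F 1 ` A) \<times> {- 1, 0, 1})"
          by (rule free_F[OF frA[OF order_refl]]) auto
        then show ?thesis
          using commute_mod_adjacent[of "F 1 ` A"] A(1) by simp
      qed
      ultimately show ?thesis
        using cid by (elim disjE) simp_all
    qed
    moreover have "commute_mod (swp V3) (swp A)"
    proof (rule commute_mod_commuting)
      show "swp V3 \<in> full"
        using full clopen(4) unfolding Vi by blast
      have "V3 \<subseteq> T"
        using clopen_subset[OF clopen(4)] .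
      \<comment> \<open>Since \<open>V3\<close> avoids both neighbours of \<open>A\<close>, the
        union is disjoint from its translate and has a swap of its own, which factors in either
        order.\<close>
      moreover have "\<forall>y\<in>V3 \<union> A. F 1 y \<notin> V3 \<union> A"
      proof (intro ballI notI)
        fix y assume y: "y \<in> V3 \<union> A" "F 1 y \<in> V3 \<union> A"
        have "F 1 y \<notin> A" if "y \<in> A"
          using A01 that by (simp add: free_01)
        moreover have "F 1 y \<notin> V3" if "y \<in> V3"
        proof -
          have "free (V3 \<times> {0, 1})"
            by (rule frV) (unfold Vi, blast)
          then show ?thesis
            using that unfolding free_01 by blast
        qed
        moreover have "F 1 y \<notin> V3" if "y \<in> A"
          using that by (auto simp: Vi)
        moreover have "F 1 y \<notin> A" if "y \<in> V3"
          using that by (auto simp: Vi F_image_iff)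
        ultimately show False
          using y by blast
      qed
      ultimately have "free ((V3 \<union> A) \<times> {0, 1})"
        unfolding free_01 using AT by blast
      moreover have "V3 \<inter> A = {}"
        by (auto simp: Vi)
      ultimately show "swp V3 \<circ> swp A = swp A \<circ> swp V3"
        using swp_Un[of V3 A] swp_Un[of A V3] by (simp add: Un_commute Int_commute)
    qed (rule A_full)
    moreover have "swp V0 \<in> full" "swp V1 \<in> full" "swp V2 \<in> full" "swp V3 \<in> full"
      by (rule full; use clopen Vi in blast)+
    ultimately have "commute_mod (swp V) (swp A)"
      using A_full by (simp add: commute_mod_comp full_comp)
    then show ?thesis
      using commute_mod_sym swp_full[OF V] A_full by blast
  qed
  then show "\<exists>W. clopen W \<and> x \<in> W \<and> (\<forall>A. clopen A \<and> A \<subseteq> W \<and> A \<subseteq> U \<longrightarrow> commute_mod (swp A) (swp V))"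
    using W0(1,2) W(1,2) by (intro exI[of _ "W0 \<inter> W"]) (auto intro: clopen_Int)
qed

lemma zero_flow_mem:
  assumes "g \<in> zero_flow" "subgroup H G" "\<And>U. clopen U \<Longrightarrow> free (U \<times> {0, 1}) \<Longrightarrow> swp U \<in> H"
  shows "g \<in> H"
proof -
  have g: "g \<in> full" and ex: "\<exists>n N. locally_constant n \<and> (\<forall>x\<in>T. g x = F (n x) x \<and> \<bar>n x\<bar> < N \<and> flow N n x = 0)"
    using assms(1) unfolding zero_flow_def by blast+
  from ex obtain n N where n: "locally_constant n" "\<forall>x\<in>T. g x = F (n x) x \<and> \<bar>n x\<bar> < N \<and> flow N n x = 0"
    by (elim exE conjE)
  have n': "g x = F (n x) x" "\<bar>n x\<bar> < N" "flow N n x = 0" if "x \<in> T" for x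
    using bspec[OF n(2) that] by blast+
  obtain x where "x \<in> T"
    using T_nonempty by blast
  then have "0 < N"
    using n'(2) by fastforce
  then show ?thesis
    using flow_zero_mem[OF g n(1) n'(1) _ n'(2,3) assms(2,3)] by blast
qed

lemma swp_zero_flow:
  assumes U: "clopen U" "free (U \<times> {0, 1})"
  shows "swp U \<in> zero_flow"
proof -
  define n :: "'a \<Rightarrow> int" where "n x = (if x \<in> U then 1 else if F (- 1) x \<in> U then - 1 else 0)" for x
  have lc: "locally_constant n"
  proof -
    define f where "f p q = (if p then 1 else if q then - 1 else (0 :: int))" for p q
    have "locally_constant (\<lambda>x. f (x \<in> U) (F (- 1) x \<in> U))"
      by (rule locally_constant_pair[OF locally_constant_mem[OF U(1)] locally_constant_F[OF locally_constant_mem[OF U(1)]]])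
    moreover have "(\<lambda>x. f (x \<in> U) (F (- 1) x \<in> U)) = n"
      by (rule ext) (simp only: f_def n_def)
    ultimately show ?thesis
      by simp
  qed
  have disj: "F 1 x \<notin> U" "F (- 1) x \<notin> U" if "x \<in> U" for x
  proof -
    show "F 1 x \<notin> U"
      using U(2) that by (simp add: free_01)
    show "F (- 1) x \<notin> U"
    proof
      assume "F (- 1) x \<in> U"
      then have "F 1 (F (- 1) x) \<notin> U"
        using U(2) unfolding free_01 by blast
      then show False
        using that by simp
    qed
  qed
  have "swp U x = F (n x) x" for x
  proof (cases rule: tower_cases[of "U \<times> {0, 1}" x])
    case (inside b i)
    then consider "i = 0" | "i = 1"
      by auto
    then show ?thesis
    proof cases
      case 1
      then show ?thesis
        using tower_in[OF U(2) inside(1), of "\<lambda>_. Transposition.transpose 0 1"] inside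
        by (simp add: swp_def n_def)
    next
      case 2
      then show ?thesis
        using tower_in[OF U(2) inside(1), of "\<lambda>_. Transposition.transpose 0 1"] inside disj
        by (simp add: swp_def n_def)
    qed
  next
    case outside
    then have "swp U x = x"
      unfolding swp_def by (rule tower_out)
    moreover have "x \<notin> U"
      using outside[of x 0] by auto
    moreover have "F (- 1) x \<notin> U"
      using outside[of "F (- 1) x" 1] by auto
    ultimately show ?thesis
      by (simp add: n_def)
  qed
  moreover have "\<bar>n x\<bar> < 2" for x
    by (simp add: n_def)
  moreover have "flow 2 n x = 0" for x
  proof -
    \<comment> \<open>At most one exchange, that of the places -1 and 0, straddles the cut, and it
      carries one point each way. Two places are counted in either case, which is
      \<open>N\<close>.\<close>
    have "{j \<in> {- 2..<2}. 0 \<le> j + n (F j x)} = (if F (- 1) x \<in> U then {- 1, 1} else {0, 1})"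
    proof (rule Set.set_eqI)
      fix j :: int
      have "j \<in> {- 2..<2} \<longleftrightarrow> j = - 2 \<or> j = - 1 \<or> j = 0 \<or> j = 1"
        by auto
      then show "j \<in> {j \<in> {- 2..<2}. 0 \<le> j + n (F j x)} \<longleftrightarrow> j \<in> (if F (- 1) x \<in> U then {- 1, 1} else {0, 1})"
        using disj[of x] disj[of "F (- 1) x"] by (auto simp: n_def)
    qed
    then show ?thesis
      by (simp add: flow_def)
  qed
  ultimately show ?thesis
    unfolding zero_flow_def using swp_full[OF U] lc by blast
qed

text \<open>Elements commuting with a fixed one modulo the 3-cycles form a subgroup, so commuting
  extends from swaps to all of \<open>zero_flow\<close> in one argument, and by symmetry in the
  other.\<close>

lemma derived_zero_flow: "derived G zero_flow = generate G gammas"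
proof
  have full: "g \<in> full" if "g \<in> zero_flow" for g
    using that by (simp add: zero_flow_def)
  have 1: "commute_mod g (swp V)" if "g \<in> zero_flow" "clopen V" "free (V \<times> {0, 1})" for g V
    using zero_flow_mem[OF that(1) commute_mod_subgroup[OF swp_full[OF that(2,3)]]]
      commute_mod_swp that swp_full by blast
  have 2: "commute_mod g h" if "g \<in> zero_flow" "h \<in> zero_flow" for g h
  proof -
    have "commute_mod h g"
      using zero_flow_mem[OF that(2) commute_mod_subgroup[OF full[OF that(1)]]]
        commute_mod_sym[OF full[OF that(1)]] 1[OF that(1)] swp_full by blast
    then show ?thesis
      using commute_mod_sym full that by blast
  qed
  then have "derived_set G zero_flow \<subseteq> generate G gammas"
    unfolding commute_mod_def by blast
  then show "derived G zero_flow \<subseteq> generate G gammas"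
    unfolding derived_def by (rule G.generate_subgroup_incl[OF _ subgroup_Gamma])
  have "gammas \<subseteq> derived_set G zero_flow"
  proof
    fix g assume "g \<in> gammas"
    then obtain W where W: "clopen W" "free (W \<times> {- 1, 0, 1})" "g = gamma W"
      unfolding gammas_def by blast
    have "swp W \<in> zero_flow"
      by (rule swp_zero_flow[OF W(1) free_Times_subset[OF W(2)]]) auto
    moreover have "swp (F (- 1) ` W) \<in> zero_flow"
      by (rule swp_zero_flow) (use W(1) free_F[OF W(2), of "{0, 1}" "- 1"] in auto)
    ultimately show "g \<in> derived_set G zero_flow"
      using gamma_commutator[OF W(1,2)] W(3) by blast
  qed
  then show "generate G gammas \<subseteq> derived G zero_flow"
    unfolding derived_def by (rule G.mono_generate)
qed

subsection \<open>Finite generation and separating labels\<close>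

text \<open>A generating clopen partition, given by labels: the itinerary under \<phi> determines
  the point. By compactness only finitely many labels occur.\<close>

definition separating :: "('a \<Rightarrow> nat) \<Rightarrow> bool" where
  "separating lab \<longleftrightarrow> locally_constant lab \<and>
     (\<forall>x\<in>T. \<forall>y\<in>T. (\<forall>k. lab (F k x) = lab (F k y)) \<longrightarrow> x = y)"

text \<open>The cylinder of radius \<open>m\<close> about \<open>x\<close>.\<close>

definition cell :: "('a \<Rightarrow> nat) \<Rightarrow> int \<Rightarrow> 'a \<Rightarrow> 'a set" where
  "cell lab m x = {y \<in> T. \<forall>i\<in>{- m..m}. lab (F i y) = lab (F i x)}"

lemma gamma_empty: "gamma {} = id"
  by (simp add: gamma_def cycle3_def)

lemma tower_const_extend:
  assumes "free (p \<times> J)" "U \<subseteq> p"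
  shows "tower (U \<times> J) (\<lambda>_. c) = tower (p \<times> J) (\<lambda>z. if z \<in> U then c else id)"
proof -
  have "tower (U \<times> J) (\<lambda>_. c) = tower (U \<times> J) (\<lambda>z. if z \<in> U then c else id)"
    by (rule tower_cong[OF free_Times_subset[OF assms order_refl]]) simp
  also have "\<dots> = tower (p \<times> J) (\<lambda>z. if z \<in> U then c else id)"
    by (rule tower_restrict[OF assms(1)]) (use assms(2) in auto)
  finally show ?thesis .
qed

text \<open>\<open>U\<close> lies at level \<open>- i\<close> over its translate in
  \<open>p\<close>. Acting by the identity over the rest of \<open>p\<close> brings 3-cycles of
  different sets into a common tower; the levels are parameters so that instances carry plain
  numerals.\<close>

lemma gamma_tower:
  assumes "free (p \<times> J)" "F i ` U \<subseteq> p" "l \<in> J" "m \<in> J" "r \<in> J" "l = m - 1" "r = m + 1" "m = - i"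
  shows "gamma U = tower (p \<times> J) (\<lambda>z. if z \<in> F i ` U
     then Transposition.transpose l m \<circ> Transposition.transpose m r else id)"
proof -
  have fr: "free ((F i ` U) \<times> J)"
    using assms(1,2) by (rule free_Times_subset) simp
  have lmr: "- 1 + m = l" "0 + m = m" "1 + m = r"
    using assms(6,7) by simp_all
  have "gamma U = cycle3 (F m ` (F i ` U)) (- 1) 0 1"
    using assms(8) by (simp add: gamma_def)
  also have "\<dots> = tower ((F i ` U) \<times> J) (\<lambda>_. Transposition.transpose l m \<circ> Transposition.transpose m r)"
    using cycle3_tower[OF fr, of "- 1" m 0 1] assms(3-5) unfolding lmr by blast
  finally show ?thesis
    using tower_const_extend[OF assms(1,2)] by simp
qed

text \<open>Two 3-cycles whose supports meet in a single point have a 3-cycle as commutator. Here the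
  supports of \<open>gamma U\<close> and \<open>gamma V\<close> meet exactly in the intersection of \<open>F 1 ` U\<close> and \<open>F (- 1) ` V\<close>,
  and inverses are written as squares.\<close>

lemma gamma_Int:
  assumes fr: "free (p \<times> {- 2, - 1, 0, 1, 2})" and UV: "F 1 ` U \<subseteq> p" "F (- 1) ` V \<subseteq> p"
  shows "gamma (F 1 ` U \<inter> F (- 1) ` V) = gamma V \<circ> (gamma U \<circ> (gamma U \<circ> (gamma V \<circ> (gamma V \<circ> gamma U))))"
proof -
  let ?J = "{- 2, - 1, 0, 1, 2} :: int set"
  \<comment> \<open>Over \<open>p\<close> the set \<open>U\<close> lies at level -1 and
    \<open>V\<close> at level 1, so their 3-cycles have only level 0 in common.\<close>
  define c1 c2 c0 where
    "c1 = Transposition.transpose (- 2 :: int) (- 1) \<circ> Transposition.transpose (- 1) 0" and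
    "c2 = Transposition.transpose (0 :: int) 1 \<circ> Transposition.transpose 1 2" and
    "c0 = Transposition.transpose (- 1 :: int) 0 \<circ> Transposition.transpose 0 1"
  define t where "t \<pi> = tower (p \<times> ?J) \<pi>" for \<pi>
  define a b where "a z = (if z \<in> F 1 ` U then c1 else id)" and "b z = (if z \<in> F (- 1) ` V then c2 else id)" for z
  have U: "gamma U = t a"
    unfolding t_def a_def c1_def by (rule gamma_tower[OF fr UV(1)]) auto
  have V: "gamma V = t b"
    unfolding t_def b_def c2_def by (rule gamma_tower[OF fr UV(2)]) auto
  have W: "gamma (F 1 ` U \<inter> F (- 1) ` V) = t (\<lambda>z. if z \<in> F 1 ` U \<inter> F (- 1) ` V then c0 else id)"
  proof -
    have "F 0 ` (F 1 ` U \<inter> F (- 1) ` V) \<subseteq> p"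
      unfolding F_0_image using UV(1) by blast
    note W0 = gamma_tower[OF fr this, unfolded F_0_image]
    show ?thesis
      unfolding t_def c0_def by (rule W0) auto
  qed
  have c_val: "c0 (- 2) = - 2" "c0 (- 1) = 0" "c0 0 = 1" "c0 1 = - 1" "c0 2 = 2"
    "c1 (- 2) = - 1" "c1 (- 1) = 0" "c1 0 = - 2" "c1 1 = 1" "c1 2 = 2"
    "c2 (- 2) = - 2" "c2 (- 1) = - 1" "c2 0 = 1" "c2 1 = 2" "c2 2 = 0"
    by (simp_all add: c0_def c1_def c2_def Transposition.transpose_def)
  have c_in: "c1 i \<in> ?J" "c2 i \<in> ?J" if "i \<in> ?J" for i
    using that by (auto simp: c1_def c2_def Transposition.transpose_def)
  have comp: "t \<pi> \<circ> t \<rho> = t (\<lambda>z. \<pi> z \<circ> \<rho> z)" if "\<And>z i. i \<in> ?J \<Longrightarrow> \<rho> z i \<in> ?J" for \<pi> \<rho>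
    unfolding t_def by (rule tower_comp[OF fr]) (use that in blast)
  have a_in: "a z i \<in> ?J" if "i \<in> ?J" for z i
    using c_in[OF that] that unfolding a_def by (cases "z \<in> F 1 ` U") (simp_all only: if_True if_False id_apply)
  have b_in: "b z i \<in> ?J" if "i \<in> ?J" for z i
    using c_in[OF that] that unfolding b_def by (cases "z \<in> F (- 1) ` V") (simp_all only: if_True if_False id_apply)
  have 1: "t b \<circ> t a = t (\<lambda>z. b z \<circ> a z)"
    by (rule comp[OF a_in])
  have 2: "t b \<circ> t (\<lambda>z. b z \<circ> a z) = t (\<lambda>z. b z \<circ> (b z \<circ> a z))"
    by (rule comp) (simp only: comp_apply a_in b_in)
  have 3: "t a \<circ> t (\<lambda>z. b z \<circ> (b z \<circ> a z)) = t (\<lambda>z. a z \<circ> (b z \<circ> (b z \<circ> a z)))"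
    by (rule comp) (simp only: comp_apply a_in b_in)
  have 4: "t a \<circ> t (\<lambda>z. a z \<circ> (b z \<circ> (b z \<circ> a z))) = t (\<lambda>z. a z \<circ> (a z \<circ> (b z \<circ> (b z \<circ> a z))))"
    by (rule comp) (simp only: comp_apply a_in b_in)
  have 5: "t b \<circ> t (\<lambda>z. a z \<circ> (a z \<circ> (b z \<circ> (b z \<circ> a z)))) = t (\<lambda>z. b z \<circ> (a z \<circ> (a z \<circ> (b z \<circ> (b z \<circ> a z)))))"
    by (rule comp) (simp only: comp_apply a_in b_in)
  have "t (\<lambda>z. if z \<in> F 1 ` U \<inter> F (- 1) ` V then c0 else id) = t (\<lambda>z. b z \<circ> (a z \<circ> (a z \<circ> (b z \<circ> (b z \<circ> a z)))))"
    unfolding t_def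
  proof (rule tower_cong[OF fr])
    fix z i assume "(z, i) \<in> p \<times> ?J"
    then have i: "i \<in> ?J"
      by blast
    \<comment> \<open>Over points belonging to just one of the two sets the word collapses to a cube
      of a 3-cycle, which is trivial.\<close>
    have 111: "c0 i = c2 (c1 (c1 (c2 (c2 (c1 i)))))" "i = c1 (c1 (c1 i))" "i = c2 (c2 (c2 i))"
      using i unfolding insert_iff empty_iff by (elim disjE; simp only: c_val simp_thms)+
    show "(if z \<in> F 1 ` U \<inter> F (- 1) ` V then c0 else id) i = (b z \<circ> (a z \<circ> (a z \<circ> (b z \<circ> (b z \<circ> a z))))) i"
      using 111 unfolding a_def b_def
      by (cases "z \<in> F 1 ` U"; cases "z \<in> F (- 1) ` V") (simp_all only: if_True if_False comp_apply id_apply Int_iff simp_thms)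
  qed
  then show ?thesis
    unfolding U V W 1 2 3 4 5 .
qed

section \<open>Cylinders of a separating label\<close>

context
  fixes lab :: "'a \<Rightarrow> nat"
  assumes lab: "separating lab"
begin

lemma lab_lc: "locally_constant lab"
  using lab by (simp add: separating_def)

lemma lab_sep: "x \<in> T \<Longrightarrow> y \<in> T \<Longrightarrow> x \<noteq> y \<Longrightarrow> \<exists>k. lab (F k x) \<noteq> lab (F k y)"
  using lab unfolding separating_def by blast

lemma cell_clopen: "clopen (cell lab m x)"
proof -
  have "clopen (T \<inter> (\<Inter>i\<in>{- m..m}. {y \<in> T. lab (F i y) = lab (F i x)}))"
    by (rule clopen_Inter)
      (simp_all add: clopen_locally_constant[OF locally_constant_F[OF lab_lc], where P = "\<lambda>l. l = lab (F i x)" for i])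
  moreover have "T \<inter> (\<Inter>i\<in>{- m..m}. {y \<in> T. lab (F i y) = lab (F i x)}) = cell lab m x"
    by (auto simp: cell_def)
  ultimately show ?thesis
    by simp
qed

lemma cell_refl: "x \<in> T \<Longrightarrow> x \<in> cell lab m x"
  by (simp add: cell_def)

lemma cell_eq: "y \<in> cell lab m x \<Longrightarrow> cell lab m y = cell lab m x"
  unfolding cell_def by simp

lemma cell_mono: "m \<le> m' \<Longrightarrow> cell lab m' x \<subseteq> cell lab m x"
  by (auto simp: cell_def)

lemma cell_locally_constant: "locally_constant (cell lab m)"
  by (rule locally_constantI) (use cell_clopen cell_refl cell_eq in blast)

text \<open>Every point outside \<open>U\<close> differs from \<open>x\<close> in its label at some
  time, and by compactness finitely many times suffice for all of them.\<close>

lemma cell_subset_point: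
  assumes "clopen U" "x \<in> U"
  obtains m where "cell lab m x \<subseteq> U"
proof -
  have x: "x \<in> T"
    using assms clopen_subset by blast
  have "\<forall>y\<in>T - U. \<exists>k. lab (F k y) \<noteq> lab (F k x)"
    using lab_sep[OF _ x] assms(2) by blast
  then obtain k where k: "\<And>y. y \<in> T - U \<Longrightarrow> lab (F (k y) y) \<noteq> lab (F (k y) x)"
    by metis
  define W where "W y = {z \<in> T. lab (F (k y) z) \<noteq> lab (F (k y) x)}" for y
  have W: "clopen (W y) \<and> y \<in> W y" if "y \<in> T - U" for y
  proof
    show "clopen (W y)"
      unfolding W_def
      by (rule clopen_locally_constant[OF locally_constant_F[OF lab_lc], where P = "\<lambda>l. l \<noteq> lab (F (k y) x)"])
    show "y \<in> W y"
      using k[OF that] that by (simp add: W_def)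
  qed
  obtain S where S: "finite S" "S \<subseteq> T - U" "T - U \<subseteq> (\<Union>y\<in>S. W y)"
    using clopen_cover[OF clopen_Diff[OF clopen_T assms(1)] W] by metis
  define m where "m = Max (insert 0 ((\<lambda>y. \<bar>k y\<bar>) ` S))"
  have m: "\<bar>k y\<bar> \<le> m" if "y \<in> S" for y
    unfolding m_def using S(1) that by (intro Max_ge) auto
  have "cell lab m x \<subseteq> U"
  proof
    fix z assume z: "z \<in> cell lab m x"
    show "z \<in> U"
    proof (rule ccontr)
      assume "z \<notin> U"
      then obtain y where y: "y \<in> S" "z \<in> W y"
        using S(3) z by (auto simp: cell_def)
      then have "lab (F (k y) z) \<noteq> lab (F (k y) x)"
        by (simp add: W_def)
      moreover have "k y \<in> {- m..m}"
        using m[OF y(1)] by auto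
      ultimately show False
        using z by (simp add: cell_def)
    qed
  qed
  then show thesis
    by (rule that)
qed

lemma cell_Lebesgue_number:
  assumes U: "clopen U" and W: "\<And>x. x \<in> U \<Longrightarrow> clopen (W x) \<and> x \<in> W x"
  obtains m0 where "\<And>x m. x \<in> U \<Longrightarrow> m0 \<le> m \<Longrightarrow> \<exists>y\<in>U. cell lab m x \<subseteq> W y"
proof -
  have "\<forall>x\<in>U. \<exists>m. cell lab m x \<subseteq> W x"
    using cell_subset_point W by metis
  then obtain m where m: "\<And>x. x \<in> U \<Longrightarrow> cell lab (m x) x \<subseteq> W x"
    by metis
  have "clopen (cell lab (m x) x) \<and> x \<in> cell lab (m x) x" if "x \<in> U" for x
    using that cell_clopen cell_refl clopen_subset[OF U] by blast
  then obtain S where S: "finite S" "S \<subseteq> U" "U \<subseteq> (\<Union>x\<in>S. cell lab (m x) x)"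
    using clopen_cover[OF U, of "\<lambda>x. cell lab (m x) x"] by metis
  define m0 where "m0 = Max (insert 0 (m ` S))"
  have m0: "m y \<le> m0" if "y \<in> S" for y
    unfolding m0_def using S(1) that by (intro Max_ge) auto
  show thesis
  proof (rule that[of m0])
    fix x k assume x: "x \<in> U" "m0 \<le> k"
    then obtain y where y: "y \<in> S" "x \<in> cell lab (m y) y"
      using S(3) by blast
    have "cell lab k x \<subseteq> cell lab (m y) x"
      using cell_mono[of "m y" k x] m0[OF y(1)] x(2) by simp
    also have "\<dots> = cell lab (m y) y"
      using y(2) by (rule cell_eq)
    also have "\<dots> \<subseteq> W y"
      using m y(1) S(2) by blast
    finally show "\<exists>y\<in>U. cell lab k x \<subseteq> W y"
      using y(1) S(2) by blast
  qed
qed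

text \<open>The translated windows run from -m-1 to m-1 and from -m+1 to m+1. They cover the window
  of radius m+1 once m is at least 1; for m = 0 the place 0 would be missing.\<close>

lemma cell_split:
  assumes "1 \<le> m"
  shows "cell lab (m + 1) x = F 1 ` cell lab m (F (- 1) x) \<inter> F (- 1) ` cell lab m (F 1 x)"
proof (rule Set.set_eqI)
  fix y
  have 1: "y \<in> F 1 ` cell lab m (F (- 1) x) \<longleftrightarrow> y \<in> T \<and> (\<forall>i\<in>{- m - 1..m - 1}. lab (F i y) = lab (F i x))"
  proof -
    have "(\<forall>i\<in>{- m..m}. lab (F (i - 1) y) = lab (F (i - 1) x)) \<longleftrightarrow> (\<forall>i\<in>{- m - 1..m - 1}. lab (F i y) = lab (F i x))"
    proof safe
      fix i assume "\<forall>i\<in>{- m..m}. lab (F (i - 1) y) = lab (F (i - 1) x)" "i \<in> {- m - 1..m - 1}"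
      then show "lab (F i y) = lab (F i x)"
        by (auto dest: bspec[of _ _ "i + 1"])
    qed auto
    then show ?thesis
      by (simp add: F_image_iff cell_def)
  qed
  have 2: "y \<in> F (- 1) ` cell lab m (F 1 x) \<longleftrightarrow> y \<in> T \<and> (\<forall>i\<in>{- m + 1..m + 1}. lab (F i y) = lab (F i x))"
  proof -
    have "(\<forall>i\<in>{- m..m}. lab (F (i + 1) y) = lab (F (i + 1) x)) \<longleftrightarrow> (\<forall>i\<in>{- m + 1..m + 1}. lab (F i y) = lab (F i x))"
    proof safe
      fix i assume "\<forall>i\<in>{- m..m}. lab (F (i + 1) y) = lab (F (i + 1) x)" "i \<in> {- m + 1..m + 1}"
      then show "lab (F i y) = lab (F i x)"
        by (auto dest: bspec[of _ _ "i - 1"])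
    qed auto
    then show ?thesis
      by (simp add: F_image_iff cell_def)
  qed
  have "{- (m + 1)..m + 1} = {- m - 1..m - 1} \<union> {- m + 1..m + 1}"
    using assms by auto
  then show "y \<in> cell lab (m + 1) x \<longleftrightarrow> y \<in> F 1 ` cell lab m (F (- 1) x) \<inter> F (- 1) ` cell lab m (F 1 x)"
    unfolding Int_iff 1 2 by (simp add: cell_def ball_Un) blast
qed

lemma Gamma_finitely_generated: "\<exists>S. finite S \<and> S \<subseteq> full \<and> generate G S = generate G gammas"
proof -
  have "\<forall>x\<in>T. \<exists>W. clopen W \<and> x \<in> W \<and> free (W \<times> {- 2, - 1, 0, 1, 2})"
    using free_Times_nbhd[of _ "{- 2, - 1, 0, 1, 2}"] by (metis finite.emptyI finite.insertI)
  then obtain W where W: "\<And>x. x \<in> T \<Longrightarrow> clopen (W x) \<and> x \<in> W x" "\<And>x. x \<in> T \<Longrightarrow> free (W x \<times> {- 2, - 1, 0, 1, 2})"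
    by metis
  obtain m1 where m1: "\<And>x m. x \<in> T \<Longrightarrow> m1 \<le> m \<Longrightarrow> \<exists>y\<in>T. cell lab m x \<subseteq> W y"
    using cell_Lebesgue_number[OF clopen_T W(1)] by metis
  \<comment> \<open>From this radius on, every cylinder is free on five levels, as
    \<open>gamma_Int\<close> requires of its common base.\<close>
  define m0 where "m0 = max 0 m1"
  have fr: "free (cell lab m x \<times> {- 2, - 1, 0, 1, 2})" if "x \<in> T" "m0 \<le> m" for x m
    using m1[OF that(1), of m] that(2) W(2) free_Times_subset[OF _ _ order_refl] unfolding m0_def
    by (metis max.boundedE)
  have fr3: "free (cell lab m x \<times> {- 1, 0, 1})" if "x \<in> T" "m0 \<le> m" for x m
    using fr[OF that] by (rule free_Times_subset) auto
  \<comment> \<open>One more than \<open>m0\<close>: a translate by one step of a cylinder of this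
    radius still lies in a cylinder of radius \<open>m0\<close>, and the radius is at least 1 for
    \<open>cell_split\<close>.\<close>
  let ?S = "gamma ` cell lab (m0 + 1) ` T"
  let ?H = "generate G ?S"
  have fin: "finite ?S"
    using locally_constant_finite_range[OF cell_locally_constant] by blast
  have S_gammas: "?S \<subseteq> gammas"
    unfolding gammas_def using cell_clopen fr3 by auto
  have S_full: "?S \<subseteq> full"
    using S_gammas gammas_full by blast
  have H: "subgroup ?H G"
    using G.generate_is_subgroup S_full by simp
  have H_comp: "g \<circ> h \<in> ?H" if "g \<in> ?H" "h \<in> ?H" for g h
    using subgroup.m_closed[OF H that] by simp
  have cells: "gamma (cell lab (m0 + 1 + int n) x) \<in> ?H" if "x \<in> T" for n x
    using that
  proof (induction n arbitrary: x)
    case 0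
    then show ?case
      by (auto intro: generate.incl)
  next
    case (Suc n)
    let ?m = "m0 + 1 + int n"
    let ?U = "cell lab ?m (F (- 1) x)" and ?V = "cell lab ?m (F 1 x)"
    have m: "1 \<le> ?m" "m0 + 1 \<le> ?m"
      by (auto simp: m0_def)
    have sub: "F 1 ` ?U \<subseteq> cell lab m0 x" "F (- 1) ` ?V \<subseteq> cell lab m0 x"
    proof -
      have "y \<in> cell lab m0 x" if "F (- 1) y \<in> ?U" for y
        unfolding cell_def mem_Collect_eq
      proof (intro conjI ballI)
        show "y \<in> T"
          using that by (simp add: cell_def)
        fix i assume "i \<in> {- m0..m0}"
        then have "i + 1 \<in> {- ?m..?m}"
          using m by auto
        then have "lab (F (i + 1) (F (- 1) y)) = lab (F (i + 1) (F (- 1) x))"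
          using that unfolding cell_def by blast
        then show "lab (F i y) = lab (F i x)"
          by simp
      qed
      then show "F 1 ` ?U \<subseteq> cell lab m0 x"
        by (auto simp: F_image_iff)
      have "y \<in> cell lab m0 x" if "F 1 y \<in> ?V" for y
        unfolding cell_def mem_Collect_eq
      proof (intro conjI ballI)
        show "y \<in> T"
          using that by (simp add: cell_def)
        fix i assume "i \<in> {- m0..m0}"
        then have "i - 1 \<in> {- ?m..?m}"
          using m by auto
        then have "lab (F (i - 1) (F 1 y)) = lab (F (i - 1) (F 1 x))"
          using that unfolding cell_def by blast
        then show "lab (F i y) = lab (F i x)"
          by simp
      qed
      then show "F (- 1) ` ?V \<subseteq> cell lab m0 x"
        by (auto simp: F_image_iff)
    qed
    have IH: "gamma ?U \<in> ?H" "gamma ?V \<in> ?H"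
      using Suc by simp_all
    have "gamma (cell lab (?m + 1) x) = gamma ?V \<circ> (gamma ?U \<circ> (gamma ?U \<circ> (gamma ?V \<circ> (gamma ?V \<circ> gamma ?U))))"
      unfolding cell_split[OF m(1)] by (rule gamma_Int[OF fr[OF Suc.prems order_refl] sub])
    moreover have "\<dots> \<in> ?H"
      by (intro H_comp IH)
    moreover have "m0 + 1 + int (Suc n) = ?m + 1"
      by simp
    ultimately show ?case
      by (simp only:)
  qed
  have gammas: "gamma U \<in> ?H" if U: "clopen U" "free (U \<times> {- 1, 0, 1})" for U
  proof -
    obtain m2 where m2: "\<And>x m. x \<in> U \<Longrightarrow> m2 \<le> m \<Longrightarrow> \<exists>y\<in>U. cell lab m x \<subseteq> U"
      using cell_Lebesgue_number[OF U(1), of "\<lambda>_. U"] U(1) by metis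
    define n where "n = nat m2"
    let ?m = "m0 + 1 + int n"
    have sub: "cell lab ?m x \<subseteq> U" if "x \<in> U" for x
    proof -
      have "m2 \<le> ?m"
        unfolding m0_def n_def by linarith
      then show ?thesis
        using m2[OF that] by blast
    qed
    have UT: "x \<in> T" if "x \<in> U" for x
      using clopen_subset[OF U(1)] that by blast
    have "finite (cell lab ?m ` U)"
      by (rule finite_subset[OF _ locally_constant_finite_range[OF cell_locally_constant]]) (use UT in blast)
    \<comment> \<open>Cylinders of one radius are equal or disjoint, so a finite union of them is
      treated by additivity of the 3-cycles; \<open>U\<close> is such a union.\<close>
    moreover have "finite \<A> \<Longrightarrow> \<A> \<subseteq> cell lab ?m ` U \<Longrightarrow> gamma (\<Union>\<A>) \<in> ?H" for \<A>
    proof (induction \<A> rule: finite_induct)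
      case empty
      then show ?case
        unfolding Union_empty gamma_empty using subgroup.one_closed[OF H] unfolding one_G by blast
    next
      case (insert A \<A>)
      obtain x where x: "x \<in> U" "A = cell lab ?m x"
        using insert by blast
      have "A \<inter> B = {}" if B: "B \<in> \<A>" for B
      proof (rule ccontr)
        assume "A \<inter> B \<noteq> {}"
        then obtain z where z: "z \<in> A" "z \<in> B"
          by blast
        obtain y where "B = cell lab ?m y"
          using insert.prems B by blast
        then have "A = B"
          using z cell_eq x(2) by metis
        then show False
          using insert.hyps(2) B by blast
      qed
      then have disj: "A \<inter> \<Union>\<A> = {}"
        by blast
      have "A \<union> \<Union>\<A> \<subseteq> U"
        using insert.prems sub by blast
      then have "free ((A \<union> \<Union>\<A>) \<times> {- 1, 0, 1})"
        using U(2) by (rule_tac free_Times_subset) auto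
      then have "gamma (\<Union>(insert A \<A>)) = gamma A \<circ> gamma (\<Union>\<A>)"
        unfolding gamma_def using cycle3_Un[OF _ disj] by simp
      moreover have "gamma A \<in> ?H"
        unfolding x(2) by (rule cells[OF UT[OF x(1)]])
      moreover have "gamma (\<Union>\<A>) \<in> ?H"
        using insert.IH insert.prems by blast
      ultimately show ?case
        using H_comp by metis
    qed
    moreover have "\<Union>(cell lab ?m ` U) = U"
      using sub cell_refl UT by blast
    ultimately show ?thesis
      by (metis order_refl)
  qed
  then have "gammas \<subseteq> ?H"
    unfolding gammas_def by blast
  then have "generate G gammas \<subseteq> ?H"
    by (rule G.generate_subgroup_incl[OF _ H])
  moreover have "?H \<subseteq> generate G gammas"
    by (rule G.mono_generate[OF S_gammas])
  ultimately show ?thesis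
    using fin S_full by blast
qed

end

text \<open>The 3-cycle has \<open>x\<close> at one end and runs along the orbit away from
  \<open>y\<close>: backwards if \<open>y\<close> is a forward iterate of \<open>x\<close>, forwards
  otherwise. None of its three levels over the chosen base point is then \<open>y\<close>, and a
  small base keeps it so.\<close>

lemma gamma_moves:
  assumes "x \<in> T" "y \<in> T" "x \<noteq> y"
  obtains g where "g \<in> gammas" "g x \<noteq> x" "g y = y"
proof -
  obtain c where c: "c = 1 \<or> c = - 1" "\<And>i. i \<in> {- 1, 0, 1} \<Longrightarrow> F c x \<noteq> F (- i) y"
  proof (cases "\<exists>j>0. y = F j x")
    case True
    then obtain j where j: "j > 0" "y = F j x"
      by blast
    have "F (- 1) x \<noteq> F (- i) y" if "i \<in> {- 1, 0, 1}" for i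
      using j that by (auto simp: F_eq_iff[OF assms(1)])
    then show thesis
      using that[of "- 1"] by blast
  next
    case False
    have pos: "y \<noteq> F j x" if "0 < j" for j
      using False that by blast
    have "F 1 x \<noteq> F (- i) y" if i: "i \<in> {- 1, 0, 1}" for i
    proof
      assume "F 1 x = F (- i) y"
      then have "F i (F 1 x) = F i (F (- i) y)"
        by simp
      then have "y = F (i + 1) x"
        by simp
      then show False
        using pos[of 1] pos[of 2] assms(3) i by auto
    qed
    then show thesis
      using that[of 1] by blast
  qed
  let ?z = "F c x"
  have z: "?z \<in> T"
    using assms(1) by simp
  obtain W1 where W1: "clopen W1" "?z \<in> W1" "free (W1 \<times> {- 1, 0, 1})"
    using free_Times_nbhd[OF z, of "{- 1, 0, 1}"] by (metis finite.emptyI finite.insertI)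
  have "?z \<notin> (\<lambda>i. F (- i) y) ` {- 1, 0, 1}"
    using c(2) by blast
  then obtain W2 where W2: "clopen W2" "?z \<in> W2" "W2 \<inter> (\<lambda>i. F (- i) y) ` {- 1, 0, 1} = {}"
    using clopen_separate[OF z, of "(\<lambda>i. F (- i) y) ` {- 1, 0, 1}"] by (metis finite.emptyI finite.insertI finite_imageI)
  let ?W = "W1 \<inter> W2"
  have fr: "free (?W \<times> {- 1, 0, 1})"
    using W1(3) by (rule free_Times_subset) auto
  have zW: "?z \<in> ?W"
    using W1 W2 by blast
  have vals: "gamma ?W (F (- 1) ?z) = F 0 ?z" "gamma ?W (F 1 ?z) = F (- 1) ?z"
    unfolding gamma_def using cycle3_values[OF fr _ _ _ zW] by simp_all
  show thesis
  proof (rule that[of "gamma ?W"])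
    show "gamma ?W \<in> gammas"
      unfolding gammas_def using fr clopen_Int[OF W1(1) W2(1)] by blast
    show "gamma ?W x \<noteq> x"
      using c(1)
    proof
      assume "c = 1"
      then have "gamma ?W x = F 1 x"
        using vals(1) by simp
      then show ?thesis
        using F_aperiodic[OF assms(1), of 1] by (metis zero_neq_one)
    next
      assume "c = - 1"
      then have "gamma ?W x = F (- 2) x"
        using vals(2) by simp
      then show ?thesis
        using F_aperiodic[OF assms(1), of "- 2"] by (metis neg_equal_0_iff_equal zero_neq_numeral)
    qed
    show "gamma ?W y = y"
      unfolding gamma_def cycle3_def
    proof (rule tower_out)
      fix b and i :: int assume bi: "(b, i) \<in> ?W \<times> {- 1, 0, 1}"
      show "F i b \<noteq> y"
      proof
        assume "F i b = y"
        then have "b = F (- i) y"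
          by auto
        then show False
          using W2(3) bi by blast
      qed
    qed
  qed
qed

lemma separating_of_finitely_generated:
  assumes S: "finite S" "S \<subseteq> full" "generate G S = generate G gammas"
  obtains lab where "separating lab"
proof -
  have "\<forall>s\<in>S. \<exists>n. locally_constant n \<and> (\<forall>x\<in>T. s x = F (n x) x)"
    using S(2) unfolding full_def by blast
  then obtain n where n: "\<And>s. s \<in> S \<Longrightarrow> locally_constant (n s)" "\<And>s x. s \<in> S \<Longrightarrow> x \<in> T \<Longrightarrow> s x = F (n s x) x"
    by metis
  define f where "f x = (\<lambda>s\<in>S. n s x)" for x
  have f: "locally_constant f"
    using locally_constant_finite[OF S(1) n(1)] by (simp add: f_def[abs_def])
  \<comment> \<open>The tuple of cocycle values takes finitely many values, coded here as numbers
    because labels are naturals.\<close>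
  obtain e :: "_ \<Rightarrow> nat" where e: "inj_on e (f ` T)"
    using finite_imp_inj_to_nat_seg[OF locally_constant_finite_range[OF f]] by blast
  define lab where "lab x = e (f x)" for x
  define sim where "sim x y \<longleftrightarrow> x \<in> T \<and> y \<in> T \<and> (\<forall>k. lab (F k x) = lab (F k y))" for x y
  have sim_F: "sim (F k x) (F k y)" if "sim x y" for k x y
    using that unfolding sim_def by simp
  have sim_n: "n s x = n s y" if "sim x y" "s \<in> S" for s x y
  proof -
    have "e (f x) = e (f y)" "x \<in> T" "y \<in> T"
      using that(1) unfolding sim_def lab_def by (auto dest: spec[of _ 0])
    then have "f x = f y"
      using e by (auto dest: inj_onD)
    then show ?thesis
      using that(2) unfolding f_def by (metis restrict_apply')
  qed
  \<comment> \<open>Equal itineraries force equal displacements under every word in the generators,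
    because \<open>sim\<close> is preserved by translation along orbits.\<close>
  have gen: "\<exists>k. g x = F k x \<and> g y = F k y" if "g \<in> generate G S" "sim x y" for g x y
    using that
  proof (induction arbitrary: x y rule: generate.induct)
    case one
    show ?case
      by (rule exI[of _ 0]) simp
  next
    case (incl s)
    then show ?case
      using n(2) sim_n unfolding sim_def by metis
  next
    case (inv s)
    then have s: "s \<in> full" "inv\<^bsub>G\<^esub> s = inv_into UNIV s"
      using S(2) inv_G by auto
    let ?u = "inv_into UNIV s x"
    have xy: "x \<in> T" "y \<in> T"
      using inv(2) by (simp_all add: sim_def)
    have u: "?u \<in> T"
      using full_in[OF full_inv[OF s(1)]] xy(1) by blast
    have sx: "x = F (n s ?u) ?u"
      using n(2)[OF inv(1) u] full_inverse(2)[OF s(1), of x] by simp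
    define k where "k = - n s ?u"
    have ux: "?u = F k x"
      unfolding k_def by (subst (2) sx) simp
    \<comment> \<open>The inverse of \<open>s\<close> is read off at the preimages, whose
      itineraries agree too.\<close>
    have "n s (F k x) = n s (F k y)"
      by (rule sim_n[OF sim_F[OF inv(2)] inv(1)])
    moreover have "n s (F k x) = - k"
      using k_def ux by (metis minus_minus)
    ultimately have "s (F k y) = F (- k) (F k y)"
      using n(2)[OF inv(1), of "F k y"] xy(2) by simp
    then have "s (F k y) = y"
      by simp
    then have "inv_into UNIV s y = F k y"
      using full_inverse(1)[OF s(1), of "F k y"] by simp
    then show ?case
      using ux s(2) by auto
  next
    case (eng h1 h2)
    obtain k where k: "h2 x = F k x" "h2 y = F k y"
      using eng.IH(2)[OF eng.prems] by blast
    obtain j where "h1 (F k x) = F j (F k x)" "h1 (F k y) = F j (F k y)"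
      using eng.IH(1)[OF sim_F[OF eng.prems]] by blast
    then show ?case
      using k by auto
  qed
  have "separating lab"
    unfolding separating_def
  proof (intro conjI ballI impI)
    show "locally_constant lab"
      using locally_constant_compose[OF f, of e] by (simp add: lab_def[abs_def])
    fix x y assume xy: "x \<in> T" "y \<in> T" "\<forall>k. lab (F k x) = lab (F k y)"
    show "x = y"
    proof (rule ccontr)
      assume "x \<noteq> y"
      then obtain g where g: "g \<in> gammas" "g x \<noteq> x" "g y = y"
        using gamma_moves[OF xy(1,2)] by metis
      have "g \<in> generate G S"
        unfolding S(3) using g(1) by (rule generate.incl)
      then obtain k where "g x = F k x" "g y = F k y"
        using gen[of g x y] xy unfolding sim_def by blast
      \<comment> \<open>Fixing \<open>y\<close> forces \<open>k = 0\<close> by aperiodicity, which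
        would also fix \<open>x\<close>.\<close>
      then have "F k y = y" "F k x \<noteq> x"
        using g by auto
      then show False
        using F_aperiodic[OF xy(2), of k] by simp
    qed
  qed
  then show thesis
    by (rule that)
qed

subsection \<open>The index map as a flow\<close>

text \<open>A cluster point, in the compact space of functions from sets to \<open>[0, 1]\<close>, of the visit frequencies
  along an orbit.\<close>

lemma invariant_mean:
  obtains m :: "'a set \<Rightarrow> real" where "\<And>A. 0 \<le> m A" "m T = 1"
    "\<And>A B. A \<inter> B = {} \<Longrightarrow> m (A \<union> B) = m A + m B" "\<And>A. m {y \<in> T. F 1 y \<in> A} = m A"
proof -
  obtain x where x: "x \<in> T"
    using T_nonempty by blast
  define a :: "nat \<Rightarrow> 'a set \<Rightarrow> real" where
    "a N A = real (card {k \<in> {..<N}. F (int k) x \<in> A}) / real N" for N A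
  define K :: "('a set \<Rightarrow> real) set" where "K = {f. \<forall>A. f A \<in> {0..1}}"
  have "compactin (product_topology (\<lambda>_::'a set. euclidean :: real topology) UNIV) (PiE UNIV (\<lambda>_. {0..1}))"
    by (subst compactin_PiE) auto
  moreover have "PiE UNIV (\<lambda>_::'a set. {0..1::real}) = K"
    by (auto simp: K_def PiE_def Pi_def)
  ultimately have K: "compact K"
    by (simp add: euclidean_product_topology)
  have aK: "a N \<in> K" for N
  proof -
    have "card {k \<in> {..<N}. F (int k) x \<in> A} \<le> card {..<N}" for A
      by (rule card_mono) auto
    then have "real (card {k \<in> {..<N}. F (int k) x \<in> A}) \<le> real N" for A
      by simp
    then show ?thesis
      by (auto simp: K_def a_def divide_le_eq_1)
  qed
  \<comment> \<open>The product over all sets is not sequentially compact, so the cluster point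
    comes from the finite intersection property of the closed sets that eventually contain the
    frequencies.\<close>
  define \<F> where "\<F> = {C. closed C \<and> eventually (\<lambda>N. a N \<in> C) sequentially}"
  have "K \<inter> \<Inter>\<F> \<noteq> {}"
  proof (rule compact_imp_fip[OF K])
    fix \<F>' assume fin: "finite \<F>'" and sub: "\<F>' \<subseteq> \<F>"
    have "\<forall>C\<in>\<F>'. eventually (\<lambda>N. a N \<in> C) sequentially"
      using sub unfolding \<F>_def by blast
    with fin have "eventually (\<lambda>N. \<forall>C\<in>\<F>'. a N \<in> C) sequentially"
      by (rule eventually_ball_finite)
    then obtain N where "\<forall>C\<in>\<F>'. a N \<in> C"
      unfolding eventually_sequentially by blast
    then show "K \<inter> \<Inter>\<F>' \<noteq> {}"
      using aK by blast
  qed (simp add: \<F>_def)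
  then obtain m where m: "m \<in> K" "\<And>C. C \<in> \<F> \<Longrightarrow> m \<in> C"
    by blast
  \<comment> \<open>Closed conditions on the frequencies pass to \<open>m\<close>. The index 0 is
    excluded because division by zero makes \<open>a 0\<close> vanish.\<close>
  have in_C: "P m" if "closed {f. P f}" "\<And>N. 0 < N \<Longrightarrow> P (a N)" for P
  proof -
    have "eventually (\<lambda>N. a N \<in> {f. P f}) sequentially"
      using eventually_gt_at_top[of "0::nat"] by (rule eventually_mono) (simp add: that(2))
    then show ?thesis
      using m(2)[of "{f. P f}"] that(1) unfolding \<F>_def by blast
  qed
  show thesis
  proof (rule that)
    show "0 \<le> m A" for A
      using m(1) by (simp add: K_def)
    show "m T = 1"
    proof (rule in_C)
      show "closed {f :: 'a set \<Rightarrow> real. f T = 1}"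
        by (intro closed_Collect_eq continuous_on_product_coordinates continuous_on_const)
      show "a N T = 1" if "0 < N" for N
        using that x by (simp add: a_def)
    qed
    show "m (A \<union> B) = m A + m B" if "A \<inter> B = {}" for A B
    proof (rule in_C)
      show "closed {f :: 'a set \<Rightarrow> real. f (A \<union> B) = f A + f B}"
        by (intro closed_Collect_eq continuous_on_add continuous_on_product_coordinates)
      show "a N (A \<union> B) = a N A + a N B" for N
      proof -
        have "{k \<in> {..<N}. F (int k) x \<in> A \<union> B} = {k \<in> {..<N}. F (int k) x \<in> A} \<union> {k \<in> {..<N}. F (int k) x \<in> B}"
          by auto
        moreover have "{k \<in> {..<N}. F (int k) x \<in> A} \<inter> {k \<in> {..<N}. F (int k) x \<in> B} = {}"
          using that by auto
        ultimately have "card {k \<in> {..<N}. F (int k) x \<in> A \<union> B} = card {k \<in> {..<N}. F (int k) x \<in> A} + card {k \<in> {..<N}. F (int k) x \<in> B}"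
          by (simp add: card_Un_disjoint)
        then show ?thesis
          unfolding a_def by (simp add: add_divide_distrib)
      qed
    qed
    show "m {y \<in> T. F 1 y \<in> A} = m A" for A
    proof -
      let ?A = "{y \<in> T. F 1 y \<in> A}"
      \<comment> \<open>Translation changes the count by at most one, so invariance holds for the
        frequencies only up to an error that vanishes in the limit.\<close>
      have diff: "\<bar>a N ?A - a N A\<bar> \<le> 1 / real N" for N
      proof -
        let ?S = "{k \<in> {..<N}. F (int k) x \<in> A}" and ?S' = "{k \<in> {..<N}. F (int k) x \<in> ?A}"
        have "Suc ` ?S' \<subseteq> insert N ?S"
          by (auto simp: less_Suc_eq_le le_less)
        then have "card (Suc ` ?S') \<le> card (insert N ?S)"
          by (rule card_mono[rotated]) simp
        then have 1: "card ?S' \<le> card ?S + 1"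
          by (simp add: card_image)
        have "?S \<subseteq> insert 0 (Suc ` ?S')"
        proof
          fix k assume k: "k \<in> ?S"
          show "k \<in> insert 0 (Suc ` ?S')"
            using k x by (cases k) auto
        qed
        then have "card ?S \<le> card (insert 0 (Suc ` ?S'))"
          by (rule card_mono[rotated]) simp
        then have 2: "card ?S \<le> card ?S' + 1"
          by (simp add: card_image)
        have "\<bar>real (card ?S') - real (card ?S)\<bar> \<le> 1"
          using 1 2 by linarith
        then have "\<bar>real (card ?S') - real (card ?S)\<bar> / real N \<le> 1 / real N"
          by (rule divide_right_mono) simp
        then show ?thesis
          unfolding a_def by (simp add: diff_divide_distrib[symmetric])
      qed
      have "\<bar>m ?A - m A\<bar> \<le> e" if e: "e > 0" for e
      proof -
        have "closed {f :: 'a set \<Rightarrow> real. \<bar>f ?A - f A\<bar> \<le> e}"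
          by (intro closed_Collect_le continuous_intros continuous_on_product_coordinates)
        moreover have "eventually (\<lambda>N. \<bar>a N ?A - a N A\<bar> \<le> e) sequentially"
        proof -
          have "eventually (\<lambda>N. 1 / real N < e) sequentially"
            using order_tendstoD(2)[OF lim_1_over_n e] by simp
          then show ?thesis
          proof (rule eventually_mono)
            show "\<bar>a N ?A - a N A\<bar> \<le> e" if "1 / real N < e" for N
              using diff[of N] that by linarith
          qed
        qed
        ultimately show ?thesis
          using m(2)[of "{f. \<bar>f ?A - f A\<bar> \<le> e}"] unfolding \<F>_def mem_Collect_eq by blast
      qed
      then have "\<bar>m ?A - m A\<bar> \<le> 0"
        by (rule field_le_epsilon) simp
      then show ?thesis
        by simp
    qed
  qed
qed

text \<open>An open set is a countable union of closed sets by metrizability. Each of these is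
  compact, so it fits into a clopen subset of the open set, which is therefore a countable union of
  clopen sets.\<close>

lemma sigma_sets_clopen: "sigma_sets T {U. clopen U} = sigma_sets T {U. openin X U}"
proof
  show "sigma_sets T {U. clopen U} \<subseteq> sigma_sets T {U. openin X U}"
    by (rule sigma_sets_mono') (auto simp: clopen_def)
  show "sigma_sets T {U. openin X U} \<subseteq> sigma_sets T {U. clopen U}"
  proof (rule sigma_sets_mono, rule subsetI)
    fix U assume "U \<in> {U. openin X U}"
    then have U: "openin X U"
      by simp
    then obtain C :: "nat \<Rightarrow> 'a set" where C: "\<And>n. closedin X (C n)" "\<Union>(range C) = U"
      using open_imp_fsigma_in[OF metrizable_X] unfolding fsigma_in_ascending by metis
    have "\<exists>K. clopen K \<and> C n \<subseteq> K \<and> K \<subseteq> U" for n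
    proof -
      have "\<forall>x\<in>C n. \<exists>W. clopen W \<and> x \<in> W \<and> W \<subseteq> U"
        using clopen_base[OF U] C(2) by blast
      then obtain W where W: "\<And>x. x \<in> C n \<Longrightarrow> clopen (W x) \<and> x \<in> W x \<and> W x \<subseteq> U"
        by metis
      have "compactin X (C n)"
        using C(1) compact_X closedin_compact_space by blast
      moreover have "\<forall>A\<in>W ` C n. openin X A" "C n \<subseteq> \<Union>(W ` C n)"
        using W unfolding clopen_def by auto
      ultimately have "\<exists>\<F>. finite \<F> \<and> \<F> \<subseteq> W ` C n \<and> C n \<subseteq> \<Union>\<F>"
        unfolding compactin_def by auto
      then obtain S where S: "finite S" "S \<subseteq> C n" "C n \<subseteq> (\<Union>x\<in>S. W x)"
        by (metis finite_subset_image)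
      have "clopen (\<Union>x\<in>S. W x)"
        using S W by (intro clopen_Union) auto
      moreover have "(\<Union>x\<in>S. W x) \<subseteq> U"
        using S W by blast
      ultimately show ?thesis
        using S(3) by blast
    qed
    then obtain K where K: "\<And>n. clopen (K n) \<and> C n \<subseteq> K n \<and> K n \<subseteq> U"
      by metis
    have "U = (\<Union>n. K n)"
    proof
      show "U \<subseteq> (\<Union>n. K n)"
        using C(2) K by blast
      show "(\<Union>n. K n) \<subseteq> U"
        using K by blast
    qed
    moreover have "(\<Union>n. K n) \<in> sigma_sets T {U. clopen U}"
      by (rule sigma_sets.Union) (use K in \<open>auto intro: sigma_sets.Basic\<close>)
    ultimately show "U \<in> sigma_sets T {U. clopen U}"
      by simp
  qed
qed

text \<open>This gives continuity at the empty set, which is what turns a finitely additive mean on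
  clopen sets into a premeasure.\<close>

lemma decreasing_clopens_empty:
  assumes A: "\<And>i. clopen (A i)" "decseq A" "(\<Inter>i. A i) = {}"
  shows "eventually (\<lambda>i. A i = {}) sequentially"
proof -
  have "\<forall>x\<in>T. \<exists>i. x \<notin> A i"
    using A(3) by blast
  then obtain i :: "'a \<Rightarrow> nat" where i: "\<And>x. x \<in> T \<Longrightarrow> x \<notin> A (i x)"
    by metis
  have "clopen (T - A (i x)) \<and> x \<in> T - A (i x)" if "x \<in> T" for x
    using i[OF that] that A(1) by (auto intro: clopen_Diff)
  then obtain S where S: "finite S" "S \<subseteq> T" "T \<subseteq> (\<Union>x\<in>S. T - A (i x))"
    using clopen_cover[OF clopen_T, of "\<lambda>x. T - A (i x)"] by metis
  have "A n = {}" if n: "Max (insert 0 (i ` S)) \<le> n" for n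
  proof (rule ccontr)
    assume "A n \<noteq> {}"
    then obtain y where y: "y \<in> A n"
      by blast
    then obtain x where x: "x \<in> S" "y \<notin> A (i x)"
      using S(3) clopen_subset[OF A(1)] by blast
    have "i x \<le> Max (insert 0 (i ` S))"
      using S(1) x(1) by (intro Max_ge) auto
    then have "A n \<subseteq> A (i x)"
      using n A(2) by (auto simp: decseq_def)
    then show False
      using x(2) y by blast
  qed
  then show ?thesis
    using eventually_sequentially by blast
qed

text \<open>The mean is merely finitely additive, but on the ring of clopen sets Caratheodory's
  extension theorem applies to it.\<close>

lemma invariant_measure_exists:
  obtains \<mu> where "invariant_prob_measure X \<phi> \<mu>"
proof (rule invariant_mean)
  fix m :: "'a set \<Rightarrow> real" assume m: "\<And>A. 0 \<le> m A" "m T = 1"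
    "\<And>A B. A \<inter> B = {} \<Longrightarrow> m (A \<union> B) = m A + m B" "\<And>A. m {y \<in> T. F 1 y \<in> A} = m A"
  let ?C = "{U. clopen U}"
  have m0: "m {} = 0"
    using m(3)[of "{}" "{}"] by simp
  interpret ring_of_sets T ?C
    by (rule ring_of_setsI) (auto intro: clopen_Un clopen_Diff dest: clopen_subset)
  have "\<exists>\<mu>. (\<forall>s\<in>?C. \<mu> s = ennreal (m s)) \<and> measure_space T (sigma_sets T ?C) \<mu>"
  proof (rule caratheodory_empty_continuous)
    show "positive ?C (\<lambda>s. ennreal (m s))"
      by (simp add: positive_def m0)
    show "additive ?C (\<lambda>s. ennreal (m s))"
      unfolding additive_def using m(1,3) by simp
    fix A :: "nat \<Rightarrow> 'a set" assume A: "range A \<subseteq> ?C" "decseq A" "(\<Inter>i. A i) = {}"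
    have "eventually (\<lambda>i. A i = {}) sequentially"
      by (rule decreasing_clopens_empty) (use A in auto)
    then have "eventually (\<lambda>i. ennreal (m (A i)) = 0) sequentially"
      by (rule eventually_mono) (simp add: m0)
    then show "(\<lambda>i. ennreal (m (A i))) \<longlonglongrightarrow> 0"
      by (rule tendsto_eventually)
  qed simp
  then obtain \<mu> where \<mu>: "\<And>s. clopen s \<Longrightarrow> \<mu> s = ennreal (m s)" "measure_space T (sigma_sets T ?C) \<mu>"
    by auto
  define M where "M = measure_of T (sigma_sets T ?C) \<mu>"
  have sub: "?C \<subseteq> Pow T"
    using clopen_subset by auto
  have sets: "sets M = sigma_sets T ?C" and space: "space M = T"
  proof -
    have "sigma_sets T ?C \<subseteq> Pow T"
      using sigma_sets_into_sp[OF sub] by blast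
    then show "sets M = sigma_sets T ?C" "space M = T"
      unfolding M_def by (simp_all only: sets_measure_of space_measure_of sigma_sets_sigma_sets_eq[OF sub])
  qed
  have em: "emeasure M U = ennreal (m U)" if "clopen U" for U
    using emeasure_measure_of_sigma[of T "sigma_sets T ?C" \<mu> U] \<mu> that
    unfolding M_def measure_space_def by (simp add: sigma_sets.Basic)
  have vimage: "\<phi> -` A \<inter> T = {y \<in> T. F 1 y \<in> A}" for A
    by (auto simp: F_1)
  have clopen_vimage: "clopen (\<phi> -` U \<inter> T)" if "clopen U" for U
    unfolding vimage using that by (rule clopen_F_vimage)
  have phi: "\<phi> \<in> measurable M M"
    by (rule measurable_sigma_sets[OF sets sub])
      (use space sets clopen_vimage phi_inv(4) in \<open>auto intro: sigma_sets.Basic\<close>)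
  \<comment> \<open>Invariance is known on clopen sets, a generator stable under intersections, and
    so extends to all measurable sets.\<close>
  have "M = distr M M \<phi>"
  proof (rule measure_eqI_generator_eq[where E = ?C and \<Omega> = T and A = "\<lambda>_. T"])
    show "Int_stable ?C"
      by (auto simp: Int_stable_def clopen_Int)
    show "emeasure M U = emeasure (distr M M \<phi>) U" if "U \<in> ?C" for U
    proof -
      have "emeasure (distr M M \<phi>) U = emeasure M (\<phi> -` U \<inter> T)"
        using that sets by (subst emeasure_distr[OF phi]) (auto simp: space intro: sigma_sets.Basic)
      then show ?thesis
        using that em clopen_vimage m(4)[of U] by (simp add: vimage)
    qed
    show "emeasure M T \<noteq> \<infinity>"
      using em[of T] by simp
  qed (use sub sets in auto)
  then have inv: "emeasure M (\<phi> -` A \<inter> T) = emeasure M A" if "A \<in> sets M" for A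
    using emeasure_distr[OF phi that] by (simp add: space)
  have "prob_space M"
    by (rule prob_spaceI) (simp add: space em m(2))
  then have "invariant_prob_measure X \<phi> M"
    unfolding invariant_prob_measure_def using space sets sigma_sets_clopen inv by simp
  then show thesis
    by (rule that)
qed

lemma invariant_measure_F:
  assumes \<mu>: "invariant_prob_measure X \<phi> \<mu>" and "clopen A"
  shows "measure \<mu> {x \<in> T. F k x \<in> A} = measure \<mu> A"
proof -
  have clopen_sets: "U \<in> sets \<mu>" if "clopen U" for U
    using that \<mu> unfolding invariant_prob_measure_def clopen_def by (auto intro: sigma_sets.Basic)
  have one: "measure \<mu> {x \<in> T. F 1 x \<in> U} = measure \<mu> U" if "clopen U" for U
  proof -
    have "{x \<in> T. F 1 x \<in> U} = \<phi> -` U \<inter> T"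
      by (auto simp: F_1)
    then show ?thesis
      using \<mu> clopen_sets[OF that] unfolding invariant_prob_measure_def measure_def by simp
  qed
  show ?thesis
    using \<open>clopen A\<close>
  proof (induction k arbitrary: A rule: int_induct[where k = 0])
    case base
    have "{x \<in> T. x \<in> A} = A"
      using clopen_subset[OF base] by blast
    then show ?case
      by simp
  next
    case (step1 i)
    have eq: "{x \<in> T. F (i + 1) x \<in> A} = {x \<in> T. F i x \<in> {y \<in> T. F 1 y \<in> A}}"
      by (auto simp: add.commute)
    show ?case
      by (simp only: eq step1(2)[OF clopen_F_vimage[OF step1(3)]] one[OF step1(3)])
  next
    case (step2 i)
    let ?A = "{y \<in> T. F (- 1) y \<in> A}"
    have A: "clopen ?A"
      by (rule clopen_F_vimage[OF step2(3)])
    have eq: "{x \<in> T. F (i - 1) x \<in> A} = {x \<in> T. F i x \<in> ?A}"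
      by auto
    have "{x \<in> T. F 1 x \<in> ?A} = A"
      using clopen_subset[OF step2(3)] by auto
    then have "measure \<mu> ?A = measure \<mu> A"
      using one[OF A] by simp
    then show ?case
      by (simp only: eq step2(2)[OF A])
  qed
qed

text \<open>The flow is a sum of indicators of \<open>{x. 0 \<le> j + n (F j x)}\<close>; by invariance dropping the \<open>F j\<close> does not
  change the integral, and then the sum counts \<open>n x\<close>.\<close>

lemma integral_cocycle:
  assumes g: "g \<in> full" "locally_constant n" "\<And>x. x \<in> T \<Longrightarrow> g x = F (n x) x"
    and N: "\<And>x. x \<in> T \<Longrightarrow> \<bar>n x\<bar> < N" and x: "x \<in> T"
    and \<mu>: "invariant_prob_measure X \<phi> \<mu>"
  shows "(\<integral>x. real_of_int (orbit_cocycle X \<phi> g x) \<partial>\<mu>) = real_of_int (flow N n x)"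
proof -
  have prob: "prob_space \<mu>" and space: "space \<mu> = T" and sets: "sets \<mu> = sigma_sets T {U. openin X U}"
    using \<mu> unfolding invariant_prob_measure_def by blast+
  interpret prob_space \<mu>
    by (rule prob)
  have clopen_sets: "U \<in> sets \<mu>" if "clopen U" for U
    using that unfolding sets clopen_def by (auto intro: sigma_sets.Basic)
  let ?J = "{- N..<N}"
  define A where "A j = {y \<in> T. 0 \<le> j + n y}" for j
  define B where "B j = {y \<in> T. F j y \<in> A j}" for j
  have A: "clopen (A j)" for j
    unfolding A_def by (rule clopen_locally_constant[OF g(2)])
  have B: "clopen (B j)" for j
    unfolding B_def by (rule clopen_F_vimage[OF A])
  have N0: "0 < N"
    using N[OF x] by linarith
  \<comment> \<open>The cocycle selected by \<open>SOME\<close> agrees with \<open>n\<close> on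
    \<open>T\<close> by aperiodicity.\<close>
  have cocycle: "orbit_cocycle X \<phi> g y = n y" if "y \<in> T" for y
  proof -
    have "is_orbit_cocycle X \<phi> g (orbit_cocycle X \<phi> g)"
      unfolding orbit_cocycle_def by (rule someI[of _ n]) (simp add: orbit_cocycle_iff g)
    then have "F (orbit_cocycle X \<phi> g y) y = F (n y) y"
      using that g(3) unfolding orbit_cocycle_iff by metis
    then show ?thesis
      using F_eq_iff[OF that] by blast
  qed
  have count: "real (card {j \<in> ?J. P j}) = (\<Sum>j\<in>?J. if P j then 1 else 0)" for P
    by (simp add: sum.If_cases Int_def)
  have int_n: "real_of_int (n y) = (\<Sum>j\<in>?J. indicator (A j) y) - real_of_int N" if y: "y \<in> T" for y
  proof -
    have "{j \<in> ?J. 0 \<le> j + n y} = {- n y..<N}"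
      using N[OF y] by auto
    then have "real (card {j \<in> ?J. 0 \<le> j + n y}) = real_of_int (n y) + real_of_int N"
      using N[OF y] by simp
    moreover have "(\<Sum>j\<in>?J. indicator (A j) y) = real (card {j \<in> ?J. 0 \<le> j + n y})"
      unfolding count by (rule sum.cong) (auto simp: A_def indicator_def y)
    ultimately show ?thesis
      by simp
  qed
  have int_flow: "real_of_int (flow N n y) = (\<Sum>j\<in>?J. indicator (B j) y) - real_of_int N" if y: "y \<in> T" for y
  proof -
    have "(\<Sum>j\<in>?J. indicator (B j) y) = real (card {j \<in> ?J. 0 \<le> j + n (F j y)})"
      unfolding count by (rule sum.cong) (auto simp: A_def B_def indicator_def y)
    then show ?thesis
      by (simp add: flow_def)
  qed
  have integral: "(\<integral>y. (\<Sum>j\<in>?J. indicator (C j) y) - real_of_int N \<partial>\<mu>) = (\<Sum>j\<in>?J. measure \<mu> (C j)) - real_of_int N"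
    if "\<And>j. clopen (C j)" for C
  proof -
    have int: "integrable \<mu> (indicator (C j) :: 'a \<Rightarrow> real)" for j
      using clopen_sets[OF that] by (simp add: emeasure_eq_measure)
    have "(\<integral>y. (\<Sum>j\<in>?J. indicator (C j) y) - real_of_int N \<partial>\<mu>) = (\<Sum>j\<in>?J. \<integral>y. indicator (C j) y \<partial>\<mu>) - real_of_int N"
      using int by (subst Bochner_Integration.integral_diff) (auto simp: prob_space intro!: Bochner_Integration.integral_sum)
    also have "\<dots> = (\<Sum>j\<in>?J. measure \<mu> (C j)) - real_of_int N"
      using clopen_subset[OF that] by (simp add: space Int_absorb2)
    finally show ?thesis .
  qed
  have "(\<integral>x. real_of_int (orbit_cocycle X \<phi> g x) \<partial>\<mu>) = (\<integral>y. (\<Sum>j\<in>?J. indicator (A j) y) - real_of_int N \<partial>\<mu>)"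
    by (rule Bochner_Integration.integral_cong) (simp_all add: space cocycle int_n)
  also have "\<dots> = (\<Sum>j\<in>?J. measure \<mu> (A j)) - real_of_int N"
    by (rule integral[OF A])
  also have "\<dots> = (\<Sum>j\<in>?J. measure \<mu> (B j)) - real_of_int N"
    unfolding B_def using invariant_measure_F[OF \<mu> A] by simp
  also have "\<dots> = (\<integral>y. (\<Sum>j\<in>?J. indicator (B j) y) - real_of_int N \<partial>\<mu>)"
    by (rule integral[OF B, symmetric])
  also have "\<dots> = (\<integral>y. real_of_int (flow N n x) \<partial>\<mu>)"
  proof (rule Bochner_Integration.integral_cong)
    fix y assume "y \<in> space \<mu>"
    then have y: "y \<in> T"
      by (simp add: space)
    have "g permutes T"
      using g(1) by (simp add: full_def)
    then have "flow N n x = flow N n y"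
      using flow_const[OF _ g(2,3) N x y] by blast
    then show "(\<Sum>j\<in>?J. indicator (B j) y) - real_of_int N = real_of_int (flow N n x)"
      using int_flow[OF y] by simp
  qed simp
  also have "\<dots> = real_of_int (flow N n x)"
    by (simp add: prob_space)
  finally show ?thesis .
qed

text \<open>The integral has this value for every invariant measure; the existence of one makes the
  integer in \<open>THE\<close> unique.\<close>

lemma index_map_flow:
  assumes g: "g \<in> full" "locally_constant n" "\<And>x. x \<in> T \<Longrightarrow> g x = F (n x) x"
    and N: "\<And>x. x \<in> T \<Longrightarrow> \<bar>n x\<bar> < N" and x: "x \<in> T"
  shows "index_map X \<phi> g = flow N n x"
  unfolding index_map_def
proof (rule the_equality)
  show "\<forall>\<mu>. invariant_prob_measure X \<phi> \<mu> \<longrightarrow>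
      real_of_int (flow N n x) = (\<integral>x. real_of_int (orbit_cocycle X \<phi> g x) \<partial>\<mu>)"
    using integral_cocycle[OF g N x] by simp
  fix i assume i: "\<forall>\<mu>. invariant_prob_measure X \<phi> \<mu> \<longrightarrow>
      real_of_int i = (\<integral>x. real_of_int (orbit_cocycle X \<phi> g x) \<partial>\<mu>)"
  obtain \<mu> where "invariant_prob_measure X \<phi> \<mu>"
    using invariant_measure_exists by blast
  then have "real_of_int i = real_of_int (flow N n x)"
    using i integral_cocycle[OF g N x] by metis
  then show "i = flow N n x"
    by simp
qed

lemma index_kernel_eq: "index_kernel X \<phi> = zero_flow"
proof (rule Set.set_eqI)
  fix g
  obtain x0 where x0: "x0 \<in> T"
    using T_nonempty by blast
  have "g \<in> index_kernel X \<phi> \<longleftrightarrow> g \<in> full \<and> index_map X \<phi> g = 0"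
    by (simp add: index_kernel_def kernel_def)
  also have "\<dots> \<longleftrightarrow> g \<in> zero_flow"
  proof
    assume g: "g \<in> full \<and> index_map X \<phi> g = 0"
    then obtain n where n: "locally_constant n" "\<And>x. x \<in> T \<Longrightarrow> g x = F (n x) x"
      using fullE by metis
    obtain N where N: "\<And>x. x \<in> T \<Longrightarrow> \<bar>n x\<bar> < N"
      using locally_constant_bounded[OF n(1)] by metis
    have "flow N n x = 0" if "x \<in> T" for x
      using index_map_flow[OF _ n N that] g by simp
    then have "\<forall>x\<in>T. g x = F (n x) x \<and> \<bar>n x\<bar> < N \<and> flow N n x = 0"
      using n(2) N by blast
    then show "g \<in> zero_flow"
      using g n(1) unfolding zero_flow_def by blast
  next
    assume "g \<in> zero_flow"
    then have g: "g \<in> full" and "\<exists>n N. locally_constant n \<and> (\<forall>x\<in>T. g x = F (n x) x \<and> \<bar>n x\<bar> < N \<and> flow N n x = 0)"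
      unfolding zero_flow_def by blast+
    then obtain n N where n: "locally_constant n" "\<forall>x\<in>T. g x = F (n x) x \<and> \<bar>n x\<bar> < N \<and> flow N n x = 0"
      by (elim exE conjE)
    have n': "g x = F (n x) x" "\<bar>n x\<bar> < N" "flow N n x = 0" if "x \<in> T" for x
      using bspec[OF n(2) that] by blast+
    have "index_map X \<phi> g = 0"
      using index_map_flow[OF g n(1) n'(1,2) x0] n'(3)[OF x0] by simp
    then show "g \<in> full \<and> index_map X \<phi> g = 0"
      using g by simp
  qed
  finally show "g \<in> index_kernel X \<phi> \<longleftrightarrow> g \<in> zero_flow" .
qed

subsection \<open>Subshifts\<close>

text \<open>The itinerary map is continuous and injective from a compact to a Hausdorff space, hence
  a homeomorphism onto a closed set of sequences, and it turns \<phi> into the shift.\<close>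

lemma conjugate_of_separating:
  assumes lab: "separating lab"
  shows "conjugate_to_minimal_subshift X \<phi>"
proof -
  define A where "A = lab ` T"
  define h where "h x = (\<lambda>k. lab (F k x))" for x
  define S where "S = h ` T"
  have lc: "locally_constant lab"
    using lab by (simp add: separating_def)
  have finA: "finite A"
    unfolding A_def by (rule locally_constant_finite_range[OF lc])
  have top: "topspace (full_shift A) = {x. \<forall>k. x k \<in> A}"
    by (auto simp: full_shift_def PiE_def Pi_def)
  have cont: "continuous_map X (full_shift A) h"
    unfolding full_shift_def continuous_map_componentwise_UNIV
  proof
    fix k
    have "openin X {x \<in> T. h x k \<in> U}" for U
      using clopen_locally_constant[OF locally_constant_F[OF lc], of "\<lambda>l. l \<in> U" k]
      by (simp add: clopen_def h_def)
    moreover have "h x k \<in> A" if "x \<in> T" for x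
      unfolding h_def A_def using that by (intro imageI) simp
    ultimately show "continuous_map X (discrete_topology A) (\<lambda>x. h x k)"
      by (auto simp: continuous_map_def)
  qed
  have Haus: "Hausdorff_space (full_shift A)"
    by (simp add: full_shift_def Hausdorff_space_product_topology)
  have "compactin (full_shift A) S"
    unfolding S_def using compact_X cont image_compactin compact_space_def by blast
  then have closed: "closedin (full_shift A) S"
    using Haus compactin_imp_closedin by blast
  let ?Y = "subtopology (full_shift A) S"
  have topY: "topspace ?Y = S"
    using closedin_subset[OF closed] by (auto simp: topspace_subtopology)
  have homeo: "homeomorphic_map X ?Y h"
  proof (rule continuous_imp_homeomorphic_map)
    show "continuous_map X ?Y h"
      using cont by (auto simp: continuous_map_in_subtopology S_def)
    show "Hausdorff_space ?Y"
      using Haus by (rule Hausdorff_space_subtopology)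
    show "h ` T = topspace ?Y"
      unfolding topY by (rule S_def[symmetric])
    show "inj_on h T"
    proof (rule inj_onI)
      fix x y assume xy: "x \<in> T" "y \<in> T" "h x = h y"
      then have "\<forall>k. lab (F k x) = lab (F k y)"
        unfolding h_def by metis
      then show "x = y"
        using lab xy unfolding separating_def by blast
    qed
  qed (rule compact_X)
  have conj: "h (\<phi> x) = shift (h x)" if "x \<in> T" for x
    using that by (auto simp: h_def shift_def fun_eq_iff simp flip: F_1)
  have "shift ` S = S"
  proof -
    have "shift ` S = h ` \<phi> ` T"
      unfolding S_def image_image using conj by (intro image_cong) auto
    also have "\<phi> ` T = T"
      using bij_phi by (simp add: bij_betw_def)
    finally show ?thesis
      by (simp add: S_def)
  qed
  then have "subshift A S"
    using finA closed by (simp add: subshift_def invariant_set_def)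
  moreover have "minimal_homeo ?Y shift"
    by (rule minimal_homeo_conjugate[of X ?Y h \<phi> shift, OF homeo _ conj])
      (use cms in \<open>auto simp: cantor_minimal_system_def\<close>)
  ultimately have "minimal_subshift A S"
    by (simp add: minimal_subshift_def)
  moreover have "conjugate X \<phi> ?Y shift"
    unfolding conjugate_def using homeo conj by blast
  ultimately show ?thesis
    unfolding conjugate_to_minimal_subshift_def by blast
qed

text \<open>The label is the letter at place 0 of the image; the labels along the orbit spell the
  whole sequence.\<close>

lemma separating_of_conjugate:
  assumes "conjugate_to_minimal_subshift X \<phi>"
  obtains lab where "separating lab"
proof -
  obtain A :: "nat set" and S where "conjugate X \<phi> (subtopology (full_shift A) S) shift"
    using assms unfolding conjugate_to_minimal_subshift_def by blast
  then obtain h where h: "homeomorphic_map X (subtopology (full_shift A) S) h"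
      "\<And>x. x \<in> T \<Longrightarrow> h (\<phi> x) = shift (h x)"
    unfolding conjugate_def by blast
  define lab where "lab x = h x 0" for x
  have hF: "h (F k x) j = h x (j + k)" if x: "x \<in> T" for k j x
  proof (induction k arbitrary: j rule: int_induct[where k = 0])
    case (step1 i)
    have "h (F (i + 1) x) j = h (F i x) (j + 1)"
      using h(2)[of "F i x"] x by (simp add: F_Suc shift_def)
    then show ?case
      using step1(2)[of "j + 1"] by (simp add: algebra_simps)
  next
    case (step2 i)
    have "h (F i x) (j - 1) = h (F (i - 1) x) j"
      using h(2)[of "F (i - 1) x"] F_Suc[OF x, of "i - 1"] x by (simp add: shift_def)
    then show ?case
      using step2(2)[of "j - 1"] by (simp add: algebra_simps)
  qed simp
  have "continuous_map X (full_shift A) h"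
    using h(1) homeomorphic_imp_continuous_map continuous_map_in_subtopology by blast
  then have "continuous_map X (discrete_topology A) (\<lambda>x. h x 0)"
    unfolding full_shift_def continuous_map_componentwise_UNIV by blast
  moreover have "continuous_map (discrete_topology A) (discrete_topology UNIV) id"
    by simp
  ultimately have "continuous_map X (discrete_topology UNIV) (id \<circ> (\<lambda>x. h x 0))"
    by (rule continuous_map_compose)
  then have "locally_constant lab"
    unfolding continuous_map_discrete_iff by (simp add: lab_def[abs_def] o_def)
  moreover have "x = y" if "x \<in> T" "y \<in> T" "\<forall>k. lab (F k x) = lab (F k y)" for x y
  proof -
    have "h x = h y"
      using that(3) hF[OF that(1), of _ 0] hF[OF that(2), of _ 0] by (simp add: lab_def fun_eq_iff)
    then show ?thesis
      using homeomorphic_imp_injective_map[OF h(1)] that by (auto dest: inj_onD)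
  qed
  ultimately have "separating lab"
    unfolding separating_def by blast
  then show thesis
    by (rule that)
qed

end

theorem theorem5p4:
  fixes X :: "'a topology" and \<phi> :: "'a \<Rightarrow> 'a"
  assumes "cantor_minimal_system X \<phi>"
  shows "finitely_generated_subgroup (topological_full_group X \<phi>)
           (derived (topological_full_group X \<phi>) (index_kernel X \<phi>))
         \<longleftrightarrow> conjugate_to_minimal_subshift X \<phi>"
proof -
  interpret cantor_minimal X \<phi>
    by unfold_locales (rule assms)
  have "finitely_generated_subgroup G (derived G (index_kernel X \<phi>)) \<longleftrightarrow>
      (\<exists>S. finite S \<and> S \<subseteq> full \<and> generate G S = generate G gammas)"
    unfolding finitely_generated_subgroup_def index_kernel_eq derived_zero_flow carrier_G ..
  also have "\<dots> \<longleftrightarrow> (\<exists>lab. separating lab)"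
    using Gamma_finitely_generated separating_of_finitely_generated by metis
  also have "\<dots> \<longleftrightarrow> conjugate_to_minimal_subshift X \<phi>"
    using conjugate_of_separating separating_of_conjugate by blast
  finally show ?thesis .
qed

end
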